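(* Let $n,N\ge 1$ be integers. Let $f_1,\dots,f_N$ be probability densities on $\mathbb{R}^n$ (with respect to Lebesgue measure), and let $X_1,\dots,X_N$, $X_1^*,\dots,X_N^*$, $Z_1,\dots,Z_N$ be independent random vectors in $\mathbb{R}^n$ on a common probability space $(\Omega,\mathcal{F},\mathbb{P})$ such that $X_i$ has density $f_i$, $X_i^*$ has density $f_i^*$ (the symmetric decreasing rearrangement of $f_i$), and $Z_i$ is uniformly distributed in $\widetilde{B}$, the Euclidean ball in $\mathbb{R}^n$ of volume one centered at the origin. Let $\mathbf{X}=[X_1\cdots X_N]$, $\mathbf{X}^*=[X_1^*\cdots X_N^*]$, $\mathbf{Z}=[Z_1\cdots Z_N]$ be the corresponding $n\times N$ random matrices. Let $C$ be a compact convex set in $\mathbb{R}^N$ and $1\le j\le n$. Then for each $\alpha\ge 0$, $$\mathbb{P}(V_j(\mathbf{X}C)>\alpha)\ \ge\ \mathbb{P}(V_j(\mathbf{X}^*C)>\alpha).$$ Moreover, if $C$ is $1$-unconditional and $\|f_i\|_\infty\le 1$ for $i=1,\dots,N$, then for each $\alpha\ge 0$, $$\mathbb{P}(V_j(\mathbf{X}C)>\alpha)\ \ge\ \mathbb{P}(V_j(\mathbf{Z}C)>\alpha).$$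
   Context: For vectors $x_1,\dots,x_N\in\mathbb{R}^n$ and $C\subseteq\mathbb{R}^N$, $[x_1\cdots x_N]C=\{\sum_{i=1}^N c_i x_i : c=(c_i)\in C\}\subseteq\mathbb{R}^n$. $V_j$ denotes the $j$-th intrinsic volume of compact convex sets in $\mathbb{R}^n$, defined by the Steiner formula $V_n(K+\varepsilon B)=\sum_{j=0}^n\omega_{n-j}V_j(K)\varepsilon^{n-j}$ for $\varepsilon>0$, where $B$ is the closed Euclidean unit ball, $V_n$ is volume, and $\omega_k$ is the volume of the Euclidean unit ball in $\mathbb{R}^k$. For a Borel set $A\subseteq\mathbb{R}^n$ of finite measure, $A^*$ is the open Euclidean ball centered at the origin with the same measure as $A$; for integrable $f:\mathbb{R}^n\to[0,\infty)$, $f^*(x)=\int_0^\infty \mathbf{1}_{\{f>t\}^*}(x)\,dt$. A set $C\subseteq\mathbb{R}^N$ is $1$-unconditional if it is invariant under reflection in each coordinate hyperplane, i.e. $(c_1,\dots,c_N)\in C$ implies $(\pm c_1,\dots,\pm c_N)\in C$ for all choices of signs. *)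

theory Defs
  imports "HOL-Probability.Probability"
begin

definition column_image :: "('m::finite \<Rightarrow> 'a::real_vector) \<Rightarrow> (real ^ 'm) set \<Rightarrow> 'a set" where
  "column_image x C = {\<Sum>i\<in>UNIV. (c $ i) *\<^sub>R x i | c. c \<in> C}"

definition outer_parallel :: "'a::euclidean_space set \<Rightarrow> real \<Rightarrow> 'a set" where
  "outer_parallel K \<epsilon> = {x + \<epsilon> *\<^sub>R b | x b. x \<in> K \<and> b \<in> cball 0 1}"

text \<open>
  The intrinsic volumes of \<open>K\<close> are the coefficients in the Steiner formula, where
  \<open>unit_ball_vol (real k)\<close> is the volume of the Euclidean unit ball in dimension \<open>k\<close>.
  A polynomial is determined by its values at all \<open>\<epsilon> > 0\<close>, so at most one sequence \<open>V\<close> satisfies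
  the condition (the clause \<open>V j = 0\<close> for \<open>j > DIM('a)\<close> only pins down the unused entries).
  By Steiner's theorem one exists for compact convex \<open>K\<close>; the value is meaningful only there.
\<close>

definition intrinsic_volume :: "nat \<Rightarrow> 'a::euclidean_space set \<Rightarrow> real" where
  "intrinsic_volume j K = (THE V :: nat \<Rightarrow> real.
     (\<forall>j > DIM('a). V j = 0) \<and>
     (\<forall>\<epsilon> > 0. measure lborel (outer_parallel K \<epsilon>) =
        (\<Sum>j\<le>DIM('a). unit_ball_vol (real (DIM('a) - j)) * V j * \<epsilon> ^ (DIM('a) - j)))) j"

text \<open>
  The set \<open>A\<^sup>*\<close>: unspecified when \<open>A\<close> has infinite measure, and empty (a ball of radius 0) when
  \<open>A\<close> is a null set.
\<close>

definition symm_ball :: "'a::euclidean_space set \<Rightarrow> 'a set" where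
  "symm_ball A = (THE S. \<exists>r\<ge>0. S = ball 0 r \<and> emeasure lborel S = emeasure lborel A)"

text \<open>
  The symmetric decreasing rearrangement takes values in \<^typ>\<open>ennreal\<close>, since the value at the
  origin is the essential supremum and may be infinite. The level \<open>t = 0\<close> is left out of the
  integration range because \<open>{x. f x > 0}\<close> may have infinite measure; for \<open>f\<close> integrable all
  other level sets have finite measure.
\<close>

definition symm_decr_rearr :: "('a::euclidean_space \<Rightarrow> real) \<Rightarrow> 'a \<Rightarrow> ennreal" where
  "symm_decr_rearr f x = (\<integral>\<^sup>+ t \<in> {0<..}. indicator (symm_ball {y. f y > t}) x \<partial>lborel)"

definition unit_volume_ball :: "'a::euclidean_space set" where
  "unit_volume_ball = (THE S. \<exists>r\<ge>0. S = cball 0 r \<and> emeasure lborel S = 1)"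

definition one_unconditional :: "(real ^ 'm::finite) set \<Rightarrow> bool" where
  "one_unconditional C \<longleftrightarrow>
     (\<forall>c\<in>C. \<forall>s :: 'm \<Rightarrow> real. (\<forall>i. s i \<in> {1, -1}) \<longrightarrow> (\<chi> i. s i * c $ i) \<in> C)"

definition prob_density :: "('a::euclidean_space \<Rightarrow> real) \<Rightarrow> bool" where
  "prob_density f \<longleftrightarrow> f \<in> borel_measurable borel \<and> (\<forall>x. 0 \<le> f x) \<and>
     (\<integral>\<^sup>+ x. ennreal (f x) \<partial>lborel) = 1"

end

theory Submission
  imports Defs
begin

text \<open>
  Let \<open>A\<close> be the set of all \<open>(x\<^sub>1, \<dots>, x\<^sub>N)\<close> with \<open>V\<^sub>j ([x\<^sub>1 \<dots> x\<^sub>N] C) \<le> \<alpha>\<close>. The first inequality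
  says that the integral of \<open>f\<^sub>1 (x\<^sub>1) \<dots> f\<^sub>N (x\<^sub>N)\<close> over \<open>A\<close> does not decrease when the densities are
  rearranged; by the layer-cake formula it suffices to treat indicator functions.

  If the points move along a common direction \<open>\<theta>\<close>, \<open>x\<^sub>i = y\<^sub>i + t\<^sub>i \<theta>\<close> with \<open>y\<^sub>i\<close> orthogonal to \<open>\<theta>\<close>, then
  \<open>V\<^sub>j\<close> is an even convex function of \<open>t\<close>, so \<open>A\<close> meets the \<open>t\<close>-space in a symmetric convex set, and the
  one-dimensional Rogers-Brascamp-Lieb-Luttinger inequality on every such fibre shows that simultaneous
  Steiner symmetrization of the sets does not decrease the integral. A direction that gains a
  definite amount of overlap with the centred balls always exists, because some translate of the
  missing part meets the superfluous part; hence the symmetrals come arbitrarily close to the balls.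
  The one-dimensional inequality follows by moving finite unions of intervals towards the origin, using
  the Prekopa-Leindler inequality, and merging intervals when they touch.

  Convexity of \<open>V\<^sub>j\<close> needs no mixed volumes. The volume of \<open>K + r [-v, v]\<close> is affine in \<open>r\<close>, so for a
  zonotope \<open>Z\<close> the volume of \<open>K + r Z\<close> is a polynomial whose coefficients are built from limits of
  \<open>vol (K + R [-v, v]) / R\<close>, and inherit monotonicity and convexity in \<open>t\<close> from the volume. Zonotopes
  approximate the ball, and coefficients of polynomials of bounded degree converge with the values; this
  yields the Steiner formula and the properties of \<open>V\<^sub>j\<close> at once.

  For unconditional \<open>C\<close> the set \<open>A\<close> is star-shaped in each variable, and among radial densities bounded by
  1 the uniform density on the ball of volume one puts the most mass on a star-shaped set: compare on each ray.
\<close>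


section \<open>One-dimensional and product Prekopa-Leindler inequality\<close>

text \<open>Prekopa-Leindler enters because the volume cut out of a symmetric convex set by a
  translated box is an even log-concave function of the centre, so it grows as the centre moves to
  the origin. Such a move scales all coordinates by one common factor; intervals in different
  coordinates cannot be moved independently, which is why the intervals travel together until the
  first contact anywhere. Evenness of \<open>V_j\<close> in \<open>t\<close> comes from the
  reflection in the hyperplane orthogonal to \<open>\<theta>\<close>; this is where orthogonality of
  the \<open>y_i\<close> is used. For \<open>V_j\<close> the obstacle is the degree. A zonotope with
  many segments gives a polynomial of large formal degree; nonnegative coefficients together with
  the growth rate \<open>r^n\<close> of the volume cut it down to \<open>n\<close>, and only then
  can the coefficients be read off from values at \<open>n + 1\<close> fixed nodes, uniformly in the
  zonotope. The events \<open>V_j > \<alpha>\<close> are handled through their complements, since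
  sublevel sets are the convex ones.\<close>

lemma cofinal_sequence:
  fixes A :: "real set"
  assumes "A \<noteq> {}"
  obtains a :: "nat \<Rightarrow> real" where "incseq a" "\<And>n. a n \<in> A" "A \<subseteq> (\<Union>n. {..a n})"
proof (cases "\<exists>m\<in>A. \<forall>x\<in>A. x \<le> m")
  case True
  then obtain m where "m \<in> A" "\<forall>x\<in>A. x \<le> m" by blast
  then show ?thesis by (intro that[of "\<lambda>_. m"]) (auto simp: incseq_def)
next
  case False
  then have gt: "\<exists>y\<in>A. y > x" if "x \<in> A" for x using that by (meson not_le)
  obtain D where D: "countable D" "D \<subseteq> A" "A \<subseteq> closure D" using separable by blast
  have "D \<noteq> {}" using D assms by auto
  define d where "d = from_nat_into D"
  have d: "range d = D" unfolding d_def using D \<open>D \<noteq> {}\<close> by (simp add: range_from_nat_into)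
  \<comment> \<open>No maximum in \<open>A\<close>: each \<open>x\<close> lies below some
    \<open>y\<close> in \<open>A\<close>, and points of \<open>D\<close> close to \<open>y\<close>
    exceed \<open>x\<close>. Running maxima over an enumeration of \<open>D\<close> therefore pass
    every \<open>x\<close>, while staying in \<open>A\<close> and increasing.\<close>
  define a where "a n = Max (d ` {..n})" for n
  have "a n \<in> A" for n
  proof -
    have "a n \<in> d ` {..n}" unfolding a_def by (intro Max_in) auto
    then show ?thesis using d D by auto
  qed
  moreover have "incseq a" unfolding a_def incseq_def by (auto intro!: Max_mono)
  moreover have "x \<in> (\<Union>n. {..a n})" if xA: "x \<in> A" for x
  proof -
    obtain y where y: "y \<in> A" "y > x" using gt[OF xA] by blast
    then have "y \<in> closure D" using D by auto
    then obtain z where z: "z \<in> D" "dist z y < y - x" using y by (metis closure_approachable diff_gt_0_iff_gt)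
    then obtain n where n: "z = d n" using d by auto
    have "z \<le> a n" unfolding a_def n by (intro Max_ge) auto
    moreover have "x < z" using z by (auto simp: dist_real_def)
    ultimately show ?thesis by (auto intro!: exI[of _ n])
  qed
  ultimately show ?thesis by (intro that[of a]) auto
qed

lemma emeasure_lborel_plus_image:
  fixes A :: "real set"
  assumes "A \<in> sets borel"
  shows "(\<lambda>x. x + c) ` A \<in> sets borel" "emeasure lborel ((\<lambda>x. x + c) ` A) = emeasure lborel A"
proof -
  have eq: "(\<lambda>x. x + c) ` A = (\<lambda>x. -c + x) -` A" by (force simp: image_iff)
  show "(\<lambda>x. x + c) ` A \<in> sets borel" unfolding eq
    using measurable_sets[of "(+) (-c)" borel borel A] assms by simp
  have "emeasure lborel A = emeasure (distr lborel borel ((+) (-c))) A" by (simp only: lborel_distr_plus)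
  also have "\<dots> = emeasure lborel ((\<lambda>x. -c + x) -` A)" using assms by (subst emeasure_distr) auto
  finally show "emeasure lborel ((\<lambda>x. x + c) ` A) = emeasure lborel A" unfolding eq by (rule sym)
qed

lemma emeasure_lborel_scale_vimage:
  fixes A :: "real set"
  assumes "A \<in> sets borel" "c > 0"
  shows "emeasure lborel A = ennreal c * emeasure lborel {x. c * x \<in> A}"
proof -
  have "emeasure lborel A = (\<integral>\<^sup>+x. indicator A x \<partial>lborel)" using assms by simp
  also have "\<dots> = ennreal c * (\<integral>\<^sup>+x. indicator A (0 + c * x) \<partial>lborel)"
    by (subst nn_integral_real_affine[where c = c and t = 0]) (use assms in auto)
  also have "(\<integral>\<^sup>+x. indicator A (0 + c * x) \<partial>lborel) = (\<integral>\<^sup>+x. indicator {x. c * x \<in> A} x \<partial>lborel)"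
    by (intro nn_integral_cong) (auto simp: indicator_def)
  also have "\<dots> = emeasure lborel {x. c * x \<in> A}" using assms by (intro nn_integral_indicator) auto
  finally show ?thesis .
qed

text \<open>Cut \<open>A\<close> at one of its points \<open>a\<close> from above and
  \<open>B\<close> at one of its points \<open>b\<close> from below. The translates
  \<open>A + b\<close> and \<open>a + B\<close> then lie on opposite sides of \<open>a + b\<close>,
  so their measures add up to the null point \<open>a + b\<close>, and every sum in them is twice a
  point of \<open>S\<close>. A measurable \<open>S\<close> containing the midpoints stands in for
  the Minkowski sum, which need not be Borel.\<close>

lemma brunn_minkowski_line:
  fixes A B S :: "real set"
  assumes [measurable]: "A \<in> sets borel" "B \<in> sets borel" "S \<in> sets borel"
    and "A \<noteq> {}" "B \<noteq> {}" and mid: "\<And>x y. x \<in> A \<Longrightarrow> y \<in> B \<Longrightarrow> (x + y) / 2 \<in> S"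
  shows "emeasure lborel A + emeasure lborel B \<le> 2 * emeasure lborel S"
proof -
  obtain a where a: "incseq a" "\<And>n. a n \<in> A" "A \<subseteq> (\<Union>n. {..a n})" by (rule cofinal_sequence[OF \<open>A \<noteq> {}\<close>]) (rule that)
  have nB: "uminus ` B \<noteq> {}" using assms by auto
  obtain b' where b': "incseq b'" "\<And>n. b' n \<in> uminus ` B" "uminus ` B \<subseteq> (\<Union>n. {..b' n})"
    by (rule cofinal_sequence[OF nB]) (rule that)
  define b where "b n = - b' n" for n
  have b: "decseq b" "\<And>n. b n \<in> B" "B \<subseteq> (\<Union>n. {b n..})"
  proof -
    show "decseq b" using b' by (auto simp: b_def incseq_def decseq_def)
    show "b n \<in> B" for n using b'(2)[of n] by (auto simp: b_def)
    show "B \<subseteq> (\<Union>n. {b n..})" 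
    proof
      fix x assume "x \<in> B"
      then obtain n where "- x \<le> b' n" using b'(3) by auto
      then show "x \<in> (\<Union>n. {b n..})" by (intro UN_I[of n]) (auto simp: b_def)
    qed
  qed
  have S2: "emeasure lborel {x. x / 2 \<in> S} = 2 * emeasure lborel S"
  proof -
    have "{x. x/2 \<in> S} \<in> sets borel" by measurable
    then have "emeasure lborel {x. x/2 \<in> S} = ennreal 2 * emeasure lborel {x. 2 * x \<in> {x. x / 2 \<in> S}}"
      by (intro emeasure_lborel_scale_vimage) auto
    then show ?thesis by simp
  qed
  have A: "(\<lambda>n. emeasure lborel (A \<inter> {..a n})) \<longlonglongrightarrow> emeasure lborel (\<Union>n. A \<inter> {..a n})"
    using a(1) by (intro Lim_emeasure_incseq) (auto simp: incseq_def intro: order_trans)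
  have B: "(\<lambda>n. emeasure lborel (B \<inter> {b n..})) \<longlonglongrightarrow> emeasure lborel (\<Union>n. B \<inter> {b n..})"
    using b(1) by (intro Lim_emeasure_incseq) (auto simp: incseq_def decseq_def intro: order_trans)
  have "(\<Union>n. A \<inter> {..a n}) = A" "(\<Union>n. B \<inter> {b n..}) = B" using a(3) b(3) by auto
  note lim = tendsto_add[OF A B, unfolded this]
  show ?thesis
  proof (rule LIMSEQ_le_const2[OF lim], intro exI allI impI)
    fix n :: nat
    let ?U = "(\<lambda>x. x + b n) ` (A \<inter> {..a n})" and ?V = "(\<lambda>x. x + a n) ` (B \<inter> {b n..})"
    have UV[measurable]: "?U \<in> sets borel" "?V \<in> sets borel" using assms(1,2) by (auto intro!: emeasure_lborel_plus_image)
    have "emeasure lborel (A \<inter> {..a n}) + emeasure lborel (B \<inter> {b n..}) = emeasure lborel ?U + emeasure lborel ?V"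
      using emeasure_lborel_plus_image(2)[of "A \<inter> {..a n}"] emeasure_lborel_plus_image(2)[of "B \<inter> {b n..}"] assms(1,2) by simp
    also have "emeasure lborel ?V = emeasure lborel (?V - {a n + b n})"
      by (rule emeasure_Diff_null_set[symmetric]) (auto intro!: finite_imp_null_set_lborel)
    also have "emeasure lborel ?U + \<dots> = emeasure lborel (?U \<union> (?V - {a n + b n}))"
      by (intro plus_emeasure) (auto simp: UV)
    also have "\<dots> \<le> emeasure lborel {x. x / 2 \<in> S}"
      using mid[OF a(2)[of n]] mid[OF _ b(2)[of n]] by (intro emeasure_mono) (auto simp: add.commute)
    finally show "emeasure lborel (A \<inter> {..a n}) + emeasure lborel (B \<inter> {b n..}) \<le> 2 * emeasure lborel S"
      using S2 by simp
  qed
qed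


section \<open>From level sets to Prekopa-Leindler\<close>

lemma nn_integral_layer_cake:
  fixes u :: "'a \<Rightarrow> ennreal"
  assumes "sigma_finite_measure M" and [measurable]: "u \<in> borel_measurable M"
  shows "(\<integral>\<^sup>+x. u x \<partial>M) = (\<integral>\<^sup>+t. indicator {0<..} t * emeasure M {x\<in>space M. ennreal t < u x} \<partial>lborel)"
proof -
  interpret sigma_finite_measure M by fact
  interpret pair_sigma_finite M "lborel :: real measure" ..
  have u: "u x = (\<integral>\<^sup>+t. indicator {0<..} t * indicator {t. ennreal t < u x} t \<partial>lborel)" for x
  proof -
    have "(\<integral>\<^sup>+t. indicator {0<..} t * indicator {t. ennreal t < u x} t \<partial>lborel)
       = (\<integral>\<^sup>+t. indicator ({0<..} \<inter> {t. ennreal t < u x}) t \<partial>lborel)"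
      by (intro nn_integral_cong) (auto simp: indicator_def)
    also have "\<dots> = emeasure lborel ({0<..} \<inter> {t::real. ennreal t < u x})"
      by (intro nn_integral_indicator) auto
    also have "\<dots> = u x"
    proof (cases "u x")
      case (real r)
      then have "{0<..} \<inter> {t::real. ennreal t < u x} = {0<..<r}" by (auto simp: ennreal_less_iff)
      then show ?thesis using real by simp
    next
      case top
      have "{0<..} \<inter> {t::real. ennreal t < u x} = {0<..}" using top by auto
      moreover have "emeasure lborel {0::real<..} = \<infinity>"
      proof (rule ccontr)
        assume "emeasure lborel {0::real<..} \<noteq> \<infinity>"
        then obtain r where r: "r \<ge> 0" "emeasure lborel {0::real<..} = ennreal r" by (cases "emeasure lborel {0::real<..}") auto
        have "emeasure lborel {0::real<..<r+1} \<le> emeasure lborel {0::real<..}" by (intro emeasure_mono) auto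
        then show False using r by (simp add: ennreal_le_iff)
      qed
      ultimately show ?thesis using top by simp
    qed
    finally show ?thesis by simp
  qed
  have "(\<integral>\<^sup>+x. u x \<partial>M) = (\<integral>\<^sup>+x. \<integral>\<^sup>+t. indicator {0<..} t * indicator {t. ennreal t < u x} t \<partial>lborel \<partial>M)"
    by (subst u) simp
  also have "\<dots> = (\<integral>\<^sup>+t. \<integral>\<^sup>+x. indicator {0<..} t * indicator {t. ennreal t < u x} t \<partial>M \<partial>lborel)"
    by (rule Fubini'[symmetric]) (simp add: indicator_def, measurable)
  also have "\<dots> = (\<integral>\<^sup>+t. indicator {0<..} t * emeasure M {x\<in>space M. ennreal t < u x} \<partial>lborel)"
  proof (rule nn_integral_cong)
    fix t :: real
    have "(\<integral>\<^sup>+x. indicator {0<..} t * indicator {t. ennreal t < u x} t \<partial>M)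
       = (\<integral>\<^sup>+x. indicator {0<..} t * indicator {x\<in>space M. ennreal t < u x} x \<partial>M)"
      by (intro nn_integral_cong) (auto simp: indicator_def)
    also have "\<dots> = indicator {0<..} t * emeasure M {x\<in>space M. ennreal t < u x}"
      by (subst nn_integral_cmult) auto
    finally show "(\<integral>\<^sup>+x. indicator {0<..} t * indicator {t. ennreal t < u x} t \<partial>M)
      = indicator {0<..} t * emeasure M {x\<in>space M. ennreal t < u x}" .
  qed
  finally show ?thesis .
qed

lemma borel_measurable_emeasure_superlevel:
  fixes u :: "'a \<Rightarrow> ennreal"
  assumes "sigma_finite_measure M" and [measurable]: "u \<in> borel_measurable M"
  shows "(\<lambda>t. emeasure M {x\<in>space M. ennreal t < u x}) \<in> borel_measurable borel"
proof -
  interpret sigma_finite_measure M by fact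
  have "{p \<in> space (borel \<Otimes>\<^sub>M M). ennreal (fst p) < u (snd p)} \<in> sets (borel \<Otimes>\<^sub>M M)" by measurable
  from measurable_emeasure_Pair[OF this] show ?thesis by (simp add: vimage_def space_pair_measure)
qed

lemma ennreal_am_gm:
  fixes a b c :: ennreal
  assumes "a + b \<le> 2 * c"
  shows "a * b \<le> c^2"
proof (cases c)
  case (real r)
  then have "a + b < top" using assms by (auto simp: less_top[symmetric] ennreal_mult_eq_top_iff top_unique)
  then obtain a' b' where ab: "a = ennreal a'" "b = ennreal b'" "a' \<ge> 0" "b' \<ge> 0"
    by (cases a; cases b) auto
  have "ennreal (a' + b') \<le> ennreal (2 * r)"
    using assms ab real by (simp add: ennreal_mult)
  then have "a' + b' \<le> 2 * r" using real by (simp add: ennreal_le_iff)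
  then have "(a' + b')^2 \<le> (2*r)^2" using ab by (intro power_mono) auto
  moreover have "0 \<le> (a' - b')^2" by simp
  ultimately have "a' * b' \<le> r^2" by (simp add: power2_eq_square algebra_simps)
  then show ?thesis using ab real
    by (simp add: ennreal_mult[symmetric] ennreal_power ennreal_leI)
next
  case top
  then show ?thesis by (simp add: power2_eq_square)
qed

text \<open>With both suprema equal to 1, the superlevel sets of \<open>f\<close> and
  \<open>g\<close> become empty at the same level. Below it both are nonempty, so the additive
  Brunn-Minkowski inequality holds at every level and can be integrated; the arithmetic-geometric
  mean inequality then turns the sum into the product.\<close>

lemma prekopa_leindler_line_normalised:
  fixes f g h :: "real \<Rightarrow> ennreal"
  assumes [measurable]: "f \<in> borel_measurable borel" "g \<in> borel_measurable borel" "h \<in> borel_measurable borel"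
    and sup: "(SUP x. f x) = 1" "(SUP x. g x) = 1"
    and fgh: "\<And>x y. f x * g y \<le> (h ((x + y) / 2))^2"
  shows "(\<integral>\<^sup>+x. f x \<partial>lborel) * (\<integral>\<^sup>+x. g x \<partial>lborel) \<le> (\<integral>\<^sup>+x. h x \<partial>lborel)^2"
proof (rule ennreal_am_gm)
  have "indicator {0<..} t * emeasure lborel {x\<in>space lborel. ennreal t < f x} +
     indicator {0<..} t * emeasure lborel {x\<in>space lborel. ennreal t < g x} \<le>
     2 * (indicator {0<..} t * emeasure lborel {x\<in>space lborel. ennreal t < h x})" for t
  proof (cases "0 < t \<and> t < 1")
    case True
    have "ennreal t < 1" using True by (simp add: ennreal_less_one_iff)
    then have ne: "{x. ennreal t < f x} \<noteq> {}" "{x. ennreal t < g x} \<noteq> {}"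
      using sup less_SUP_iff[of "ennreal t" f UNIV] less_SUP_iff[of "ennreal t" g UNIV] by auto
    have "(x + y) / 2 \<in> {x. ennreal t < h x}" if "x \<in> {x. ennreal t < f x}" "y \<in> {x. ennreal t < g x}" for x y
    proof -
      have "ennreal t * ennreal t < ennreal t * g y" using that True by (intro ennreal_mult_strict_left_mono) auto
      also have "\<dots> \<le> f x * g y" using that by (intro mult_right_mono) auto
      also have "\<dots> \<le> (h ((x + y) / 2))^2" by (rule fgh)
      finally have "(ennreal t)^2 < (h ((x + y) / 2))^2" by (simp add: power2_eq_square)
      then show ?thesis using power_mono[of "h ((x + y) / 2)" "ennreal t" 2] by (auto simp: not_le[symmetric])
    qed
    from brunn_minkowski_line[OF _ _ _ ne this] show ?thesis using True by simp
  next
    case False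
    have "f x \<le> 1" "g x \<le> 1" for x using sup by (metis SUP_upper UNIV_I)+
    moreover have "1 \<le> ennreal t" if "t > 0" using that False by (simp add: ennreal_ge_1)
    ultimately have "f x \<le> ennreal t" "g x \<le> ennreal t" if "t > 0" for x using that by (meson order_trans)+
    then have "t > 0 \<Longrightarrow> {x. ennreal t < f x} = {} \<and> {x. ennreal t < g x} = {}" by (auto simp: not_less)
    then show ?thesis by (cases "t > 0") (auto simp: indicator_def)
  qed
  then have le: "(\<integral>\<^sup>+t. indicator {0<..} t * emeasure lborel {x\<in>space lborel. ennreal t < f x} +
     indicator {0<..} t * emeasure lborel {x\<in>space lborel. ennreal t < g x} \<partial>lborel) \<le>
     (\<integral>\<^sup>+t. 2 * (indicator {0<..} t * emeasure lborel {x\<in>space lborel. ennreal t < h x}) \<partial>lborel)"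
    by (intro nn_integral_mono)
  have [measurable]: "(\<lambda>t. emeasure lborel {x. ennreal t < u x}) \<in> borel_measurable borel" if "u \<in> borel_measurable borel" for u :: "real \<Rightarrow> ennreal"
    using borel_measurable_emeasure_superlevel[OF sigma_finite_lborel, of u] that by simp
  have lc: "(\<integral>\<^sup>+x. u x \<partial>lborel) = (\<integral>\<^sup>+t. indicator {0<..} t * emeasure lborel {x\<in>space lborel. ennreal t < u x} \<partial>lborel)"
    if "u \<in> borel_measurable borel" for u :: "real \<Rightarrow> ennreal"
    using that by (intro nn_integral_layer_cake sigma_finite_lborel) simp
  show "(\<integral>\<^sup>+x. f x \<partial>lborel) + (\<integral>\<^sup>+x. g x \<partial>lborel) \<le> 2 * (\<integral>\<^sup>+x. h x \<partial>lborel)"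
    unfolding lc(1)[OF assms(1)] lc(1)[OF assms(2)] lc(1)[OF assms(3)]
    using le assms(1-3) by (simp add: nn_integral_add nn_integral_cmult)
qed

text \<open>Hypothesis and conclusion are homogeneous: with \<open>a\<close> and \<open>b\<close>
  the suprema, \<open>f / a\<close>, \<open>g / b\<close> and \<open>h / sqrt (a b)\<close> fall
  under the normalised case.\<close>

lemma prekopa_leindler_line_bounded:
  fixes f g h :: "real \<Rightarrow> ennreal"
  assumes [measurable]: "f \<in> borel_measurable borel" "g \<in> borel_measurable borel" "h \<in> borel_measurable borel"
    and sup: "(SUP x. f x) < \<infinity>" "(SUP x. g x) < \<infinity>"
    and fgh: "\<And>x y. f x * g y \<le> (h ((x + y) / 2))^2"
  shows "(\<integral>\<^sup>+x. f x \<partial>lborel) * (\<integral>\<^sup>+x. g x \<partial>lborel) \<le> (\<integral>\<^sup>+x. h x \<partial>lborel)^2"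
proof (cases "(SUP x. f x) = 0 \<or> (SUP x. g x) = 0")
  case True
  then have "(\<forall>x. f x = 0) \<or> (\<forall>x. g x = 0)" by (auto simp: SUP_eq_iff bot_ennreal[symmetric])
  then show ?thesis by auto
next
  case False
  obtain a where a: "a > 0" "(SUP x. f x) = ennreal a" using sup(1) False by (cases "SUP x. f x") (auto simp: ennreal_eq_0_iff not_le)
  obtain b where b: "b > 0" "(SUP x. g x) = ennreal b" using sup(2) False by (cases "SUP x. g x") (auto simp: ennreal_eq_0_iff not_le)
  define F where "F = (\<integral>\<^sup>+x. f x \<partial>lborel)"
  define G where "G = (\<integral>\<^sup>+x. g x \<partial>lborel)"
  define H where "H = (\<integral>\<^sup>+x. h x \<partial>lborel)"
  have s: "ennreal (1 / sqrt (a*b)) * ennreal (1 / sqrt (a*b)) = ennreal (1/(a*b))"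
    using a b by (simp add: ennreal_mult[symmetric] del: real_sqrt_mult)
  have ab: "ennreal (1/a) * ennreal (1/b) = ennreal (1/(a*b))" using a b by (simp add: ennreal_mult[symmetric])
  have sh: "(ennreal (1 / sqrt (a*b)) * u)^2 = ennreal (1/(a*b)) * u^2" for u
  proof -
    have "(ennreal (1 / sqrt (a*b)) * u)^2 = (ennreal (1 / sqrt (a*b)) * ennreal (1 / sqrt (a*b))) * u^2"
      by (simp add: power2_eq_square mult_ac del: real_sqrt_mult)
    then show ?thesis unfolding s .
  qed
  have fg: "ennreal (1/a) * u * (ennreal (1/b) * v) = ennreal (1/(a*b)) * (u * v)" for u v
    unfolding ab[symmetric] by (simp add: mult_ac)
  have "(\<integral>\<^sup>+x. ennreal (1/a) * f x \<partial>lborel) * (\<integral>\<^sup>+x. ennreal (1/b) * g x \<partial>lborel) \<le>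
     (\<integral>\<^sup>+x. ennreal (1 / sqrt (a*b)) * h x \<partial>lborel)^2"
  proof (rule prekopa_leindler_line_normalised)
    show "(SUP x. ennreal (1/a) * f x) = 1" "(SUP x. ennreal (1/b) * g x) = 1"
      using a b by (simp_all add: SUP_mult_left_ennreal[symmetric] ennreal_mult[symmetric])
    show "ennreal (1/a) * f x * (ennreal (1/b) * g y) \<le> (ennreal (1 / sqrt (a*b)) * h ((x + y)/2))^2" for x y
      unfolding sh fg by (intro mult_left_mono fgh) auto
  qed measurable
  then have "ennreal (1/(a*b)) * (F * G) \<le> ennreal (1/(a*b)) * H^2"
    by (simp add: nn_integral_cmult F_def[symmetric] G_def[symmetric] H_def[symmetric] sh fg del: real_sqrt_mult)
  then have "F * G \<le> H^2" using a b by (subst (asm) ennreal_mult_le_mult_iff) (auto simp: ennreal_eq_0_iff not_le)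
  then show ?thesis unfolding F_def G_def H_def .
qed

lemma prekopa_leindler_line:
  fixes f g h :: "real \<Rightarrow> ennreal"
  assumes [measurable]: "f \<in> borel_measurable borel" "g \<in> borel_measurable borel" "h \<in> borel_measurable borel"
    and fgh: "\<And>x y. f x * g y \<le> (h ((x + y) / 2))^2"
  shows "(\<integral>\<^sup>+x. f x \<partial>lborel) * (\<integral>\<^sup>+x. g x \<partial>lborel) \<le> (\<integral>\<^sup>+x. h x \<partial>lborel)^2"
proof -
  let ?H = "(\<integral>\<^sup>+x. h x \<partial>lborel)^2"
  have trunc: "(SUP k::nat. \<integral>\<^sup>+x. min (u x) (of_nat k) \<partial>lborel) = (\<integral>\<^sup>+x. u x \<partial>lborel)"
    if [measurable]: "u \<in> borel_measurable borel" for u :: "real \<Rightarrow> ennreal"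
  proof -
    have "(\<integral>\<^sup>+x. (SUP k::nat. min (u x) (of_nat k)) \<partial>lborel) = (SUP k::nat. \<integral>\<^sup>+x. min (u x) (of_nat k) \<partial>lborel)"
      by (intro nn_integral_monotone_convergence_SUP)
         (auto simp: incseq_def le_fun_def min_le_iff_disj)
    moreover have "(SUP k::nat. min (u x) (of_nat k)) = u x" for x
    proof -
      have "(SUP k::nat. min (u x) (of_nat k)) = min (u x) (SUP k::nat. of_nat k)"
        by (simp add: inf_min[symmetric] inf_SUP)
      then show ?thesis by (simp add: ennreal_SUP_of_nat_eq_top)
    qed
    ultimately show ?thesis by simp
  qed
  have le: "(\<integral>\<^sup>+x. min (f x) (of_nat k) \<partial>lborel) * (\<integral>\<^sup>+x. min (g x) (of_nat l) \<partial>lborel) \<le> ?H" for k l :: nat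
  proof (rule prekopa_leindler_line_bounded)
    have "(SUP x. min (f x) (of_nat k)) \<le> of_nat k" by (intro SUP_least) auto
    also have "of_nat k < (\<infinity>::ennreal)" by (simp add: of_nat_less_top)
    finally show "(SUP x. min (f x) (of_nat k)) < \<infinity>" .
    have "(SUP x. min (g x) (of_nat l)) \<le> of_nat l" by (intro SUP_least) auto
    also have "of_nat l < (\<infinity>::ennreal)" by (simp add: of_nat_less_top)
    finally show "(SUP x. min (g x) (of_nat l)) < \<infinity>" .
    show "min (f x) (of_nat k) * min (g y) (of_nat l) \<le> (h ((x + y) / 2))^2" for x y
      by (rule order_trans[OF _ fgh[of x y]]) (auto intro!: mult_mono)
  qed measurable
  have "(\<integral>\<^sup>+x. f x \<partial>lborel) * (\<integral>\<^sup>+x. min (g x) (of_nat l) \<partial>lborel) \<le> ?H" for l :: nat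
    unfolding trunc[OF assms(1), symmetric] SUP_mult_right_ennreal by (intro SUP_least le)
  then show ?thesis
    unfolding trunc[OF assms(2), symmetric] SUP_mult_left_ennreal by (intro SUP_least)
qed

text \<open>Tensorization: the line inequality, applied to sections in one coordinate, says
  precisely that the partial integrals satisfy the hypothesis in the remaining coordinates. Points
  outside \<open>extensional I\<close> are not in the space of the product measure.\<close>

lemma prekopa_leindler_PiM:
  fixes f g h :: "('i \<Rightarrow> real) \<Rightarrow> ennreal"
  assumes "finite I"
    and "f \<in> borel_measurable (PiM I (\<lambda>_. lborel))" "g \<in> borel_measurable (PiM I (\<lambda>_. lborel))"
      "h \<in> borel_measurable (PiM I (\<lambda>_. lborel))"
    and "\<And>x y. x \<in> extensional I \<Longrightarrow> y \<in> extensional I \<Longrightarrow> f x * g y \<le> (h (\<lambda>i\<in>I. (x i + y i) / 2))^2"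
  shows "(\<integral>\<^sup>+x. f x \<partial>PiM I (\<lambda>_. lborel)) * (\<integral>\<^sup>+x. g x \<partial>PiM I (\<lambda>_. lborel)) \<le> (\<integral>\<^sup>+x. h x \<partial>PiM I (\<lambda>_. lborel))^2"
  using assms
proof (induction I arbitrary: f g h rule: finite_induct)
  case empty
  have u: "(\<lambda>_. undefined) \<in> extensional {}" by auto
  show ?case
    using empty(4)[OF u u] by (simp add: PiM_empty nn_integral_count_space_finite)
next
  case (insert i I)
  interpret product_sigma_finite "\<lambda>_. lborel :: real measure" ..
  note [measurable] = insert.prems(1-3)
  have upd: "(\<lambda>k\<in>insert i I. ((x(i := s)) k + (y(i := t)) k) / 2) = (\<lambda>k\<in>I. (x k + y k)/2)(i := (s + t)/2)"
    for x y :: "'i \<Rightarrow> real" and s t using insert.hyps by (auto simp: fun_eq_iff restrict_def)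
  have ext: "x(i := s) \<in> extensional (insert i I)" if "x \<in> extensional I" for x :: "'i \<Rightarrow> real" and s
    using that by (auto simp: extensional_def)
  have sec: "(\<lambda>s. u (x(i := s))) \<in> borel_measurable borel"
    if "x \<in> extensional I" and [measurable]: "u \<in> borel_measurable (PiM (insert i I) (\<lambda>_. lborel))" for x and u :: "('i \<Rightarrow> real) \<Rightarrow> ennreal"
  proof -
    have "(\<lambda>s. x(i := s)) \<in> lborel \<rightarrow>\<^sub>M PiM (insert i I) (\<lambda>_. lborel)"
      using that(1) insert.hyps
      by (intro measurable_fun_upd[where J = I] measurable_const measurable_ident) (auto simp: space_PiM PiE_iff)
    from measurable_compose[OF this that(2)] show ?thesis by simp
  qed
  have int: "(\<lambda>x. \<integral>\<^sup>+s. u (x(i := s)) \<partial>lborel) \<in> borel_measurable (PiM I (\<lambda>_. lborel))"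
    if [measurable]: "u \<in> borel_measurable (PiM (insert i I) (\<lambda>_. lborel))" for u :: "('i \<Rightarrow> real) \<Rightarrow> ennreal"
    using insert.hyps by measurable
  have "(\<integral>\<^sup>+x. (\<integral>\<^sup>+s. f (x(i := s)) \<partial>lborel) \<partial>PiM I (\<lambda>_. lborel)) * (\<integral>\<^sup>+x. (\<integral>\<^sup>+s. g (x(i := s)) \<partial>lborel) \<partial>PiM I (\<lambda>_. lborel))
    \<le> (\<integral>\<^sup>+x. (\<integral>\<^sup>+s. h (x(i := s)) \<partial>lborel) \<partial>PiM I (\<lambda>_. lborel))^2"
  proof (rule insert.IH)
    fix x y :: "'i \<Rightarrow> real" assume xy: "x \<in> extensional I" "y \<in> extensional I"
    have e: "(\<lambda>i\<in>I. (x i + y i) / 2) \<in> extensional I" by auto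
    show "(\<integral>\<^sup>+s. f (x(i := s)) \<partial>lborel) * (\<integral>\<^sup>+s. g (y(i := s)) \<partial>lborel) \<le>
        (\<integral>\<^sup>+s. h ((\<lambda>i\<in>I. (x i + y i) / 2)(i := s)) \<partial>lborel)^2"
      using insert.prems(4)[OF ext[OF xy(1)] ext[OF xy(2)], unfolded upd]
      by (intro prekopa_leindler_line sec xy e insert.prems(1-3))
  qed (rule int, rule insert.prems)+
  then show ?case using insert.hyps insert.prems(1-3) by (simp add: product_nn_integral_insert)
qed

section \<open>Sections of symmetric convex sets by boxes\<close>

abbreviation lborel_pow :: "('m::finite \<Rightarrow> 'a::euclidean_space) measure" where
  "lborel_pow \<equiv> PiM UNIV (\<lambda>_. lborel)"

lemma space_lborel_pow [simp]: "space lborel_pow = UNIV"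
  by (simp add: space_PiM PiE_UNIV_domain)

lemma sets_lborel_pow_Pi:
  assumes "\<And>i. A i \<in> sets borel"
  shows "{x. \<forall>i. x i \<in> A i} \<in> sets (lborel_pow :: ('m::finite \<Rightarrow> 'a::euclidean_space) measure)"
proof -
  have "{x. \<forall>i. x i \<in> A i} = Pi\<^sub>E UNIV A" by auto
  then show ?thesis using assms by (auto intro!: sets_PiM_I_finite)
qed

lemma emeasure_lborel_pow_Pi:
  assumes "\<And>i. A i \<in> sets borel"
  shows "emeasure (lborel_pow :: ('m::finite \<Rightarrow> 'a::euclidean_space) measure) {x. \<forall>i. x i \<in> A i} = (\<Prod>i\<in>UNIV. emeasure lborel (A i))"
proof -
  interpret product_sigma_finite "\<lambda>_. lborel :: 'a measure" ..
  have "{x. \<forall>i. x i \<in> A i} = Pi\<^sub>E UNIV A" by auto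
  then show ?thesis using assms by (simp add: emeasure_PiM)
qed

lemma sigma_finite_lborel_pow: "sigma_finite_measure (lborel_pow :: ('m::finite \<Rightarrow> 'a::euclidean_space) measure)"
proof -
  interpret product_sigma_finite "\<lambda>_. lborel :: 'a measure" ..
  show ?thesis by (rule sigma_finite) simp
qed

lemma distr_lborel_pow_componentwise:
  fixes T :: "'m::finite \<Rightarrow> 'a::euclidean_space \<Rightarrow> 'a"
  assumes [measurable]: "\<And>i. T i \<in> borel_measurable borel" and T: "\<And>i. distr lborel borel (T i) = lborel"
  shows "distr lborel_pow lborel_pow (\<lambda>x i. T i (x i)) = lborel_pow"
proof -
  interpret product_sigma_finite "\<lambda>_. lborel :: 'a measure" ..
  have m: "(\<lambda>x i. T i (x i)) \<in> lborel_pow \<rightarrow>\<^sub>M lborel_pow"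
    by (rule measurable_PiM_single') (auto simp: space_PiM)
  show ?thesis
  proof (rule PiM_eqI)
    fix A :: "'m \<Rightarrow> 'a set" assume A: "\<And>i. i \<in> UNIV \<Longrightarrow> A i \<in> sets lborel"
    have TA: "T i -` A i \<in> sets borel" for i using measurable_sets[of "T i" borel borel "A i"] A by simp
    have "emeasure (distr lborel_pow lborel_pow (\<lambda>x i. T i (x i))) (Pi\<^sub>E UNIV A)
        = emeasure lborel_pow {x. \<forall>i. x i \<in> T i -` A i}"
      using A by (subst emeasure_distr[OF m]) (auto intro!: sets_PiM_I_finite arg_cong2[where f=emeasure])
    also have "\<dots> = (\<Prod>i\<in>UNIV. emeasure lborel (T i -` A i))" by (intro emeasure_lborel_pow_Pi TA)
    also have "\<dots> = (\<Prod>i\<in>UNIV. emeasure (distr lborel borel (T i)) (A i))"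
      using A by (intro prod.cong refl) (subst emeasure_distr, auto)
    finally show "emeasure (distr lborel_pow lborel_pow (\<lambda>x i. T i (x i))) (Pi\<^sub>E UNIV A) = (\<Prod>i\<in>UNIV. emeasure lborel (A i))"
      unfolding T .
  qed auto
qed

lemma nn_integral_lborel_pow_componentwise:
  fixes T :: "'m::finite \<Rightarrow> 'a::euclidean_space \<Rightarrow> 'a"
  assumes [measurable]: "\<And>i. T i \<in> borel_measurable borel" and T: "\<And>i. distr lborel borel (T i) = lborel"
    and f: "f \<in> borel_measurable lborel_pow"
  shows "(\<integral>\<^sup>+x. f (\<lambda>i. T i (x i)) \<partial>lborel_pow) = (\<integral>\<^sup>+x. f x \<partial>lborel_pow)"
proof -
  have m: "(\<lambda>x i. T i (x i)) \<in> lborel_pow \<rightarrow>\<^sub>M lborel_pow"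
    by (rule measurable_PiM_single') (auto simp: space_PiM)
  have "(\<integral>\<^sup>+x. f (\<lambda>i. T i (x i)) \<partial>lborel_pow) = (\<integral>\<^sup>+x. f x \<partial>distr lborel_pow lborel_pow (\<lambda>x i. T i (x i)))"
    using f m by (simp add: nn_integral_distr)
  then show ?thesis unfolding distr_lborel_pow_componentwise[of T, OF assms(1) T] .
qed

lemma nn_integral_lborel_pow_translate:
  fixes c :: "'m::finite \<Rightarrow> 'a::euclidean_space"
  assumes "f \<in> borel_measurable lborel_pow"
  shows "(\<integral>\<^sup>+x. f (\<lambda>i. c i + x i) \<partial>lborel_pow) = (\<integral>\<^sup>+x. f x \<partial>lborel_pow)"
  by (rule nn_integral_lborel_pow_componentwise[where T = "\<lambda>i. (+) (c i)"]) (use assms in \<open>auto simp: lborel_distr_plus\<close>)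

lemma ennreal_power2_le_imp_le:
  fixes a b :: ennreal
  assumes "a^2 \<le> b^2"
  shows "a \<le> b"
proof (rule ccontr)
  assume "\<not> a \<le> b"
  then have ba: "b < a" by simp
  then obtain r where r: "b = ennreal r" "r \<ge> 0" by (cases b) auto
  show False
  proof (cases a)
    case (real s)
    then have "s^2 \<le> r^2" using assms r by (simp add: ennreal_power ennreal_le_iff)
    then have "s \<le> r" using r(2) by (rule power2_le_imp_le)
    then show False using ba real r by (simp add: ennreal_less_iff)
  next
    case top
    then show False using assms r by (simp add: ennreal_power top_unique power2_eq_square ennreal_mult_eq_top_iff)
  qed
qed

lemma dyadic_approximation:
  fixes l d :: real
  assumes "0 \<le> l" "l \<le> 1" "0 < d"
  shows "\<exists>n k :: nat. k \<le> 2^n \<and> \<bar>real k / 2^n - l\<bar> < d"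
proof -
  obtain n where n: "(1/2)^n < d" using \<open>0 < d\<close> real_arch_pow_inv[of d "1/2"] by auto
  define k where "k = nat \<lfloor>l * 2^n\<rfloor>"
  have k: "real k \<le> l * 2^n" "l * 2^n < real k + 1"
    using \<open>0 \<le> l\<close> by (auto simp: k_def of_nat_nat)
  have "l * 2^n \<le> 2^n" using assms by simp
  then have "real k \<le> 2^n" using k by linarith
  then have "k \<le> 2^n" by (metis of_nat_le_iff of_nat_numeral of_nat_power)
  moreover have "\<bar>real k / 2^n - l\<bar> \<le> (1/2)^n"
  proof -
    have "real k / 2^n \<le> l" "l < (real k + 1) / 2^n" using k by (simp_all add: pos_less_divide_eq pos_divide_le_eq)
    then show ?thesis by (simp add: add_divide_distrib power_one_over)
  qed
  ultimately show ?thesis using n by (intro exI[of _ n] exI[of _ k]) auto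
qed

definition open_box :: "('m \<Rightarrow> real) \<Rightarrow> ('m \<Rightarrow> real) \<Rightarrow> ('m \<Rightarrow> real) set" where
  "open_box u r = {x. \<forall>i. \<bar>x i - u i\<bar> < r i}"

lemma sets_open_box [measurable]: "open_box u r \<in> sets (lborel_pow :: ('m::finite \<Rightarrow> real) measure)"
proof -
  have "open_box u r = {x. \<forall>i. x i \<in> ball (u i) (r i)}" by (auto simp: open_box_def dist_real_def abs_minus_commute)
  then show ?thesis by (simp only:) (rule sets_lborel_pow_Pi, simp)
qed

text \<open>Convexity is recorded at midpoints because this is the form in which it is obtained
  (midpoint inequalities for volumes) and the form in which Prekopa-Leindler with equal weights
  consumes it.\<close>

definition midconvex_symmetric :: "('m \<Rightarrow> real) set \<Rightarrow> bool" where
  "midconvex_symmetric K \<longleftrightarrow> (\<forall>x\<in>K. (\<lambda>i. - x i) \<in> K) \<and> (\<forall>x\<in>K. \<forall>y\<in>K. (\<lambda>i. (x i + y i) / 2) \<in> K)"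

context
  fixes K :: "('m::finite \<Rightarrow> real) set"
  assumes K [measurable]: "K \<in> sets lborel_pow" and msK: "midconvex_symmetric K"
begin

lemma box_section_midpoint:
  "emeasure lborel_pow (K \<inter> open_box u r) * emeasure lborel_pow (K \<inter> open_box v r)
     \<le> (emeasure lborel_pow (K \<inter> open_box (\<lambda>i. (u i + v i)/2) r))^2"
proof -
  have b: "(\<lambda>i. (x i + y i)/2) \<in> open_box (\<lambda>i. (u i + v i)/2) r" if "x \<in> open_box u r" "y \<in> open_box v r" for x y
    unfolding open_box_def
  proof (intro CollectI allI)
    fix i
    have "\<bar>x i - u i\<bar> < r i" "\<bar>y i - v i\<bar> < r i" using that by (auto simp: open_box_def)
    then show "\<bar>(x i + y i)/2 - (u i + v i)/2\<bar> < r i" by (simp add: abs_less_iff field_simps)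
  qed
  have "(\<integral>\<^sup>+x. indicator (K \<inter> open_box u r) x \<partial>lborel_pow) * (\<integral>\<^sup>+x. indicator (K \<inter> open_box v r) x \<partial>lborel_pow)
     \<le> (\<integral>\<^sup>+x. indicator (K \<inter> open_box (\<lambda>i. (u i + v i)/2) r) x \<partial>lborel_pow)^2"
    by (rule prekopa_leindler_PiM) (use b msK in \<open>auto simp: midconvex_symmetric_def indicator_def restrict_UNIV\<close>)
  then show ?thesis by simp
qed

lemma box_section_uminus:
  "emeasure lborel_pow (K \<inter> open_box (\<lambda>i. - u i) r) = emeasure lborel_pow (K \<inter> open_box u r)"
proof -
  have "(\<integral>\<^sup>+x. indicator (K \<inter> open_box u r) (\<lambda>i. - x i) \<partial>lborel_pow) = (\<integral>\<^sup>+x. indicator (K \<inter> open_box u r) x \<partial>lborel_pow)"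
    by (rule nn_integral_lborel_pow_componentwise[where T = "\<lambda>i. uminus"]) (auto simp: lborel_distr_uminus)
  moreover have "indicator (K \<inter> open_box u r) (\<lambda>i. - x i) = (indicator (K \<inter> open_box (\<lambda>i. - u i) r) x :: ennreal)" for x
  proof -
    have "(\<lambda>i. - x i) \<in> K \<longleftrightarrow> x \<in> K" using msK by (force simp: midconvex_symmetric_def)
    moreover have "\<bar>- x i - u i\<bar> = \<bar>x i - - u i\<bar>" for i by linarith
    ultimately show ?thesis by (auto simp: indicator_def open_box_def)
  qed
  ultimately show ?thesis by simp
qed

text \<open>By the midpoint inequality and evenness the value at the centre 0, the midpoint of
  \<open>u\<close> and \<open>- u\<close>, is at least the value at \<open>u\<close>. Each further
  dyadic multiple with odd numerator is the midpoint of two multiples of the previous level, where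
  the bound is already known.\<close>

lemma box_section_dyadic:
  "k \<le> 2^n \<Longrightarrow> emeasure lborel_pow (K \<inter> open_box u r) \<le> emeasure lborel_pow (K \<inter> open_box (\<lambda>i. real k / 2^n * u i) r)"
proof (induction n arbitrary: k)
  case 0
  have "emeasure lborel_pow (K \<inter> open_box u r)^2 \<le> (emeasure lborel_pow (K \<inter> open_box (\<lambda>i. 0) r))^2"
    using box_section_midpoint[of u r "\<lambda>i. - u i"] by (simp add: box_section_uminus power2_eq_square)
  then have "emeasure lborel_pow (K \<inter> open_box u r) \<le> emeasure lborel_pow (K \<inter> open_box (\<lambda>i. 0) r)"
    by (rule ennreal_power2_le_imp_le)
  then show ?case using 0 by (cases k) auto
next
  case (Suc n)
  show ?case
  proof (cases "even k")
    case True
    then obtain l where "k = 2 * l" by (auto elim: evenE)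
    then show ?thesis using Suc.IH[of l] Suc.prems by simp
  next
    case False
    then obtain l where l: "k = 2 * l + 1" by (auto elim: oddE)
    let ?e = "\<lambda>l. emeasure lborel_pow (K \<inter> open_box (\<lambda>i. real l / 2^n * u i) r)"
    have "l \<le> 2^n" "l + 1 \<le> 2^n" using Suc.prems l by auto
    then have "emeasure lborel_pow (K \<inter> open_box u r) \<le> ?e l" "emeasure lborel_pow (K \<inter> open_box u r) \<le> ?e (l+1)"
      using Suc.IH by blast+
    then have "emeasure lborel_pow (K \<inter> open_box u r)^2 \<le> ?e l * ?e (l+1)"
      unfolding power2_eq_square by (intro mult_mono) auto
    also have "\<dots> \<le> (emeasure lborel_pow (K \<inter> open_box (\<lambda>i. (real l / 2^n * u i + real (l+1) / 2^n * u i)/2) r))^2"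
      by (rule box_section_midpoint)
    also have "(\<lambda>i. (real l / 2^n * u i + real (l+1) / 2^n * u i)/2) = (\<lambda>i. real k / 2^Suc n * u i)"
      by (auto simp: l fun_eq_iff field_simps)
    finally show ?thesis by (rule ennreal_power2_le_imp_le)
  qed
qed

text \<open>Real factors are reached without continuity in the centre: a slightly smaller box around
  a nearby dyadic multiple of \<open>u\<close> fits inside the full box around \<open>l u\<close>,
  and the smaller boxes exhaust the box around \<open>u\<close>.\<close>

lemma box_section_contract:
  assumes "0 \<le> l" "l \<le> 1"
  shows "emeasure lborel_pow (K \<inter> open_box u r) \<le> emeasure lborel_pow (K \<inter> open_box (\<lambda>i. l * u i) r)"
proof -
  define rr where "rr n i = r i - 1 / real (Suc n)" for n i
  have le: "emeasure lborel_pow (K \<inter> open_box u (rr n)) \<le> emeasure lborel_pow (K \<inter> open_box (\<lambda>i. l * u i) r)" for n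
  proof -
    \<comment> \<open>\<open>B\<close> is positive and bounds every \<open>\<bar>u i\<bar>\<close>,
      so a dyadic number within \<open>1 / ((n + 1) B)\<close> of \<open>l\<close> displaces each
      coordinate of the centre by at most \<open>1 / (n + 1)\<close>, the margin by which the box
      was shrunk.\<close>
    define B where "B = 1 + (\<Sum>i\<in>UNIV. \<bar>u i\<bar>)"
    have B: "\<bar>u i\<bar> \<le> B" "B > 0" for i
    proof -
      have "\<bar>u i\<bar> \<le> (\<Sum>i\<in>UNIV. \<bar>u i\<bar>)" by (rule member_le_sum) auto
      then show "\<bar>u i\<bar> \<le> B" "B > 0" unfolding B_def by linarith+
    qed
    obtain m k :: nat where mk: "k \<le> 2^m" "\<bar>real k / 2^m - l\<bar> < 1 / (real (Suc n) * B)"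
      using dyadic_approximation[OF assms, of "1 / (real (Suc n) * B)"] B(2) by (auto simp del: of_nat_Suc)
    have "open_box (\<lambda>i. real k / 2^m * u i) (rr n) \<subseteq> open_box (\<lambda>i. l * u i) r"
      unfolding open_box_def
    proof (intro subsetI CollectI allI)
      fix x i assume "x \<in> {x. \<forall>i. \<bar>x i - real k / 2^m * u i\<bar> < rr n i}"
      then have 1: "\<bar>x i - real k / 2^m * u i\<bar> < r i - 1 / real (Suc n)" by (auto simp: rr_def)
      have "\<bar>real k / 2^m * u i - l * u i\<bar> = \<bar>real k / 2^m - l\<bar> * \<bar>u i\<bar>" by (simp add: abs_mult[symmetric] algebra_simps)
      also have "\<dots> \<le> 1 / (real (Suc n) * B) * B" using mk B by (intro mult_mono) (auto intro: less_imp_le)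
      also have "\<dots> = 1 / real (Suc n)" using B by simp
      finally have "\<bar>x i - real k / 2^m * u i\<bar> + \<bar>real k / 2^m * u i - l * u i\<bar> < r i"
        using add_less_le_mono[OF 1] by fastforce
      then show "\<bar>x i - l * u i\<bar> < r i" using abs_triangle_ineq[of "x i - real k / 2^m * u i" "real k / 2^m * u i - l * u i"] by simp
    qed
    then have "emeasure lborel_pow (K \<inter> open_box (\<lambda>i. real k / 2^m * u i) (rr n)) \<le> emeasure lborel_pow (K \<inter> open_box (\<lambda>i. l * u i) r)"
      by (intro emeasure_mono) auto
    then show ?thesis using box_section_dyadic[OF mk(1), of u "rr n"] by (rule order_trans[rotated])
  qed
  have "(\<Union>n. K \<inter> open_box u (rr n)) = K \<inter> open_box u r"
  proof (intro equalityI subsetI)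
    fix x assume x: "x \<in> K \<inter> open_box u r"
    have "\<exists>n. \<forall>i. \<bar>x i - u i\<bar> < rr n i"
    proof -
      define d where "d = Min (range (\<lambda>i. r i - \<bar>x i - u i\<bar>))"
      have "d > 0" using x by (auto simp: d_def open_box_def)
      then obtain n where n: "1 / real (Suc n) < d" using nat_approx_posE by blast
      have "d \<le> r i - \<bar>x i - u i\<bar>" for i by (auto simp: d_def)
      then have "\<bar>x i - u i\<bar> < rr n i" for i using n by (smt (verit, best) rr_def)
      then show ?thesis by blast
    qed
    then show "x \<in> (\<Union>n. K \<inter> open_box u (rr n))" using x by (auto simp: open_box_def)
  next
    fix x assume "x \<in> (\<Union>n. K \<inter> open_box u (rr n))"
    then obtain n where n: "x \<in> K" "\<And>i. \<bar>x i - u i\<bar> < r i - 1 / real (Suc n)" by (auto simp: open_box_def rr_def)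
    have "1 / real (Suc n) > 0" by simp
    then have "\<bar>x i - u i\<bar> < r i" for i using n(2)[of i] by linarith
    then show "x \<in> K \<inter> open_box u r" using n(1) by (auto simp: open_box_def)
  qed
  moreover have "incseq (\<lambda>n. K \<inter> open_box u (rr n))"
  proof (rule incseq_SucI)
    fix n
    have "1 / real (Suc (Suc n)) \<le> 1 / real (Suc n)" by (simp add: field_simps)
    then have "rr n i \<le> rr (Suc n) i" for i by (simp add: rr_def)
    then show "K \<inter> open_box u (rr n) \<subseteq> K \<inter> open_box u (rr (Suc n))" by (auto simp: open_box_def intro: less_le_trans)
  qed
  then have "(SUP n. emeasure lborel_pow (K \<inter> open_box u (rr n))) = emeasure lborel_pow (\<Union>n. K \<inter> open_box u (rr n))"
    by (intro SUP_emeasure_incseq) auto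
  moreover have "(SUP n. emeasure lborel_pow (K \<inter> open_box u (rr n))) \<le> emeasure lborel_pow (K \<inter> open_box (\<lambda>i. l * u i) r)"
    using le by (intro SUP_least)
  ultimately show ?thesis by simp
qed

end

section \<open>The rearrangement inequality on the line\<close>

definition separated :: "(real \<times> real) set \<Rightarrow> bool" where
  "separated S \<longleftrightarrow> finite S \<and> (\<forall>p\<in>S. snd p > 0) \<and>
     (\<forall>p\<in>S. \<forall>q\<in>S. p \<noteq> q \<longrightarrow> snd p + snd q \<le> \<bar>fst p - fst q\<bar>)"

definition intervals :: "(real \<times> real) set \<Rightarrow> real set" where
  "intervals S = (\<Union>p\<in>S. {x. \<bar>x - fst p\<bar> < snd p})"

lemma separatedD:
  assumes "separated S"
  shows "finite S" "p \<in> S \<Longrightarrow> snd p > 0"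
    "p \<in> S \<Longrightarrow> q \<in> S \<Longrightarrow> p \<noteq> q \<Longrightarrow> snd p + snd q \<le> \<bar>fst p - fst q\<bar>"
  using assms by (auto simp: separated_def)

lemma indicator_intervals:
  assumes "separated S"
  shows "indicator (intervals S) x = (\<Sum>p\<in>S. indicator {x. \<bar>x - fst p\<bar> < snd p} x :: ennreal)"
proof -
  have "disjoint_family_on (\<lambda>p. {x. \<bar>x - fst p\<bar> < snd p}) S"
    unfolding disjoint_family_on_def
  proof (intro ballI impI equals0I)
    fix p q x assume pq: "p \<in> S" "q \<in> S" "p \<noteq> q" and "x \<in> {x. \<bar>x - fst p\<bar> < snd p} \<inter> {x. \<bar>x - fst q\<bar> < snd q}"
    then have "\<bar>x - fst p\<bar> < snd p" "\<bar>x - fst q\<bar> < snd q" by auto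
    then show False using separatedD(3)[OF assms pq] by linarith
  qed
  then show ?thesis unfolding intervals_def using separatedD(1)[OF assms] by (simp add: indicator_UN_disjoint)
qed

lemma box_intervals_eq_sum:
  fixes K :: "('m::finite \<Rightarrow> real) set"
  assumes [measurable]: "K \<in> sets lborel_pow" and S: "\<And>i. separated (S i)"
  shows "emeasure lborel_pow (K \<inter> {x. \<forall>i. x i \<in> intervals (S i)})
    = (\<Sum>g\<in>Pi\<^sub>E UNIV S. emeasure lborel_pow (K \<inter> open_box (\<lambda>i. fst (g i)) (\<lambda>i. snd (g i))))"
proof -
  have [measurable]: "intervals (S i) \<in> sets borel" for i unfolding intervals_def
    using separatedD(1)[OF S[of i]] by (intro sets.finite_UN) auto
  have m: "{x. \<forall>i. x i \<in> intervals (S i)} \<in> sets lborel_pow" by (intro sets_lborel_pow_Pi) simp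
  have prod_ind: "(\<Prod>i\<in>UNIV. indicator (A i) (x i)) = (indicator {x. \<forall>i. x i \<in> A i} x :: ennreal)"
    for A :: "'m \<Rightarrow> real set" and x by (auto simp: indicator_def prod_zero_iff)
  have "emeasure lborel_pow (K \<inter> {x. \<forall>i. x i \<in> intervals (S i)})
    = (\<integral>\<^sup>+x. indicator (K \<inter> {x. \<forall>i. x i \<in> intervals (S i)}) x \<partial>lborel_pow)"
    using m by (intro nn_integral_indicator[symmetric]) simp
  also have "\<dots> = (\<integral>\<^sup>+x. (\<Sum>g\<in>Pi\<^sub>E UNIV S. indicator (K \<inter> open_box (\<lambda>i. fst (g i)) (\<lambda>i. snd (g i))) x) \<partial>lborel_pow)"
  proof (rule nn_integral_cong)
    fix x :: "'m \<Rightarrow> real"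
    have "indicator (K \<inter> {x. \<forall>i. x i \<in> intervals (S i)}) x = indicator K x * (\<Prod>i\<in>UNIV. indicator (intervals (S i)) (x i) :: ennreal)"
      by (simp add: prod_ind indicator_inter_arith)
    also have "\<dots> = indicator K x * (\<Sum>g\<in>Pi\<^sub>E UNIV S. \<Prod>i\<in>UNIV. indicator {x. \<bar>x - fst (g i)\<bar> < snd (g i)} (x i))"
      using separatedD(1)[OF S] by (simp add: indicator_intervals[OF S] prod_sum_PiE)
    also have "\<dots> = (\<Sum>g\<in>Pi\<^sub>E UNIV S. indicator (K \<inter> open_box (\<lambda>i. fst (g i)) (\<lambda>i. snd (g i))) x)"
      by (simp add: sum_distrib_left prod_ind open_box_def indicator_inter_arith)
    finally show "indicator (K \<inter> {x. \<forall>i. x i \<in> intervals (S i)}) x =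
      (\<Sum>g\<in>Pi\<^sub>E UNIV S. indicator (K \<inter> open_box (\<lambda>i. fst (g i)) (\<lambda>i. snd (g i))) x :: ennreal)" .
  qed
  also have "\<dots> = (\<Sum>g\<in>Pi\<^sub>E UNIV S. emeasure lborel_pow (K \<inter> open_box (\<lambda>i. fst (g i)) (\<lambda>i. snd (g i))))"
    by (subst nn_integral_sum) auto
  finally show ?thesis .
qed

text \<open>A product of disjoint unions splits into boxes, one for each choice of an interval per
  coordinate, and every box gains when its centre is multiplied by \<open>l\<close>. Separation of
  the scaled families and injectivity of the scaling guarantee that the larger terms add up again to
  the measure of a product of unions.\<close>

lemma box_intervals_contract:
  fixes K :: "('m::finite \<Rightarrow> real) set"
  assumes K: "K \<in> sets lborel_pow" "midconvex_symmetric K" and S: "\<And>i. separated (S i)"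
    and l: "0 \<le> l" "l \<le> 1"
    and S': "\<And>i. separated (apfst ((*) l) ` S i)" and inj: "\<And>i. inj_on (apfst ((*) l)) (S i)"
  shows "emeasure lborel_pow (K \<inter> {x. \<forall>i. x i \<in> intervals (S i)})
    \<le> emeasure lborel_pow (K \<inter> {x. \<forall>i. x i \<in> intervals (apfst ((*) l) ` S i)})"
proof -
  let ?c = "apfst ((*) l) :: real \<times> real \<Rightarrow> real \<times> real"
  have bij: "bij_betw (\<lambda>g i. ?c (g i)) (Pi\<^sub>E UNIV S) (Pi\<^sub>E UNIV (\<lambda>i. ?c ` S i))"
    unfolding bij_betw_def
  proof
    show "inj_on (\<lambda>g i. ?c (g i)) (Pi\<^sub>E UNIV S)"
    proof (rule inj_onI, rule ext)
      fix g h i assume "g \<in> Pi\<^sub>E UNIV S" "h \<in> Pi\<^sub>E UNIV S" "(\<lambda>i. ?c (g i)) = (\<lambda>i. ?c (h i))"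
      then show "g i = h i" using inj_onD[OF inj[of i], of "g i" "h i"] by (metis PiE_mem UNIV_I)
    qed
    show "(\<lambda>g i. ?c (g i)) ` Pi\<^sub>E UNIV S = Pi\<^sub>E UNIV (\<lambda>i. ?c ` S i)"
    proof (intro equalityI subsetI)
      fix g assume g: "g \<in> Pi\<^sub>E UNIV (\<lambda>i. ?c ` S i)"
      then have "\<forall>i. \<exists>p\<in>S i. g i = ?c p" by (auto simp: PiE_UNIV_domain)
      then obtain h where "\<forall>i. h i \<in> S i \<and> g i = ?c (h i)" by metis
      then show "g \<in> (\<lambda>g i. ?c (g i)) ` Pi\<^sub>E UNIV S" by (intro image_eqI[of _ _ h]) auto
    qed auto
  qed
  have "(\<Sum>g\<in>Pi\<^sub>E UNIV S. emeasure lborel_pow (K \<inter> open_box (\<lambda>i. fst (g i)) (\<lambda>i. snd (g i))))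
    \<le> (\<Sum>g\<in>Pi\<^sub>E UNIV S. emeasure lborel_pow (K \<inter> open_box (\<lambda>i. fst (?c (g i))) (\<lambda>i. snd (?c (g i)))))"
    using box_section_contract[OF K l] by (intro sum_mono) simp
  also have "\<dots> = (\<Sum>g\<in>Pi\<^sub>E UNIV (\<lambda>i. ?c ` S i). emeasure lborel_pow (K \<inter> open_box (\<lambda>i. fst (g i)) (\<lambda>i. snd (g i))))"
    by (rule sum.reindex_bij_betw[OF bij, of "\<lambda>g. emeasure lborel_pow (K \<inter> open_box (\<lambda>i. fst (g i)) (\<lambda>i. snd (g i)))"])
  finally show ?thesis using K by (simp add: box_intervals_eq_sum[OF _ S] box_intervals_eq_sum[OF _ S'])
qed

text \<open>The merged interval covers both old ones and also their common endpoint
  \<open>fst p + snd p\<close>. Outside the two, nothing can be closer to the merged interval than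
  the gap conditions with \<open>p\<close> and \<open>q\<close> allow, because no centre lies
  between them.\<close>

lemma merge_touching:
  assumes T: "separated T" and pq: "p \<in> T" "q \<in> T" "fst p < fst q" "snd p + snd q = fst q - fst p"
  defines "m \<equiv> ((fst p - snd p + fst q + snd q) / 2, snd p + snd q)"
  defines "T' \<equiv> insert m (T - {p, q})"
  shows "separated T'" "card T' < card T" "sum snd T' = sum snd T"
    "intervals T \<subseteq> insert (fst p + snd p) (intervals T')"
proof -
  note fin = separatedD(1)[OF T] and pos = separatedD(2)[OF T] and sep = separatedD(3)[OF T]
  have p: "snd p > 0" "snd q > 0" "p \<noteq> q" using pos pq by auto
  have m: "fst m - fst p = snd q" "snd m = snd p + snd q" "fst m - fst q = - snd p"
    using pq(4) by (auto simp: m_def field_simps)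
  have mT: "m \<notin> T - {p, q}"
  proof
    assume "m \<in> T - {p,q}"
    then have "snd m + snd p \<le> \<bar>fst m - fst p\<bar>" using sep[of m p] pq by auto
    then show False using m p by simp
  qed
  have sm: "snd m + snd t \<le> \<bar>fst m - fst t\<bar>" if t: "t \<in> T - {p, q}" for t
  proof -
    have "snd t > 0" using pos t by auto
    moreover have "snd t + snd p \<le> \<bar>fst t - fst p\<bar>" "snd t + snd q \<le> \<bar>fst t - fst q\<bar>"
      using sep[of t p] sep[of t q] pq t by auto
    ultimately show ?thesis using m p pq(3,4) by linarith
  qed
  show "separated T'"
    unfolding separated_def T'_def
  proof (intro conjI ballI impI)
    show "finite (insert m (T - {p, q}))" using fin by simp
    show "snd t > 0" if "t \<in> insert m (T - {p, q})" for t using that pos[of t] m(2) p by auto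
    show "snd s + snd t \<le> \<bar>fst s - fst t\<bar>" if "s \<in> insert m (T - {p, q})" "t \<in> insert m (T - {p, q})" "s \<noteq> t" for s t
      using that sm[of s] sm[of t] sep[of s t] by (auto simp: add.commute abs_minus_commute)
  qed
  have c2: "card {p, q} = 2" using p by simp
  have sub: "{p, q} \<subseteq> T" using pq by simp
  have "card T' = Suc (card (T - {p, q}))" unfolding T'_def using fin mT by simp
  also have "card (T - {p,q}) = card T - 2" using card_Diff_subset[OF _ sub] c2 by simp
  finally show "card T' < card T" using card_mono[OF fin sub] c2 by simp
  have "sum snd T = sum snd (T - {p,q}) + sum snd {p, q}" using sum.subset_diff[OF sub fin] .
  then show "sum snd T' = sum snd T" unfolding T'_def using fin mT m p by simp
  show "intervals T \<subseteq> insert (fst p + snd p) (intervals T')"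
  proof
    fix x assume "x \<in> intervals T"
    then obtain t where t: "t \<in> T" "\<bar>x - fst t\<bar> < snd t" by (auto simp: intervals_def)
    show "x \<in> insert (fst p + snd p) (intervals T')"
    proof (cases "t = p \<or> t = q")
      case True
      then have "\<bar>x - fst p\<bar> < snd p \<or> \<bar>x - fst q\<bar> < snd q" using t by auto
      then have "\<bar>x - fst m\<bar> < snd m" using m p by linarith
      then show ?thesis by (auto simp: intervals_def T'_def)
    next
      case False
      then show ?thesis using t by (auto simp: intervals_def T'_def)
    qed
  qed
qed

lemma null_sets_hyperplane: "{x. x i = a} \<in> null_sets (lborel_pow :: ('m::finite \<Rightarrow> real) measure)"
proof -
  let ?A = "\<lambda>k. if k = i then {a} else UNIV"
  have eq: "{x. x i = a} = {x. \<forall>k. x k \<in> ?A k}" by auto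
  have A: "?A k \<in> sets borel" for k by simp
  have "(\<Prod>k\<in>UNIV. emeasure lborel (?A k)) = 0" by (intro prod_zero) (auto intro!: bexI[of _ i])
  then show ?thesis unfolding eq null_sets_def
    using sets_lborel_pow_Pi[of ?A, OF A] emeasure_lborel_pow_Pi[of ?A, OF A] by simp
qed

text \<open>The induction counts intervals over all coordinates together. Centres shrink by a common
  factor down to the first contact; one merger lowers the count by one and changes the set only
  inside a hyperplane.\<close>

lemma rearrangement_intervals:
  fixes K :: "('m::finite \<Rightarrow> real) set"
  assumes K [measurable]: "K \<in> sets lborel_pow" and msK: "midconvex_symmetric K" 
  shows "(\<And>i. separated (S i)) \<Longrightarrow> emeasure lborel_pow (K \<inter> {x. \<forall>i. x i \<in> intervals (S i)})
     \<le> emeasure lborel_pow (K \<inter> open_box (\<lambda>_. 0) (\<lambda>i. sum snd (S i)))"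
proof (induction "\<Sum>i\<in>UNIV. card (S i)" arbitrary: S rule: less_induct)
  case less
  note S = less.prems
  note fin = separatedD(1)[OF S] and pos = separatedD(2)[OF S] and sep = separatedD(3)[OF S]
  have intm [measurable]: "intervals T \<in> sets borel" if "finite T" for T unfolding intervals_def
    using that by (intro sets.finite_UN) auto
  \<comment> \<open>Two intervals of the same coordinate touch exactly when the centres have been
    scaled by the ratio of the sum of half-lengths to the distance of centres. As the factor
    decreases from 1, the first contact is at the largest ratio; all ratios are at most 1 by
    separation.\<close>
  define D where "D = (\<Union>i. (\<lambda>(p, q). (snd p + snd q) / \<bar>fst p - fst q\<bar>) ` {(p, q) \<in> S i \<times> S i. p \<noteq> q})"
  have "finite {(p, q) \<in> S i \<times> S i. p \<noteq> q}" for i by (rule finite_subset[of _ "S i \<times> S i"]) (use fin in auto)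
  then have finD: "finite D" unfolding D_def by auto
  show ?case
  proof (cases "D = {}")
    case True
    \<comment> \<open>No ratio means at most one interval in each coordinate, so the centres can be
      scaled by 0 at once. An empty family fits as well: its total half-length is 0 and the centred
      interval is empty.\<close>
    then have one: "p = q" if "p \<in> S i" "q \<in> S i" for p q i using that by (fastforce simp: D_def)
    have S0: "intervals (apfst ((*) 0) ` S i) = {x. \<bar>x\<bar> < sum snd (S i)}" "separated (apfst ((*) 0) ` S i)" for i
    proof -
      consider "S i = {}" | p where "S i = {p}" using one[of _ i] by blast
      then show "intervals (apfst ((*) 0) ` S i) = {x. \<bar>x\<bar> < sum snd (S i)}" "separated (apfst ((*) 0) ` S i)"
        by (cases; use pos[of _ i] in \<open>force simp: intervals_def separated_def\<close>)+
    qed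
    have "emeasure lborel_pow (K \<inter> {x. \<forall>i. x i \<in> intervals (S i)})
      \<le> emeasure lborel_pow (K \<inter> {x. \<forall>i. x i \<in> intervals (apfst ((*) 0) ` S i)})"
      by (rule box_intervals_contract[OF K msK S _ _ S0(2)]) (use one in \<open>auto simp: inj_on_def\<close>)
    then show ?thesis unfolding S0(1) by (simp add: open_box_def)
  next
    case False
    define l where "l = Max D"
    have lD: "l \<in> D" unfolding l_def using finD False by (rule Max_in)
    then obtain i z where z: "z \<in> {(p, q) \<in> S i \<times> S i. p \<noteq> q}" "l = (\<lambda>(p, q). (snd p + snd q) / \<bar>fst p - fst q\<bar>) z"
      unfolding D_def by (elim UN_E imageE) 
    obtain p' q' where zz: "z = (p', q')" by (cases z)
    have pq': "p' \<in> S i" "q' \<in> S i" "p' \<noteq> q'" "l = (snd p' + snd q') / \<bar>fst p' - fst q'\<bar>"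
      using z unfolding zz by auto
    have "\<exists>p q. p \<in> S i \<and> q \<in> S i \<and> fst p < fst q \<and> l = (snd p + snd q) / \<bar>fst p - fst q\<bar>"
    proof (cases "fst p' < fst q'")
      case False
      then have "fst q' < fst p'" using sep[OF pq'(1-3)] pos[OF pq'(1)] pos[OF pq'(2)] by linarith
      then show ?thesis using pq' by (intro exI[of _ q'] exI[of _ p']) (simp add: add.commute abs_minus_commute)
    qed (use pq' in blast)
    then obtain p q where pq: "p \<in> S i" "q \<in> S i" "fst p < fst q" "l = (snd p + snd q) / \<bar>fst p - fst q\<bar>" by blast
    have l0: "l > 0" using pq pos[OF pq(1)] pos[OF pq(2)] by simp
    have "p \<noteq> q" using pq by auto
    then have l1: "l \<le> 1" using sep[OF pq(1,2)] pq by (simp add: divide_le_eq_1)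
    have sepl: "snd s + snd t \<le> l * \<bar>fst s - fst t\<bar>" if st: "s \<in> S k" "t \<in> S k" "s \<noteq> t" for s t k
    proof -
      have "(snd s + snd t) / \<bar>fst s - fst t\<bar> \<in> D" using st unfolding D_def by force
      then have "(snd s + snd t) / \<bar>fst s - fst t\<bar> \<le> l" unfolding l_def using finD by simp
      moreover have "\<bar>fst s - fst t\<bar> > 0" using sep[OF st] pos[OF st(1)] pos[OF st(2)] by linarith
      ultimately show ?thesis by (simp add: divide_le_eq)
    qed
    let ?c = "apfst ((*) l) :: real \<times> real \<Rightarrow> real \<times> real"
    have inj: "inj_on ?c (S k)" for k using l0 by (auto simp: inj_on_def)
    have sepc: "separated (?c ` S k)" for k
      unfolding separated_def
    proof (intro conjI ballI impI)
      show "finite (?c ` S k)" using fin by simp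
      show "snd s > 0" if "s \<in> ?c ` S k" for s using that pos by auto
      show "snd s + snd t \<le> \<bar>fst s - fst t\<bar>" if "s \<in> ?c ` S k" "t \<in> ?c ` S k" "s \<noteq> t" for s t
      proof -
        obtain s' t' where "s = ?c s'" "s' \<in> S k" "t = ?c t'" "t' \<in> S k" "s' \<noteq> t'" using \<open>s \<in> _\<close> \<open>t \<in> _\<close> \<open>s \<noteq> t\<close> by auto
        moreover have "\<bar>l * fst s' - l * fst t'\<bar> = l * \<bar>fst s' - fst t'\<bar>" using l0 by (simp add: abs_mult right_diff_distrib[symmetric])
        ultimately show ?thesis using sepl[of s' k t'] by simp
      qed
    qed
    have contract: "emeasure lborel_pow (K \<inter> {x. \<forall>i. x i \<in> intervals (S i)})
       \<le> emeasure lborel_pow (K \<inter> {x. \<forall>i. x i \<in> intervals (?c ` S i)})"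
      using box_intervals_contract[OF K msK S _ l1 sepc inj] l0 by simp
    have lt: "fst (?c p) < fst (?c q)" using l0 pq(3) by (simp add: fst_apfst)
    define m where "m = ((fst (?c p) - snd (?c p) + fst (?c q) + snd (?c q)) / 2, snd (?c p) + snd (?c q))"
    define T where "T = insert m (?c ` S i - {?c p, ?c q})"
    have "l * (fst q - fst p) = snd p + snd q" using pq(3,4) by simp
    then have touch: "snd (?c p) + snd (?c q) = fst (?c q) - fst (?c p)" by (simp add: right_diff_distrib)
    have T: "separated T" "card T < card (?c ` S i)" "sum snd T = sum snd (?c ` S i)"
      "intervals (?c ` S i) \<subseteq> insert (fst (?c p) + snd (?c p)) (intervals T)"
      using merge_touching[OF sepc imageI[OF pq(1)] imageI[OF pq(2)] lt touch] unfolding T_def m_def by blast+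
    define S' where "S' k = (if k = i then T else ?c ` S k)" for k
    have cardc: "card (?c ` S k) = card (S k)" for k by (rule card_image[OF inj])
    have sumc: "sum snd (?c ` S k) = sum snd (S k)" for k by (simp add: sum.reindex[OF inj])
    have "(\<Sum>k\<in>UNIV. card (S' k)) < (\<Sum>k\<in>UNIV. card (S k))"
    proof (rule sum_strict_mono_ex1)
      show "\<forall>k\<in>UNIV. card (S' k) \<le> card (S k)" using T(2) cardc by (auto simp: S'_def)
      show "\<exists>k\<in>UNIV. card (S' k) < card (S k)" using T(2) cardc by (auto simp: S'_def intro!: exI[of _ i])
    qed simp
    moreover have "separated (S' k)" for k using T(1) sepc by (simp add: S'_def)
    ultimately have IH: "emeasure lborel_pow (K \<inter> {x. \<forall>i. x i \<in> intervals (S' i)})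
      \<le> emeasure lborel_pow (K \<inter> open_box (\<lambda>_. 0) (\<lambda>i. sum snd (S' i)))" by (rule less.hyps)
    have N: "{x. x i = fst (?c p) + snd (?c p)} \<in> null_sets (lborel_pow :: ('m \<Rightarrow> real) measure)" by (rule null_sets_hyperplane)
    have mS': "{x. \<forall>i. x i \<in> intervals (S' i)} \<in> sets lborel_pow"
      using T(1) sepc by (intro sets_lborel_pow_Pi intm) (auto simp: S'_def dest: separatedD(1))
    have "emeasure lborel_pow (K \<inter> {x. \<forall>i. x i \<in> intervals (?c ` S i)})
      \<le> emeasure lborel_pow (K \<inter> {x. \<forall>i. x i \<in> intervals (S' i)} \<union> {x. x i = fst (?c p) + snd (?c p)})"
    proof (rule emeasure_mono)
      show "K \<inter> {x. \<forall>i. x i \<in> intervals (?c ` S i)} \<subseteq> K \<inter> {x. \<forall>i. x i \<in> intervals (S' i)} \<union> {x. x i = fst (?c p) + snd (?c p)}"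
        using T(4) by (auto simp: S'_def)
    qed (use N mS' in auto)
    also have "\<dots> = emeasure lborel_pow (K \<inter> {x. \<forall>i. x i \<in> intervals (S' i)})"
      by (intro emeasure_Un_null_set N) (use mS' in auto)
    finally have "emeasure lborel_pow (K \<inter> {x. \<forall>i. x i \<in> intervals (S i)}) \<le> emeasure lborel_pow (K \<inter> open_box (\<lambda>_. 0) (\<lambda>i. sum snd (S' i)))"
      using contract IH by (blast intro: order_trans)
    moreover have "(\<lambda>i. sum snd (S' i)) = (\<lambda>i. sum snd (S i))" using T(3) sumc by (auto simp: S'_def)
    ultimately show ?thesis by simp
  qed
qed


text \<open>Finite measure bounds the length of each component, so components are bounded open
  intervals. There may be infinitely many; finite subfamilies from an enumeration increase to
  \<open>U\<close>.\<close>

lemma open_set_eq_UN_intervals: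
  fixes U :: "real set"
  assumes "open U" and fin: "emeasure lborel U < \<infinity>"
  shows "\<exists>S. (\<forall>n. separated (S n)) \<and> incseq (\<lambda>n::nat. intervals (S n)) \<and> U = (\<Union>n. intervals (S n))"
proof -
  have comp: "\<exists>c r. r > 0 \<and> C = {x. \<bar>x - c\<bar> < r}" if C: "C \<in> components U" for C
  proof -
    have C': "open C" "connected C" "C \<noteq> {}" "C \<subseteq> U"
      using C \<open>open U\<close> by (auto simp: open_components in_components_connected in_components_nonempty in_components_subset)
    obtain L where L: "emeasure lborel U = ennreal L" "L \<ge> 0" using fin by (cases "emeasure lborel U") auto
    have len: "y - x \<le> L" if "x \<in> C" "y \<in> C" for x y
    proof (cases "x \<le> y")
      case True
      have "{x..y} \<subseteq> U" using C' that connected_contains_Icc by blast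
      then have "emeasure lborel {x..y} \<le> emeasure lborel U" using \<open>open U\<close> by (intro emeasure_mono) auto
      then show ?thesis using True L by (simp add: ennreal_le_iff)
    qed (use L in auto)
    obtain w where w: "w \<in> C" using C' by auto
    have bd: "bdd_above C" "bdd_below C"
      using len[OF w] len[OF _ w] by (auto intro!: bdd_aboveI[of _ "w + L"] bdd_belowI[of _ "w - L"] simp: algebra_simps)
    define a b where "a = Inf C" and "b = Sup C"
    have "C = {a<..<b}"
    proof (intro equalityI subsetI)
      fix x assume x: "x \<in> C"
      then obtain e where e: "e > 0" "ball x e \<subseteq> C" using C'(1) open_contains_ball by blast
      have "x + e/2 \<in> C" "x - e/2 \<in> C" using e by (auto simp: subset_iff dist_real_def)
      then have "x + e/2 \<le> b" "a \<le> x - e/2" unfolding a_def b_def using bd by (auto intro: cSup_upper cInf_lower)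
      then show "x \<in> {a<..<b}" using e(1) by auto
    next
      fix x assume "x \<in> {a<..<b}"
      then obtain y z where "y \<in> C" "y < x" "z \<in> C" "x < z"
        unfolding a_def b_def using bd C'(3) by (auto simp: cInf_less_iff less_cSup_iff)
      then show "x \<in> C" using C'(2) connectedD_interval[of C y z x] by auto
    qed
    moreover have "a < b" using calculation w by auto
    ultimately show ?thesis
      by (intro exI[of _ "(a+b)/2"] exI[of _ "(b-a)/2"]) (auto simp: abs_less_iff field_simps)
  qed
  then obtain c r where cr: "\<And>C. C \<in> components U \<Longrightarrow> r C > 0 \<and> C = {x. \<bar>x - c C\<bar> < r C}" by metis
  have "countable (components U)"
    using \<open>open U\<close> by (intro countable_disjoint_open_subsets) (auto simp: open_components disjoint_def components_nonoverlap)
  then have "\<exists>n. from_nat_into (components U) n = C" if "C \<in> components U" for C using that by (rule from_nat_into_surj)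
  then obtain e :: "nat \<Rightarrow> real set" where e: "components U \<subseteq> range e" by (metis image_eqI subsetI UNIV_I)
  define S where "S n = (\<lambda>C. (c C, r C)) ` (components U \<inter> e ` {..n})" for n
  have int: "intervals (S n) = \<Union>(components U \<inter> e ` {..n})" for n
  proof -
    have "intervals (S n) = (\<Union>C\<in>components U \<inter> e ` {..n}. {x. \<bar>x - c C\<bar> < r C})"
      by (auto simp: intervals_def S_def)
    also have "\<dots> = (\<Union>C\<in>components U \<inter> e ` {..n}. C)" using cr by (intro SUP_cong) auto
    finally show ?thesis by simp
  qed
  have "separated (S n)" for n
    unfolding separated_def
  proof (intro conjI ballI impI)
    show "finite (S n)" by (simp add: S_def)
    show "snd p > 0" if "p \<in> S n" for p using that cr by (auto simp: S_def)
    fix p q assume "p \<in> S n" "q \<in> S n" "p \<noteq> q"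
    obtain C where C: "C \<in> components U" "p = (c C, r C)" using \<open>p \<in> S n\<close> unfolding S_def by blast
    obtain D where D: "D \<in> components U" "q = (c D, r D)" using \<open>q \<in> S n\<close> unfolding S_def by blast
    have CD: "C \<in> components U" "D \<in> components U" "p = (c C, r C)" "q = (c D, r D)" "C \<noteq> D"
      using C D \<open>p \<noteq> q\<close> by auto
    then have "C \<inter> D = {}" using components_nonoverlap by blast
    then have dis: "{x. \<bar>x - c C\<bar> < r C} \<inter> {x. \<bar>x - c D\<bar> < r D} = {}" and pos: "r C > 0" "r D > 0" using cr CD by blast+
    show "snd p + snd q \<le> \<bar>fst p - fst q\<bar>"
    proof (rule ccontr)
      assume "\<not> snd p + snd q \<le> \<bar>fst p - fst q\<bar>"
      then have lt: "\<bar>c C - c D\<bar> < r C + r D" using CD by simp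
      \<comment> \<open>The point dividing the segment between the centres in the ratio of the
        radii: if the gap condition failed, it would lie in both intervals.\<close>
      define x where "x = (r D * c C + r C * c D) / (r C + r D)"
      have "x - c C = (c D - c C) * (r C / (r C + r D))" "x - c D = (c C - c D) * (r D / (r C + r D))"
        using pos by (auto simp: x_def field_simps)
      then have "\<bar>x - c C\<bar> = \<bar>c C - c D\<bar> * (r C / (r C + r D))" "\<bar>x - c D\<bar> = \<bar>c C - c D\<bar> * (r D / (r C + r D))"
        using pos by (simp_all add: abs_mult abs_minus_commute)
      moreover have "t * (a / (r C + r D)) < a" if "t < r C + r D" "a > 0" for t a
        using mult_strict_right_mono[OF that] pos by (simp add: pos_divide_less_eq mult.commute)
      ultimately have "\<bar>x - c C\<bar> < r C" "\<bar>x - c D\<bar> < r D" using lt pos by presburger+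
      then show False using dis by auto
    qed
  qed
  moreover have "incseq (\<lambda>n. intervals (S n))" unfolding int by (fastforce simp: incseq_def)
  moreover have "U = (\<Union>n. intervals (S n))"
  proof -
    have "\<Union>(components U) \<subseteq> (\<Union>n. intervals (S n))"
    proof (rule Union_least)
      fix C assume C: "C \<in> components U"
      then obtain n where "C = e n" using e by auto
      then have "C \<subseteq> intervals (S n)" unfolding int using C by auto
      then show "C \<subseteq> (\<Union>n. intervals (S n))" by auto
    qed
    moreover have "(\<Union>n. intervals (S n)) \<subseteq> \<Union>(components U)" unfolding int by blast
    ultimately have "\<Union>(components U) = (\<Union>n. intervals (S n))" by (rule antisym)
    then show ?thesis unfolding Union_components .
  qed
  ultimately show ?thesis by blast
qed

lemma emeasure_intervals:
  assumes "separated S"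
  shows "emeasure lborel (intervals S) = ennreal (2 * sum snd S)"
proof -
  note fin = separatedD(1)[OF assms]
  have "intervals S \<in> sets borel" unfolding intervals_def using fin by (intro sets.finite_UN) auto
  then have "emeasure lborel (intervals S) = (\<integral>\<^sup>+x. indicator (intervals S) x \<partial>lborel)" by simp
  also have "\<dots> = (\<Sum>p\<in>S. emeasure lborel {x. \<bar>x - fst p\<bar> < snd p})"
    by (simp add: indicator_intervals[OF assms] nn_integral_sum)
  also have "\<dots> = (\<Sum>p\<in>S. ennreal (2 * snd p))"
  proof (rule sum.cong)
    fix p assume "p \<in> S"
    have "{x. \<bar>x - fst p\<bar> < snd p} = {fst p - snd p<..<fst p + snd p}" by auto
    then show "emeasure lborel {x. \<bar>x - fst p\<bar> < snd p} = ennreal (2 * snd p)"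
      using separatedD(2)[OF assms \<open>p \<in> S\<close>] by simp
  qed simp
  also have "\<dots> = ennreal (2 * sum snd S)"
    using separatedD(2)[OF assms] by (subst sum_ennreal) (auto simp: sum_distrib_left intro: less_imp_le)
  finally show ?thesis .
qed

lemma open_box_mono: "(\<And>i. r i \<le> s i) \<Longrightarrow> open_box u r \<subseteq> open_box u s"
  by (auto simp: open_box_def intro: less_le_trans)

lemma rearrangement_open:
  fixes K :: "('m::finite \<Rightarrow> real) set"
  assumes K [measurable]: "K \<in> sets lborel_pow" and msK: "midconvex_symmetric K"
    and U: "\<And>i. open (U i)" "\<And>i. emeasure lborel (U i) \<le> ennreal (2 * r i)" and r: "\<And>i. r i \<ge> 0"
  shows "emeasure lborel_pow (K \<inter> {x. \<forall>i. x i \<in> U i}) \<le> emeasure lborel_pow (K \<inter> open_box (\<lambda>_. 0) r)"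
proof -
  have "\<exists>S. (\<forall>n. separated (S n)) \<and> incseq (\<lambda>n::nat. intervals (S n)) \<and> U i = (\<Union>n. intervals (S n))" for i
    using U(1)[of i] le_less_trans[OF U(2)[of i]] by (intro open_set_eq_UN_intervals) auto
  then obtain S where S: "\<And>i n. separated (S i n)" "\<And>i. incseq (\<lambda>n::nat. intervals (S i n))" "\<And>i. U i = (\<Union>n. intervals (S i n))"
    by metis
  have intm: "intervals (S i n) \<in> sets borel" for i n
    unfolding intervals_def using separatedD(1)[OF S(1)] by (intro sets.finite_UN) auto
  have le: "emeasure lborel_pow (K \<inter> {x. \<forall>i. x i \<in> intervals (S i n)}) \<le> emeasure lborel_pow (K \<inter> open_box (\<lambda>_. 0) r)" for n
  proof -
    have "sum snd (S i n) \<le> r i" for i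
    proof -
      have "emeasure lborel (intervals (S i n)) \<le> emeasure lborel (U i)"
        by (rule emeasure_mono) (use S(3)[of i] borel_open[OF U(1)[of i]] in \<open>auto simp del: borel_open\<close>)
      then have "ennreal (2 * sum snd (S i n)) \<le> ennreal (2 * r i)" using U(2)[of i] unfolding emeasure_intervals[OF S(1)] by (rule order_trans)
      then show ?thesis using r[of i] by (simp add: ennreal_le_iff)
    qed
    then have "emeasure lborel_pow (K \<inter> open_box (\<lambda>_. 0) (\<lambda>i. sum snd (S i n))) \<le> emeasure lborel_pow (K \<inter> open_box (\<lambda>_. 0) r)"
      using open_box_mono[of "\<lambda>i. sum snd (S i n)" r] by (intro emeasure_mono) auto
    with rearrangement_intervals[OF K msK S(1)] show ?thesis by (rule order_trans)
  qed
  have inc: "incseq (\<lambda>n. K \<inter> {x. \<forall>i. x i \<in> intervals (S i n)})" using S(2) by (fastforce simp: incseq_def)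
  have "K \<inter> {x. \<forall>i. x i \<in> U i} = (\<Union>n. K \<inter> {x. \<forall>i. x i \<in> intervals (S i n)})"
  proof (intro equalityI subsetI)
    fix x assume x: "x \<in> K \<inter> {x. \<forall>i. x i \<in> U i}"
    then have "\<forall>i. \<exists>n. x i \<in> intervals (S i n)" using S(3) by auto
    then obtain n where n: "\<And>i. x i \<in> intervals (S i (n i))" by metis
    have "n i \<le> Max (range n)" for i by simp
    then have "x i \<in> intervals (S i (Max (range n)))" for i using subsetD[OF incseqD[OF S(2)] n] by blast
    then show "x \<in> (\<Union>n. K \<inter> {x. \<forall>i. x i \<in> intervals (S i n)})" using x by auto
  qed (use S(3) in auto)
  moreover have "(SUP n. emeasure lborel_pow (K \<inter> {x. \<forall>i. x i \<in> intervals (S i n)})) = emeasure lborel_pow (\<Union>n. K \<inter> {x. \<forall>i. x i \<in> intervals (S i n)})"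
    using inc intm by (intro SUP_emeasure_incseq) (auto intro!: sets.Int sets_lborel_pow_Pi)
  moreover have "(SUP n. emeasure lborel_pow (K \<inter> {x. \<forall>i. x i \<in> intervals (S i n)})) \<le> emeasure lborel_pow (K \<inter> open_box (\<lambda>_. 0) r)"
    using le by (intro SUP_least)
  ultimately show ?thesis by simp
qed

lemma emeasure_open_box: "(\<And>i. r i \<ge> 0) \<Longrightarrow> emeasure lborel_pow (open_box u r) = ennreal (\<Prod>i\<in>UNIV. 2 * r (i::'m::finite))"
proof -
  assume r: "\<And>i. r i \<ge> 0"
  have "open_box u r = {x. \<forall>i. x i \<in> {u i - r i<..<u i + r i}}" by (auto simp: open_box_def abs_less_iff algebra_simps)
  then have "emeasure lborel_pow (open_box u r) = (\<Prod>i\<in>UNIV. emeasure lborel {u i - r i<..<u i + r i})"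
    using emeasure_lborel_pow_Pi[of "\<lambda>i. {u i - r i<..<u i + r i}"] by simp
  also have "\<dots> = (\<Prod>i\<in>UNIV. ennreal (2 * r i))" using r by (intro prod.cong) auto
  finally show ?thesis using r by (simp add: prod_ennreal)
qed

theorem rearrangement_line:
  fixes K :: "('m::finite \<Rightarrow> real) set"
  assumes K [measurable]: "K \<in> sets lborel_pow" and msK: "midconvex_symmetric K"
    and E: "\<And>i. E i \<in> sets borel" "\<And>i. emeasure lborel (E i) = ennreal (2 * r i)" and r: "\<And>i. r i \<ge> 0"
  shows "emeasure lborel_pow (K \<inter> {x. \<forall>i. x i \<in> E i}) \<le> emeasure lborel_pow (K \<inter> open_box (\<lambda>_. 0) r)"
proof -
  define rr where "rr n i = r i + 1 / real (Suc n)" for n i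
  have rr0: "rr n i \<ge> 0" for n i using r[of i] by (simp add: rr_def)
  have le: "emeasure lborel_pow (K \<inter> {x. \<forall>i. x i \<in> E i}) \<le> emeasure lborel_pow (K \<inter> open_box (\<lambda>_. 0) (rr n))" for n
  proof -
    have "\<exists>U. open U \<and> E i \<subseteq> U \<and> emeasure lborel U \<le> ennreal (2 * rr n i)" for i
    proof -
      obtain U where U: "open U" "E i \<subseteq> U" "emeasure lborel (U - E i) < ennreal (2 / real (Suc n))"
        using outer_regular_lborel[OF E(1)[of i], of "2 / real (Suc n)"] by auto
      have "emeasure lborel U = emeasure lborel (E i \<union> (U - E i))" using U(2) by (intro arg_cong2[where f = emeasure]) auto
      also have "\<dots> \<le> emeasure lborel (E i) + emeasure lborel (U - E i)" using U(1) E(1)[of i] by (intro emeasure_subadditive) auto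
      also have "\<dots> \<le> ennreal (2 * r i) + ennreal (2 / real (Suc n))" using U(3) E(2)[of i] by (intro add_mono) auto
      also have "\<dots> = ennreal (2 * rr n i)" using r[of i] by (simp add: ennreal_plus[symmetric] rr_def ring_distribs del: ennreal_plus)
      finally show ?thesis using U by blast
    qed
    then obtain U where U: "\<And>i. open (U i)" "\<And>i. E i \<subseteq> U i" "\<And>i. emeasure lborel (U i) \<le> ennreal (2 * rr n i)" by metis
    have "emeasure lborel_pow (K \<inter> {x. \<forall>i. x i \<in> E i}) \<le> emeasure lborel_pow (K \<inter> {x. \<forall>i. x i \<in> U i})"
      using U(1,2) by (intro emeasure_mono) (auto intro!: sets.Int sets_lborel_pow_Pi)
    also have "\<dots> \<le> emeasure lborel_pow (K \<inter> open_box (\<lambda>_. 0) (rr n))"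
      by (rule rearrangement_open[OF K msK U(1) U(3) rr0])
    finally show ?thesis .
  qed
  have "(INF n. emeasure lborel_pow (K \<inter> open_box (\<lambda>_. 0) (rr n))) = emeasure lborel_pow (\<Inter>n. K \<inter> open_box (\<lambda>_. 0) (rr n))"
  proof (intro INF_emeasure_decseq)
    show "decseq (\<lambda>n. K \<inter> open_box (\<lambda>_. 0) (rr n))"
    proof (rule decseq_SucI)
      fix n
      have "rr (Suc n) i \<le> rr n i" for i by (simp add: rr_def field_simps)
      then show "K \<inter> open_box (\<lambda>_. 0) (rr (Suc n)) \<subseteq> K \<inter> open_box (\<lambda>_. 0) (rr n)" using open_box_mono by blast
    qed
    show "emeasure lborel_pow (K \<inter> open_box (\<lambda>_. 0) (rr n)) \<noteq> \<infinity>" for n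
    proof -
      have "emeasure lborel_pow (K \<inter> open_box (\<lambda>_. 0) (rr n)) \<le> emeasure lborel_pow (open_box (\<lambda>_. 0) (rr n))"
        by (intro emeasure_mono) auto
      also have "\<dots> < \<infinity>" using rr0 by (simp add: emeasure_open_box)
      finally show ?thesis by simp
    qed
  qed auto
  moreover have "emeasure lborel_pow (K \<inter> {x. \<forall>i. x i \<in> E i}) \<le> (INF n. emeasure lborel_pow (K \<inter> open_box (\<lambda>_. 0) (rr n)))"
    using le by (intro INF_greatest)
  ultimately have "emeasure lborel_pow (K \<inter> {x. \<forall>i. x i \<in> E i}) \<le> emeasure lborel_pow (\<Inter>n. K \<inter> open_box (\<lambda>_. 0) (rr n))" by simp
  \<comment> \<open>The enlarged open boxes shrink to the closed box. Its faces lie in hyperplanes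
    and are null, which leads back to the open box.\<close>
  also have "\<dots> \<le> emeasure lborel_pow (K \<inter> open_box (\<lambda>_. 0) r \<union> (\<Union>i\<in>UNIV. {x. x i = r i} \<union> {x. x i = - r i}))"
  proof (rule emeasure_mono)
    show "(\<Inter>n. K \<inter> open_box (\<lambda>_. 0) (rr n)) \<subseteq> K \<inter> open_box (\<lambda>_. 0) r \<union> (\<Union>i\<in>UNIV. {x. x i = r i} \<union> {x. x i = - r i})"
    proof
      fix x assume x: "x \<in> (\<Inter>n. K \<inter> open_box (\<lambda>_. 0) (rr n))"
      have "\<bar>x i\<bar> \<le> r i" for i
      proof (rule field_le_epsilon)
        fix e :: real assume "e > 0"
        then obtain n where "1 / real (Suc n) < e" using nat_approx_posE by blast
        moreover have "\<bar>x i\<bar> < rr n i" using x by (auto simp: open_box_def)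
        ultimately show "\<bar>x i\<bar> \<le> r i + e" by (simp add: rr_def)
      qed
      then have "x \<in> open_box (\<lambda>_. 0) r \<or> (\<exists>i. \<bar>x i\<bar> = r i)" by (force simp: open_box_def less_le)
      then have "x \<in> open_box (\<lambda>_. 0) r \<or> (\<exists>i. x i = r i \<or> x i = - r i)" unfolding abs_eq_iff' by blast
      then show "x \<in> K \<inter> open_box (\<lambda>_. 0) r \<union> (\<Union>i\<in>UNIV. {x. x i = r i} \<union> {x. x i = - r i})" using x by auto
    qed
    show "K \<inter> open_box (\<lambda>_. 0) r \<union> (\<Union>i\<in>UNIV. {x. x i = r i} \<union> {x. x i = - r i}) \<in> sets lborel_pow"
      by (intro sets.Un sets.Int sets.finite_UN) (auto intro!: null_setsD2 null_sets_hyperplane)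
  qed
  also have "\<dots> = emeasure lborel_pow (K \<inter> open_box (\<lambda>_. 0) r)"
    by (intro emeasure_Un_null_set null_sets_UN' null_sets.Un null_sets_hyperplane) auto
  finally show ?thesis .
qed

section \<open>Integration along a direction and Steiner symmetrization\<close>

lemma measurable_shift_along [measurable]:
  "(\<lambda>(x, t) i. x i + t i *\<^sub>R \<theta>) \<in> (lborel_pow :: ('m::finite \<Rightarrow> 'a::euclidean_space) measure) \<Otimes>\<^sub>M (lborel_pow :: ('m \<Rightarrow> real) measure) \<rightarrow>\<^sub>M lborel_pow"
  unfolding case_prod_beta by (rule measurable_PiM_single') (auto simp: space_PiM)

text \<open>Fubini along \<open>\<theta>\<close> without a basis adapted to \<open>\<theta>\<close>:
  integration over the orthogonal hyperplane is replaced by integration over the slab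
  \<open>0 \<le> x \<bullet> \<theta> < 1\<close> of thickness one, since the inner integral depends
  only on the orthogonal parts.\<close>

lemma nn_integral_lborel_pow_along_direction:
  fixes h :: "('m::finite \<Rightarrow> 'a::euclidean_space) \<Rightarrow> ennreal"
  assumes \<theta>: "norm \<theta> = 1" and h [measurable]: "h \<in> borel_measurable lborel_pow"
  shows "(\<integral>\<^sup>+x. h x \<partial>lborel_pow) =
    (\<integral>\<^sup>+x. (\<Prod>i\<in>UNIV. indicator {0..<1} (x i \<bullet> \<theta>)) *
      (\<integral>\<^sup>+t. h (\<lambda>i. x i - (x i \<bullet> \<theta>) *\<^sub>R \<theta> + t i *\<^sub>R \<theta>) \<partial>(lborel_pow :: ('m \<Rightarrow> real) measure)) \<partial>lborel_pow)"
proof -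
  let ?M = "lborel_pow :: ('m \<Rightarrow> 'a) measure" and ?T = "lborel_pow :: ('m \<Rightarrow> real) measure"
  interpret M: sigma_finite_measure ?M by (rule sigma_finite_lborel_pow)
  interpret T: sigma_finite_measure ?T by (rule sigma_finite_lborel_pow)
  interpret MT: pair_sigma_finite ?M ?T ..
  interpret P: product_sigma_finite "\<lambda>_. lborel :: real measure" ..
  have \<theta>1: "\<theta> \<bullet> \<theta> = 1" using \<theta> by (simp add: norm_eq_1)
  have shift: "(\<lambda>p. h (\<lambda>i. fst p i + snd p i *\<^sub>R \<theta>)) \<in> borel_measurable (?M \<Otimes>\<^sub>M ?T)"
    using measurable_compose[OF measurable_shift_along h, of \<theta>] by (simp add: case_prod_beta)
  have shift_t: "(\<lambda>t. h (\<lambda>i. y i + t i *\<^sub>R \<theta>)) \<in> borel_measurable ?T" for y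
    using measurable_compose[OF measurable_Pair1' shift, of y] by simp
  have \<phi>[measurable]: "(\<lambda>x. (\<Prod>i\<in>UNIV. indicator {0..<1} (x i \<bullet> \<theta>)) :: ennreal) \<in> borel_measurable ?M" by measurable
  have 1: "(\<integral>\<^sup>+t. h (\<lambda>i. x i - (x i \<bullet> \<theta>) *\<^sub>R \<theta> + t i *\<^sub>R \<theta>) \<partial>?T) = (\<integral>\<^sup>+t. h (\<lambda>i. x i + t i *\<^sub>R \<theta>) \<partial>?T)" for x
    using nn_integral_lborel_pow_translate[of "\<lambda>t. h (\<lambda>i. x i - (x i \<bullet> \<theta>) *\<^sub>R \<theta> + t i *\<^sub>R \<theta>)" "\<lambda>i. x i \<bullet> \<theta>"]
      shift_t[of "\<lambda>i. x i - (x i \<bullet> \<theta>) *\<^sub>R \<theta>"]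
    by (simp add: algebra_simps)
  have "(\<integral>\<^sup>+x. (\<Prod>i\<in>UNIV. indicator {0..<1} (x i \<bullet> \<theta>)) * (\<integral>\<^sup>+t. h (\<lambda>i. x i - (x i \<bullet> \<theta>) *\<^sub>R \<theta> + t i *\<^sub>R \<theta>) \<partial>?T) \<partial>?M)
    = (\<integral>\<^sup>+x. (\<integral>\<^sup>+t. (\<Prod>i\<in>UNIV. indicator {0..<1} (x i \<bullet> \<theta>)) * h (\<lambda>i. x i + t i *\<^sub>R \<theta>) \<partial>?T) \<partial>?M)"
    unfolding 1 using shift_t by (intro nn_integral_cong) (simp add: nn_integral_cmult)
  also have "\<dots> = (\<integral>\<^sup>+t. (\<integral>\<^sup>+x. (\<Prod>i\<in>UNIV. indicator {0..<1} (x i \<bullet> \<theta>)) * h (\<lambda>i. x i + t i *\<^sub>R \<theta>) \<partial>?M) \<partial>?T)"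
    using shift by (intro MT.Fubini'[symmetric]) (simp add: case_prod_beta)
  \<comment> \<open>Translating \<open>x\<close> by \<open>- t \<theta>\<close> moves all dependence
    on \<open>t\<close> into the slab, and for fixed \<open>x\<close> the values \<open>t i\<close>
    with \<open>x i\<close> in the moved slab form an interval of length one.\<close>
  also have "\<dots> = (\<integral>\<^sup>+t. (\<integral>\<^sup>+x. (\<Prod>i\<in>UNIV. indicator {0..<1} (x i \<bullet> \<theta> - t i)) * h x \<partial>?M) \<partial>?T)"
  proof (rule nn_integral_cong)
    fix t :: "'m \<Rightarrow> real"
    have [measurable]: "(\<lambda>x. (\<Prod>i\<in>UNIV. indicator {0..<1} (x i \<bullet> \<theta> - t i)) :: ennreal) \<in> borel_measurable ?M" by measurable
    show "(\<integral>\<^sup>+x. (\<Prod>i\<in>UNIV. indicator {0..<1} (x i \<bullet> \<theta>)) * h (\<lambda>i. x i + t i *\<^sub>R \<theta>) \<partial>?M)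
      = (\<integral>\<^sup>+x. (\<Prod>i\<in>UNIV. indicator {0..<1} (x i \<bullet> \<theta> - t i)) * h x \<partial>?M)"
      using nn_integral_lborel_pow_translate[of "\<lambda>x. (\<Prod>i\<in>UNIV. indicator {0..<1} (x i \<bullet> \<theta> - t i)) * h x" "\<lambda>i. t i *\<^sub>R \<theta>"]
      by (simp add: inner_add_left \<theta>1 add.commute)
  qed
  also have "\<dots> = (\<integral>\<^sup>+x. (\<integral>\<^sup>+t. (\<Prod>i\<in>UNIV. indicator {0..<1} (x i \<bullet> \<theta> - t i)) * h x \<partial>?T) \<partial>?M)"
    by (rule MT.Fubini') (unfold case_prod_beta, measurable)
  also have "\<dots> = (\<integral>\<^sup>+x. h x \<partial>?M)"
  proof (rule nn_integral_cong)
    fix x :: "'m \<Rightarrow> 'a"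
    have one: "(\<integral>\<^sup>+s. indicator {0..<1} (c - s) \<partial>lborel) = (1::ennreal)" for c :: real
    proof -
      have "(\<integral>\<^sup>+s. indicator {0..<1} (c - s) \<partial>lborel) = (\<integral>\<^sup>+s. indicator {c-1<..c} s \<partial>lborel :: ennreal)"
        by (intro nn_integral_cong) (auto simp: indicator_def)
      then show ?thesis by simp
    qed
    have "(\<integral>\<^sup>+t. (\<Prod>i\<in>UNIV. indicator {0..<1} (x i \<bullet> \<theta> - t i)) * h x \<partial>?T)
       = (\<integral>\<^sup>+t. (\<Prod>i\<in>UNIV. indicator {0..<1} (x i \<bullet> \<theta> - t i)) \<partial>?T) * h x"
      by (intro nn_integral_multc) measurable
    also have "(\<integral>\<^sup>+t. (\<Prod>i\<in>UNIV. indicator {0..<1} (x i \<bullet> \<theta> - t i)) \<partial>?T) = (\<Prod>i\<in>UNIV. \<integral>\<^sup>+s. indicator {0..<1} (x i \<bullet> \<theta> - s) \<partial>lborel)"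
      by (rule P.product_nn_integral_prod) auto
    finally show "(\<integral>\<^sup>+t. (\<Prod>i\<in>UNIV. indicator {0..<1} (x i \<bullet> \<theta> - t i)) * h x \<partial>?T) = h x" by (simp add: one)
  qed
  finally show ?thesis by simp
qed

lemma nn_integral_along_direction:
  fixes h :: "'a::euclidean_space \<Rightarrow> ennreal"
  assumes \<theta>: "norm \<theta> = 1" and h [measurable]: "h \<in> borel_measurable borel"
  shows "(\<integral>\<^sup>+x. h x \<partial>lborel) = (\<integral>\<^sup>+x. indicator {0..<1} (x \<bullet> \<theta>) * (\<integral>\<^sup>+t. h (x - (x \<bullet> \<theta>) *\<^sub>R \<theta> + t *\<^sub>R \<theta>) \<partial>lborel) \<partial>lborel)"
proof -
  interpret A: product_sigma_finite "\<lambda>_::unit. lborel :: 'a measure" ..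
  interpret R: product_sigma_finite "\<lambda>_::unit. lborel :: real measure" ..
  have a: "(\<integral>\<^sup>+x. u (x ()) \<partial>lborel_pow) = (\<integral>\<^sup>+x. u x \<partial>lborel)" if "u \<in> borel_measurable borel" for u :: "'a \<Rightarrow> ennreal"
    using A.product_nn_integral_singleton[of u "()"] that by (simp add: UNIV_unit)
  have r: "(\<integral>\<^sup>+x. u (x ()) \<partial>lborel_pow) = (\<integral>\<^sup>+x. u x \<partial>lborel)" if "u \<in> borel_measurable borel" for u :: "real \<Rightarrow> ennreal"
    using R.product_nn_integral_singleton[of u "()"] that by (simp add: UNIV_unit)
  have "(\<integral>\<^sup>+x. h x \<partial>lborel) = (\<integral>\<^sup>+x. h (x ()) \<partial>lborel_pow)" by (rule a[symmetric]) measurable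
  also have "\<dots> = (\<integral>\<^sup>+x. indicator {0..<1} (x () \<bullet> \<theta>) *
      (\<integral>\<^sup>+t. h (x () - (x () \<bullet> \<theta>) *\<^sub>R \<theta> + t () *\<^sub>R \<theta>) \<partial>(lborel_pow :: (unit \<Rightarrow> real) measure)) \<partial>lborel_pow)"
    by (subst nn_integral_lborel_pow_along_direction[OF \<theta>]) (simp_all add: UNIV_unit)
  also have "\<dots> = (\<integral>\<^sup>+x. indicator {0..<1} (x () \<bullet> \<theta>) * (\<integral>\<^sup>+t. h (x () - (x () \<bullet> \<theta>) *\<^sub>R \<theta> + t *\<^sub>R \<theta>) \<partial>lborel) \<partial>lborel_pow)"
    by (intro nn_integral_cong arg_cong2[where f="(*)"] refl r) measurable
  also have "\<dots> = (\<integral>\<^sup>+x. indicator {0..<1} (x \<bullet> \<theta>) * (\<integral>\<^sup>+t. h (x - (x \<bullet> \<theta>) *\<^sub>R \<theta> + t *\<^sub>R \<theta>) \<partial>lborel) \<partial>lborel)"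
    by (rule a) measurable
  finally show ?thesis .
qed

section \<open>Fibre lengths and Steiner symmetrals\<close>

definition fibre_length :: "'a::euclidean_space \<Rightarrow> 'a set \<Rightarrow> 'a \<Rightarrow> ennreal" where
  "fibre_length \<theta> E x = emeasure lborel {t::real. x + t *\<^sub>R \<theta> \<in> E}"

lemma fibre_sets [measurable]:
  fixes E :: "'a::euclidean_space set"
  assumes [measurable]: "E \<in> sets borel"
  shows "{t::real. x + t *\<^sub>R \<theta> \<in> E} \<in> sets borel"
proof -
  have "{t \<in> space borel. x + t *\<^sub>R \<theta> \<in> E} \<in> sets borel" by measurable
  then show ?thesis by simp
qed

lemma fibre_length_measurable [measurable]:
  assumes [measurable]: "E \<in> sets borel"
  shows "fibre_length \<theta> E \<in> borel_measurable borel"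
proof -
  have "{p \<in> space (borel \<Otimes>\<^sub>M lborel). fst p + snd p *\<^sub>R \<theta> \<in> E} \<in> sets (borel \<Otimes>\<^sub>M (lborel :: real measure))" by measurable
  from lborel.measurable_emeasure_Pair[OF this] show ?thesis
    by (simp add: vimage_def space_pair_measure fibre_length_def[abs_def])
qed

lemma fibre_length_shift:
  assumes "E \<in> sets borel"
  shows "fibre_length \<theta> E (x + s *\<^sub>R \<theta>) = fibre_length \<theta> E x"
proof -
  have "emeasure lborel {t. x + t *\<^sub>R \<theta> \<in> E} = emeasure (distr lborel borel ((+) s)) {t. x + t *\<^sub>R \<theta> \<in> E}"
    by (simp add: lborel_distr_plus)
  also have "\<dots> = emeasure lborel {t. x + s *\<^sub>R \<theta> + t *\<^sub>R \<theta> \<in> E}"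
    using assms by (subst emeasure_distr) (auto simp: vimage_def algebra_simps)
  finally show ?thesis by (simp add: fibre_length_def)
qed

lemma fibre_length_shift':
  assumes "E \<in> sets borel"
  shows "fibre_length \<theta> E (x - s *\<^sub>R \<theta>) = fibre_length \<theta> E x"
  using fibre_length_shift[OF assms, of \<theta> x "- s"] by simp

lemma emeasure_eq_fibre_length:
  assumes "norm \<theta> = 1" and [measurable]: "E \<in> sets borel"
  shows "emeasure lborel E = (\<integral>\<^sup>+x. indicator {0..<1} (x \<bullet> \<theta>) * fibre_length \<theta> E x \<partial>lborel)"
proof -
  have "emeasure lborel E = (\<integral>\<^sup>+x. indicator E x \<partial>lborel)" by simp
  also have "\<dots> = (\<integral>\<^sup>+x. indicator {0..<1} (x \<bullet> \<theta>) * (\<integral>\<^sup>+t. indicator E (x - (x \<bullet> \<theta>) *\<^sub>R \<theta> + t *\<^sub>R \<theta>) \<partial>lborel) \<partial>lborel)"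
    by (rule nn_integral_along_direction[OF assms(1)]) simp
  also have "\<dots> = (\<integral>\<^sup>+x. indicator {0..<1} (x \<bullet> \<theta>) * fibre_length \<theta> E x \<partial>lborel)"
  proof (intro nn_integral_cong arg_cong2[where f="(*)"] refl)
    fix x
    have "(\<integral>\<^sup>+t. indicator E (x - (x \<bullet> \<theta>) *\<^sub>R \<theta> + t *\<^sub>R \<theta>) \<partial>lborel) = (\<integral>\<^sup>+t. indicator {t. x - (x \<bullet> \<theta>) *\<^sub>R \<theta> + t *\<^sub>R \<theta> \<in> E} t \<partial>lborel)"
      by (intro nn_integral_cong) (auto simp: indicator_def)
    also have "\<dots> = fibre_length \<theta> E (x - (x \<bullet> \<theta>) *\<^sub>R \<theta>)" unfolding fibre_length_def by (intro nn_integral_indicator) simp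
    finally show "(\<integral>\<^sup>+t. indicator E (x - (x \<bullet> \<theta>) *\<^sub>R \<theta> + t *\<^sub>R \<theta>) \<partial>lborel) = fibre_length \<theta> E x"
      by (simp add: fibre_length_shift')
  qed
  finally show ?thesis .
qed

lemma emeasure_symmetric_interval: "emeasure lborel {t::real. ennreal (2 * \<bar>t\<bar>) < L} = L"
proof (cases L)
  case (real l)
  then have "{t::real. ennreal (2 * \<bar>t\<bar>) < L} = {- l/2<..<l/2}"
    by (auto simp: ennreal_less_iff abs_less_iff)
  then show ?thesis using real by simp
next
  case top
  then have "{t::real. ennreal (2 * \<bar>t\<bar>) < L} = UNIV" by auto
  then show ?thesis using top by simp
qed

text \<open>The strict inequality makes every fibre an open centred interval, in agreement with
  \<open>open_box\<close> and with the open balls that are approached.\<close>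

definition steiner :: "'a::euclidean_space \<Rightarrow> 'a set \<Rightarrow> 'a set" where
  "steiner \<theta> E = {x. ennreal (2 * \<bar>x \<bullet> \<theta>\<bar>) < fibre_length \<theta> E x}"

lemma steiner_sets [measurable]:
  assumes [measurable]: "E \<in> sets borel"
  shows "steiner \<theta> E \<in> sets borel"
proof -
  have "{x \<in> space borel. ennreal (2 * \<bar>x \<bullet> \<theta>\<bar>) < fibre_length \<theta> E x} \<in> sets borel" by measurable
  then show ?thesis by (simp add: steiner_def)
qed

lemma orthogonal_part:
  assumes "norm \<theta> = 1"
  shows "(x - (x \<bullet> \<theta>) *\<^sub>R \<theta>) \<bullet> \<theta> = 0" "(x - (x \<bullet> \<theta>) *\<^sub>R \<theta> + t *\<^sub>R \<theta>) \<bullet> \<theta> = t"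
  using assms by (auto simp: inner_diff_left inner_add_left norm_eq_1)

lemma mem_steiner:
  assumes "norm \<theta> = 1" "E \<in> sets borel"
  shows "x - (x \<bullet> \<theta>) *\<^sub>R \<theta> + t *\<^sub>R \<theta> \<in> steiner \<theta> E \<longleftrightarrow> ennreal (2 * \<bar>t\<bar>) < fibre_length \<theta> E x"
  unfolding steiner_def mem_Collect_eq orthogonal_part[OF assms(1)] fibre_length_shift[OF assms(2)] fibre_length_shift'[OF assms(2)] ..

lemma fibre_length_eq_orthogonal:
  assumes "E \<in> sets borel"
  shows "fibre_length \<theta> E x = emeasure lborel {t. x - (x \<bullet> \<theta>) *\<^sub>R \<theta> + t *\<^sub>R \<theta> \<in> E}"
  using fibre_length_shift'[OF assms, of \<theta> x "x \<bullet> \<theta>"] by (simp add: fibre_length_def)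

lemma fibre_length_steiner:
  assumes "norm \<theta> = 1" "E \<in> sets borel"
  shows "fibre_length \<theta> (steiner \<theta> E) x = fibre_length \<theta> E x"
  using assms by (subst fibre_length_eq_orthogonal) (auto simp: mem_steiner emeasure_symmetric_interval)

lemma emeasure_steiner:
  assumes "norm \<theta> = 1" "E \<in> sets borel"
  shows "emeasure lborel (steiner \<theta> E) = emeasure lborel E"
  using assms by (simp add: emeasure_eq_fibre_length[OF assms(1)] fibre_length_steiner)

lemma norm_orthogonal_part:
  assumes "norm \<theta> = 1"
  shows "norm (x - (x \<bullet> \<theta>) *\<^sub>R \<theta> + t *\<^sub>R \<theta>) ^ 2 = norm (x - (x \<bullet> \<theta>) *\<^sub>R \<theta>) ^ 2 + t ^ 2"
proof -
  have "(x - (x \<bullet> \<theta>) *\<^sub>R \<theta>) \<bullet> (t *\<^sub>R \<theta>) = 0" using orthogonal_part(1)[OF assms, of x] by simp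
  then show ?thesis using assms norm_add_Pythagorean[of "x - (x \<bullet> \<theta>) *\<^sub>R \<theta>" "t *\<^sub>R \<theta>"]
    by (simp add: orthogonal_def)
qed

lemma fibre_ball:
  assumes "norm \<theta> = 1" "R \<ge> 0"
  shows "x - (x \<bullet> \<theta>) *\<^sub>R \<theta> + t *\<^sub>R \<theta> \<in> ball 0 R \<longleftrightarrow> t^2 < R^2 - norm (x - (x \<bullet> \<theta>) *\<^sub>R \<theta>) ^ 2"
proof -
  have "norm v < R \<longleftrightarrow> norm v ^ 2 < R ^ 2" for v :: 'a
    using assms(2) power_strict_mono[of "norm v" R 2] power2_less_imp_less[of "norm v" R] by auto
  then show ?thesis unfolding mem_ball_0 by (simp only: norm_orthogonal_part[OF assms(1)]) auto
qed

lemma fibre_ball_sqrt: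
  assumes "norm \<theta> = 1" "R \<ge> 0"
  defines "\<rho> \<equiv> \<lambda>x. sqrt (max 0 (R^2 - norm (x - (x \<bullet> \<theta>) *\<^sub>R \<theta>) ^ 2))"
  shows "x - (x \<bullet> \<theta>) *\<^sub>R \<theta> + t *\<^sub>R \<theta> \<in> ball 0 R \<longleftrightarrow> \<bar>t\<bar> < \<rho> x"
    "fibre_length \<theta> (ball 0 R) x = ennreal (2 * \<rho> x)"
proof -
  have *: "t^2 < a \<longleftrightarrow> \<bar>t\<bar> < sqrt (max 0 a)" for a t :: real
  proof -
    have "t^2 < a \<longleftrightarrow> t^2 < max 0 a" using zero_le_power2[of t] by linarith
    then show ?thesis using real_sqrt_less_iff[of "t^2" "max 0 a"] by simp
  qed
  show mem: "x - (x \<bullet> \<theta>) *\<^sub>R \<theta> + t *\<^sub>R \<theta> \<in> ball 0 R \<longleftrightarrow> \<bar>t\<bar> < \<rho> x" for t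
    unfolding fibre_ball[OF assms(1,2)] \<rho>_def by (rule *)
  have "{t. \<bar>t\<bar> < \<rho> x} = {- \<rho> x<..<\<rho> x}" by auto
  moreover have "\<rho> x \<ge> 0" by (simp add: \<rho>_def)
  ultimately show "fibre_length \<theta> (ball 0 R) x = ennreal (2 * \<rho> x)"
    unfolding fibre_length_eq_orthogonal[OF borel_open[OF open_ball]] mem by simp
qed

lemma fibre_length_mono:
  assumes "E \<subseteq> F" "F \<in> sets borel"
  shows "fibre_length \<theta> E x \<le> fibre_length \<theta> F x"
  unfolding fibre_length_def using assms by (intro emeasure_mono) auto

lemma steiner_subset_ball:
  assumes "norm \<theta> = 1" "R \<ge> 0" "E \<in> sets borel" "E \<subseteq> ball 0 R"
  shows "steiner \<theta> E \<subseteq> ball 0 R"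
proof
  fix x assume "x \<in> steiner \<theta> E"
  then have "ennreal (2 * \<bar>x \<bullet> \<theta>\<bar>) < fibre_length \<theta> E x" by (simp add: steiner_def)
  also have "\<dots> \<le> fibre_length \<theta> (ball 0 R) x" using assms by (intro fibre_length_mono) auto
  finally have "\<bar>x \<bullet> \<theta>\<bar> < sqrt (max 0 (R^2 - norm (x - (x \<bullet> \<theta>) *\<^sub>R \<theta>) ^ 2))"
    unfolding fibre_ball_sqrt(2)[OF assms(1,2)] by (simp add: ennreal_less_iff)
  then have "x - (x \<bullet> \<theta>) *\<^sub>R \<theta> + (x \<bullet> \<theta>) *\<^sub>R \<theta> \<in> ball 0 R"
    unfolding fibre_ball_sqrt(1)[OF assms(1,2)] .
  then show "x \<in> ball 0 R" by simp
qed

text \<open>On every line parallel to \<open>\<theta>\<close> the symmetral and the ball are both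
  centred intervals, so they intersect in the shorter one. The part inside the ball together with
  the part that can be shifted into the gap is bounded by both lengths: it is contained in the fibre
  of \<open>E\<close>, and after the shift it fits into the fibre of the ball.\<close>

lemma steiner_gain:
  fixes E :: "'a::euclidean_space set"
  assumes \<theta>: "norm \<theta> = 1" and [measurable]: "E \<in> sets borel" and r: "r \<ge> 0"
  shows "emeasure lborel (E \<inter> ball 0 r) + emeasure lborel {x \<in> E - ball 0 r. x + c *\<^sub>R \<theta> \<in> ball 0 r - E}
    \<le> emeasure lborel (steiner \<theta> E \<inter> ball 0 r)"
proof -
  let ?B = "ball 0 r :: 'a set" 
  define N where "N = {x \<in> E - ?B. x + c *\<^sub>R \<theta> \<in> ?B - E}"
  have [measurable]: "?B \<in> sets borel" "E - ?B \<in> sets borel" "?B - E \<in> sets borel" by simp_all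
  have "{x \<in> space borel. x \<in> E - ?B \<and> x + c *\<^sub>R \<theta> \<in> ?B - E} \<in> sets borel" by measurable
  then have [measurable]: "N \<in> sets borel" by (simp add: N_def)
  have le: "fibre_length \<theta> (E \<inter> ?B) x + fibre_length \<theta> N x \<le> fibre_length \<theta> (steiner \<theta> E \<inter> ?B) x" for x
  proof -
    have split: "fibre_length \<theta> F x + fibre_length \<theta> G x = fibre_length \<theta> (F \<union> G) x"
      if [measurable]: "F \<in> sets borel" "G \<in> sets borel" and "F \<inter> G = {}" for F G
    proof -
      have "{t. x + t *\<^sub>R \<theta> \<in> F} \<inter> {t. x + t *\<^sub>R \<theta> \<in> G} = {}" using that(3) by auto
      moreover have "{t. x + t *\<^sub>R \<theta> \<in> F \<union> G} = {t. x + t *\<^sub>R \<theta> \<in> F} \<union> {t. x + t *\<^sub>R \<theta> \<in> G}" by auto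
      ultimately show ?thesis unfolding fibre_length_def by (simp add: plus_emeasure)
    qed
    have "fibre_length \<theta> (E \<inter> ?B) x + fibre_length \<theta> N x = fibre_length \<theta> (E \<inter> ?B \<union> N) x"
      by (rule split) (auto simp: N_def)
    also have "\<dots> \<le> fibre_length \<theta> E x" by (rule fibre_length_mono) (auto simp: N_def)
    finally have 1: "fibre_length \<theta> (E \<inter> ?B) x + fibre_length \<theta> N x \<le> fibre_length \<theta> E x" .
    have "fibre_length \<theta> N x \<le> fibre_length \<theta> (?B - E) (x + c *\<^sub>R \<theta>)"
      unfolding fibre_length_def by (intro emeasure_mono) (auto simp: N_def algebra_simps)
    also have "\<dots> = fibre_length \<theta> (?B - E) x" by (rule fibre_length_shift) simp
    finally have "fibre_length \<theta> (E \<inter> ?B) x + fibre_length \<theta> N x \<le> fibre_length \<theta> (E \<inter> ?B) x + fibre_length \<theta> (?B - E) x"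
      by (rule add_left_mono)
    also have "\<dots> = fibre_length \<theta> (E \<inter> ?B \<union> (?B - E)) x" by (rule split) auto
    also have "E \<inter> ?B \<union> (?B - E) = ?B" by auto
    finally have 2: "fibre_length \<theta> (E \<inter> ?B) x + fibre_length \<theta> N x \<le> fibre_length \<theta> ?B x" .
    define \<rho> where "\<rho> = sqrt (max 0 (r^2 - norm (x - (x \<bullet> \<theta>) *\<^sub>R \<theta>) ^ 2))"
    have "fibre_length \<theta> (steiner \<theta> E \<inter> ?B) x = emeasure lborel {t. ennreal (2 * \<bar>t\<bar>) < fibre_length \<theta> E x \<and> \<bar>t\<bar> < \<rho>}"
    proof -
      have m: "steiner \<theta> E \<inter> ?B \<in> sets borel" by simp
      show ?thesis
        unfolding fibre_length_eq_orthogonal[OF m] Int_iff mem_steiner[OF \<theta> \<open>E \<in> sets borel\<close>] fibre_ball_sqrt(1)[OF \<theta> r] \<rho>_def by simp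
    qed
    also have "{t. ennreal (2 * \<bar>t\<bar>) < fibre_length \<theta> E x \<and> \<bar>t\<bar> < \<rho>} = {t. ennreal (2 * \<bar>t\<bar>) < min (fibre_length \<theta> E x) (fibre_length \<theta> ?B x)}"
      unfolding fibre_ball_sqrt(2)[OF \<theta> r] \<rho>_def[symmetric] by (auto simp: ennreal_less_iff)
    finally have "fibre_length \<theta> (steiner \<theta> E \<inter> ?B) x = min (fibre_length \<theta> E x) (fibre_length \<theta> ?B x)"
      by (simp only: emeasure_symmetric_interval)
    then show ?thesis using 1 2 by simp
  qed
  have "emeasure lborel (E \<inter> ?B) + emeasure lborel N
    = (\<integral>\<^sup>+x. indicator {0..<1} (x \<bullet> \<theta>) * fibre_length \<theta> (E \<inter> ?B) x + indicator {0..<1} (x \<bullet> \<theta>) * fibre_length \<theta> N x \<partial>lborel)"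
    by (simp add: emeasure_eq_fibre_length[OF \<theta>] nn_integral_add)
  also have "\<dots> \<le> (\<integral>\<^sup>+x. indicator {0..<1} (x \<bullet> \<theta>) * fibre_length \<theta> (steiner \<theta> E \<inter> ?B) x \<partial>lborel)"
    unfolding distrib_left[symmetric] by (intro nn_integral_mono mult_left_mono le) auto
  also have "\<dots> = emeasure lborel (steiner \<theta> E \<inter> ?B)" by (simp add: emeasure_eq_fibre_length[OF \<theta>])
  finally show ?thesis unfolding N_def .
qed


text \<open>With \<open>y i\<close> orthogonal to \<open>\<theta>\<close>, replacing
  \<open>t\<close> by \<open>- t\<close> is the reflection in the hyperplane orthogonal to
  \<open>\<theta>\<close>, under which intrinsic volumes are invariant.\<close>

definition midconvex_symmetric_along_lines :: "('m \<Rightarrow> 'a::euclidean_space) set \<Rightarrow> bool" where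
  "midconvex_symmetric_along_lines A \<longleftrightarrow> (\<forall>\<theta> y. norm \<theta> = 1 \<longrightarrow> (\<forall>i. y i \<bullet> \<theta> = 0) \<longrightarrow>
     midconvex_symmetric {t. (\<lambda>i. y i + t i *\<^sub>R \<theta>) \<in> A})"

lemma emeasure_steiner_mono:
  fixes A :: "('m::finite \<Rightarrow> 'a::euclidean_space) set"
  assumes A [measurable]: "A \<in> sets lborel_pow" and msA: "midconvex_symmetric_along_lines A"
    and \<theta>: "norm \<theta> = 1" and R: "R \<ge> 0" and E: "\<And>i. E i \<in> sets borel" "\<And>i. E i \<subseteq> ball 0 R"
  shows "emeasure lborel_pow (A \<inter> {x. \<forall>i. x i \<in> E i}) \<le> emeasure lborel_pow (A \<inter> {x. \<forall>i. x i \<in> steiner \<theta> (E i)})"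
proof -
  let ?\<phi> = "\<lambda>x :: 'm \<Rightarrow> 'a. (\<Prod>i\<in>UNIV. indicator {0..<1} (x i \<bullet> \<theta>)) :: ennreal"
  let ?p = "\<lambda>x (t :: 'm \<Rightarrow> real) i. x i - (x i \<bullet> \<theta>) *\<^sub>R \<theta> + t i *\<^sub>R \<theta>"
  have eq: "emeasure lborel_pow (A \<inter> {x. \<forall>i. x i \<in> F i}) =
    (\<integral>\<^sup>+x. ?\<phi> x * emeasure lborel_pow ({t. ?p x t \<in> A} \<inter> {t. \<forall>i. x i - (x i \<bullet> \<theta>) *\<^sub>R \<theta> + t i *\<^sub>R \<theta> \<in> F i}) \<partial>lborel_pow)"
    if F: "\<And>i. F i \<in> sets borel" for F :: "'m \<Rightarrow> 'a set"
  proof -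
    have [measurable]: "A \<inter> {x. \<forall>i. x i \<in> F i} \<in> sets lborel_pow" using F by (intro sets.Int sets_lborel_pow_Pi A)
    have "emeasure lborel_pow (A \<inter> {x. \<forall>i. x i \<in> F i}) = (\<integral>\<^sup>+x. indicator (A \<inter> {x. \<forall>i. x i \<in> F i}) x \<partial>lborel_pow)" by simp
    also have "\<dots> = (\<integral>\<^sup>+x. ?\<phi> x * (\<integral>\<^sup>+t. indicator (A \<inter> {x. \<forall>i. x i \<in> F i}) (?p x t) \<partial>lborel_pow) \<partial>lborel_pow)"
      by (rule nn_integral_lborel_pow_along_direction[OF \<theta>]) simp
    also have "\<dots> = (\<integral>\<^sup>+x. ?\<phi> x * emeasure lborel_pow ({t. ?p x t \<in> A} \<inter> {t. \<forall>i. x i - (x i \<bullet> \<theta>) *\<^sub>R \<theta> + t i *\<^sub>R \<theta> \<in> F i}) \<partial>lborel_pow)"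
    proof (intro nn_integral_cong arg_cong2[where f="(*)"] refl)
      fix x :: "'m \<Rightarrow> 'a"
      have "?p x \<in> lborel_pow \<rightarrow>\<^sub>M lborel_pow" by (rule measurable_PiM_single') (auto simp: space_PiM)
      then have "?p x -` (A \<inter> {x. \<forall>i. x i \<in> F i}) \<inter> space lborel_pow \<in> sets lborel_pow" by (rule measurable_sets) simp
      then have m: "{t. ?p x t \<in> A} \<inter> {t. \<forall>i. x i - (x i \<bullet> \<theta>) *\<^sub>R \<theta> + t i *\<^sub>R \<theta> \<in> F i} \<in> sets lborel_pow"
        by (simp add: vimage_def Collect_conj_eq)
      have "(\<integral>\<^sup>+t. indicator (A \<inter> {x. \<forall>i. x i \<in> F i}) (?p x t) \<partial>lborel_pow)
        = (\<integral>\<^sup>+t. indicator ({t. ?p x t \<in> A} \<inter> {t. \<forall>i. x i - (x i \<bullet> \<theta>) *\<^sub>R \<theta> + t i *\<^sub>R \<theta> \<in> F i}) t \<partial>lborel_pow)"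
        by (intro nn_integral_cong) (simp add: indicator_def)
      then show "(\<integral>\<^sup>+t. indicator (A \<inter> {x. \<forall>i. x i \<in> F i}) (?p x t) \<partial>lborel_pow)
        = emeasure lborel_pow ({t. ?p x t \<in> A} \<inter> {t. \<forall>i. x i - (x i \<bullet> \<theta>) *\<^sub>R \<theta> + t i *\<^sub>R \<theta> \<in> F i})"
        using m by simp
    qed
    finally show ?thesis .
  qed
  have le: "emeasure lborel_pow ({t. ?p x t \<in> A} \<inter> {t. \<forall>i. x i - (x i \<bullet> \<theta>) *\<^sub>R \<theta> + t i *\<^sub>R \<theta> \<in> E i})
    \<le> emeasure lborel_pow ({t. ?p x t \<in> A} \<inter> {t. \<forall>i. x i - (x i \<bullet> \<theta>) *\<^sub>R \<theta> + t i *\<^sub>R \<theta> \<in> steiner \<theta> (E i)})" for x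
  proof -
    have "?p x \<in> lborel_pow \<rightarrow>\<^sub>M lborel_pow" by (rule measurable_PiM_single') (auto simp: space_PiM)
    then have "?p x -` A \<inter> space lborel_pow \<in> sets lborel_pow" by (rule measurable_sets) simp
    then have K: "{t. ?p x t \<in> A} \<in> sets lborel_pow" by (simp add: vimage_def)
    have msK: "midconvex_symmetric {t. ?p x t \<in> A}"
      using msA[unfolded midconvex_symmetric_along_lines_def, rule_format, OF \<theta>, of "\<lambda>i. x i - (x i \<bullet> \<theta>) *\<^sub>R \<theta>"]
        orthogonal_part(1)[OF \<theta>] by blast
    \<comment> \<open>Half the fibre length as a real number; boundedness of \<open>E i\<close>
      makes the length finite, so nothing is lost in the conversion.\<close>
    define r where "r i = enn2real (fibre_length \<theta> (E i) (x i)) / 2" for i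
    have fl: "fibre_length \<theta> (E i) (x i) = ennreal (2 * r i)" for i
    proof -
      have "fibre_length \<theta> (E i) (x i) \<le> fibre_length \<theta> (ball 0 R) (x i)" using E(2) by (intro fibre_length_mono) auto
      also have "\<dots> < top" unfolding fibre_ball_sqrt(2)[OF \<theta> R] by simp
      finally show ?thesis by (simp add: r_def)
    qed
    have "emeasure lborel_pow ({t. ?p x t \<in> A} \<inter> {t. \<forall>i. t i \<in> {s. x i - (x i \<bullet> \<theta>) *\<^sub>R \<theta> + s *\<^sub>R \<theta> \<in> E i}})
      \<le> emeasure lborel_pow ({t. ?p x t \<in> A} \<inter> open_box (\<lambda>_. 0) r)"
    proof (rule rearrangement_line[OF K msK])
      show "{s. x i - (x i \<bullet> \<theta>) *\<^sub>R \<theta> + s *\<^sub>R \<theta> \<in> E i} \<in> sets borel" for i by (rule fibre_sets) (rule E)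
      show "emeasure lborel {s. x i - (x i \<bullet> \<theta>) *\<^sub>R \<theta> + s *\<^sub>R \<theta> \<in> E i} = ennreal (2 * r i)" for i
        using fl[of i] unfolding fibre_length_eq_orthogonal[OF E(1)] .
      show "r i \<ge> 0" for i by (simp add: r_def)
    qed
    also have "open_box (\<lambda>_. 0) r = {t. \<forall>i. x i - (x i \<bullet> \<theta>) *\<^sub>R \<theta> + t i *\<^sub>R \<theta> \<in> steiner \<theta> (E i)}"
      unfolding mem_steiner[OF \<theta> E(1)] fl by (auto simp: open_box_def ennreal_less_iff)
    finally show ?thesis by simp
  qed
  show ?thesis
    unfolding eq[of E, OF E(1)] eq[of "\<lambda>i. steiner \<theta> (E i)", OF steiner_sets, OF E(1)]
    by (intro nn_integral_mono mult_left_mono le) auto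
qed

section \<open>The rearrangement inequality for sets\<close>

text \<open>Averaging over translations: the overlap of \<open>D\<close> with \<open>E\<close>
  shifted by \<open>- z\<close> integrates over \<open>z\<close> to the product \<open>d^2\<close>
  of the measures, and it vanishes outside the ball of radius \<open>2 R\<close>. The factor 2 in
  the denominator turns failure everywhere into the contradiction \<open>d^2 \<le> d^2 / 2\<close>,
  even with \<open>z = 0\<close> excluded as a null set, so that \<open>z\<close> has a
  direction.\<close>

lemma exists_overlapping_shift:
  fixes D E :: "'a::euclidean_space set"
  assumes [measurable]: "D \<in> sets borel" "E \<in> sets borel" and R: "R > 0" "D \<subseteq> ball 0 R" "E \<subseteq> ball 0 R"
    and d: "d > 0" "emeasure lborel D = ennreal d" "emeasure lborel E = ennreal d"
  shows "\<exists>\<theta> c. norm \<theta> = 1 \<and> d^2 / (2 * measure lborel (ball (0::'a) (2*R))) \<le> measure lborel {x \<in> D. x + c *\<^sub>R \<theta> \<in> E}"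
proof -
  define V where "V = measure lborel (ball (0::'a) (2*R))"
  have V: "V > 0" using R by (simp add: V_def content_ball_pos)
  have emV: "emeasure lborel (ball (0::'a) (2*R)) = ennreal V"
    unfolding V_def by (rule emeasure_eq_ennreal_measure) (use emeasure_lborel_ball_finite[of "0::'a" "2*R"] in auto)
  have [measurable]: "{x \<in> D. x + z \<in> E} \<in> sets borel" for z
  proof -
    have "{x \<in> space borel. x \<in> D \<and> x + z \<in> E} \<in> sets borel" by measurable
    then show ?thesis by simp
  qed
  define g where "g z = emeasure lborel {x \<in> D. x + z \<in> E}" for z
  have tr: "(\<integral>\<^sup>+z. indicator E (x + z) \<partial>lborel) = ennreal d" for x
  proof -
    have "ennreal d = (\<integral>\<^sup>+z. indicator E z \<partial>distr lborel borel ((+) x))" by (simp add: lborel_distr_plus d)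
    also have "\<dots> = (\<integral>\<^sup>+z. indicator E (x + z) \<partial>lborel)" by (subst nn_integral_distr) auto
    finally show ?thesis by simp
  qed
  have "(\<integral>\<^sup>+z. g z \<partial>lborel) = (\<integral>\<^sup>+z. \<integral>\<^sup>+x. indicator D x * indicator E (x + z) \<partial>lborel \<partial>lborel)"
  proof (rule nn_integral_cong)
    fix z
    have "g z = (\<integral>\<^sup>+x. indicator {x \<in> D. x + z \<in> E} x \<partial>lborel)" by (simp add: g_def)
    also have "\<dots> = (\<integral>\<^sup>+x. indicator D x * indicator E (x + z) \<partial>lborel)"
      by (intro nn_integral_cong) (auto simp: indicator_def)
    finally show "g z = (\<integral>\<^sup>+x. indicator D x * indicator E (x + z) \<partial>lborel)" .
  qed
  also have "\<dots> = (\<integral>\<^sup>+x. \<integral>\<^sup>+z. indicator D x * indicator E (x + z) \<partial>lborel \<partial>lborel)"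
    by (rule lborel_pair.Fubini') (unfold case_prod_beta, measurable)
  also have "\<dots> = (\<integral>\<^sup>+x. indicator D x * ennreal d \<partial>lborel)" by (simp add: nn_integral_cmult tr)
  also have "\<dots> = ennreal (d^2)" using d by (simp add: nn_integral_multc ennreal_mult[symmetric] power2_eq_square)
  finally have int: "(\<integral>\<^sup>+z. g z \<partial>lborel) = ennreal (d^2)" .
  have "\<exists>z. z \<noteq> 0 \<and> ennreal (d^2 / (2 * V)) \<le> g z"
  proof (rule ccontr)
    assume "\<not> ?thesis"
    then have lt: "g z \<le> ennreal (d^2 / (2*V))" if "z \<noteq> 0" for z using that by (auto simp: not_le intro: less_imp_le)
    have out: "g z = 0" if "z \<notin> ball 0 (2*R)" for z
    proof -
      have "{x \<in> D. x + z \<in> E} = {}"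
      proof (rule ccontr)
        assume "{x \<in> D. x + z \<in> E} \<noteq> {}"
        then obtain x where "norm x < R" "norm (x + z) < R" using R by fastforce
        then have "norm z < 2 * R" using norm_triangle_ineq4[of "x + z" x] by simp
        then show False using that by simp
      qed
      then show ?thesis unfolding g_def by (simp only: emeasure_empty)
    qed
    have "(\<integral>\<^sup>+z. g z \<partial>lborel) \<le> (\<integral>\<^sup>+z. ennreal (d^2 / (2*V)) * indicator (ball (0::'a) (2*R)) z \<partial>lborel)"
    proof (rule nn_integral_mono_AE)
      show "AE z in lborel. g z \<le> ennreal (d^2 / (2*V)) * indicator (ball 0 (2*R)) z"
        using AE_lborel_singleton[of 0]
      proof eventually_elim
        fix z :: 'a assume "z \<noteq> 0"
        then show "g z \<le> ennreal (d^2 / (2*V)) * indicator (ball 0 (2*R)) z"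
          using lt[of z] out[of z] by (cases "z \<in> ball 0 (2*R)") auto
      qed
    qed
    also have "\<dots> = ennreal (d^2 / (2*V)) * ennreal V" by (simp add: nn_integral_cmult_indicator emV)
    also have "\<dots> = ennreal (d^2 / 2)" using V by (simp add: ennreal_mult[symmetric])
    finally have "d^2 \<le> d^2/2" unfolding int by (simp add: ennreal_le_iff)
    then show False using d by simp
  qed
  then obtain z where z: "z \<noteq> 0" "ennreal (d^2 / (2 * V)) \<le> g z" by blast
  have "g z \<le> emeasure lborel D" unfolding g_def by (intro emeasure_mono) auto
  then have "g z = ennreal (measure lborel {x \<in> D. x + z \<in> E})"
    unfolding g_def using d by (intro emeasure_eq_ennreal_measure) (auto simp: top_unique)
  then have "d^2 / (2*V) \<le> measure lborel {x \<in> D. x + z \<in> E}" using z(2) by (simp add: ennreal_le_iff)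
  then show ?thesis using z(1) unfolding V_def
    by (intro exI[of _ "z /\<^sub>R norm z"] exI[of _ "norm z"]) simp
qed

lemma finite_measure_subset_ball:
  fixes E :: "'a::euclidean_space set"
  assumes "E \<subseteq> ball 0 R"
  shows "emeasure lborel E = ennreal (measure lborel E)"
proof (rule emeasure_eq_ennreal_measure)
  have "emeasure lborel E \<le> emeasure lborel (ball (0::'a) R)" by (rule emeasure_mono[OF assms]) simp
  also have "\<dots> < \<infinity>" by (rule emeasure_lborel_ball_finite)
  finally show "emeasure lborel E \<noteq> top" by simp
qed

text \<open>Symmetrization preserves measure, so the overlap gained with the ball is mass lost
  outside it.\<close>

lemma measure_steiner_deficit:
  fixes E :: "'a::euclidean_space set"
  assumes \<theta>: "norm \<theta> = 1" and E [measurable]: "E \<in> sets borel" and R: "R \<ge> 0" "E \<subseteq> ball 0 R" and r: "r \<ge> 0"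
  shows "measure lborel (steiner \<theta> E - ball 0 r) + measure lborel {x \<in> E - ball 0 r. x + c *\<^sub>R \<theta> \<in> ball 0 r - E}
    \<le> measure lborel (E - ball 0 r)"
proof -
  let ?B = "ball 0 r :: 'a set" and ?N = "{x \<in> E - ball 0 r. x + c *\<^sub>R \<theta> \<in> ball 0 r - E}"
  have S: "steiner \<theta> E \<subseteq> ball 0 R" by (rule steiner_subset_ball[OF \<theta> R(1) E R(2)])
  have fin: "emeasure lborel F = ennreal (measure lborel F)" if "F \<subseteq> E \<or> F \<subseteq> steiner \<theta> E" for F
    using that R S by (intro finite_measure_subset_ball[of _ R]) auto
  have "measure lborel (E \<inter> ?B) + measure lborel ?N \<le> measure lborel (steiner \<theta> E \<inter> ?B)"
    using steiner_gain[OF \<theta> E r, of c] fin[of "E \<inter> ?B"] fin[of ?N] fin[of "steiner \<theta> E \<inter> ?B"]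
    by (simp add: ennreal_plus[symmetric] ennreal_le_iff Collect_conv_if del: ennreal_plus)
  moreover have "measure lborel E = measure lborel (E \<inter> ?B) + measure lborel (E - ?B)"
    using measure_Union[of lborel "E \<inter> ?B" "E - ?B"] fin[of "E \<inter> ?B"] fin[of "E - ?B"] by (simp add: Int_Diff_Un Int_Diff_disjoint)
  moreover have "measure lborel (steiner \<theta> E) = measure lborel (steiner \<theta> E \<inter> ?B) + measure lborel (steiner \<theta> E - ?B)"
    using measure_Union[of lborel "steiner \<theta> E \<inter> ?B" "steiner \<theta> E - ?B"] fin[of "steiner \<theta> E \<inter> ?B"] fin[of "steiner \<theta> E - ?B"]
    by (simp add: Int_Diff_Un Int_Diff_disjoint)
  moreover have "measure lborel (steiner \<theta> E) = measure lborel E" by (simp add: measure_def emeasure_steiner[OF \<theta> E])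
  ultimately show ?thesis by linarith
qed

lemma ball_of_measure:
  fixes v :: real
  assumes "v \<ge> 0"
  shows "\<exists>s\<ge>0. emeasure lborel (ball (0::'a::euclidean_space) s) = ennreal v"
proof -
  define \<omega> where "\<omega> = unit_ball_vol (real DIM('a))"
  have \<omega>: "\<omega> > 0" by (simp add: \<omega>_def)
  define s where "s = root DIM('a) (v / \<omega>)"
  have "s \<ge> 0" "s ^ DIM('a) = v / \<omega>" using assms \<omega> by (simp_all add: s_def)
  then show ?thesis using \<omega> by (intro exI[of _ s]) (simp add: emeasure_ball \<omega>_def[symmetric])
qed

lemma ball_radius_mono:
  assumes "0 \<le> s" "0 \<le> r" "emeasure lborel (ball (0::'a::euclidean_space) s) \<le> emeasure lborel (ball (0::'a) r)"
  shows "s \<le> r"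
proof -
  have "s ^ DIM('a) \<le> r ^ DIM('a)" using assms by (simp add: emeasure_ball ennreal_le_iff)
  then show ?thesis using assms by (simp add: power_mono_iff)
qed

context
  fixes A :: "('m::finite \<Rightarrow> 'a::euclidean_space) set"
  assumes A [measurable]: "A \<in> sets lborel_pow" and msA: "midconvex_symmetric_along_lines A"
begin

text \<open>The total deficit \<open>D F\<close>, the volume of the \<open>F i\<close> outside their
  target balls, controls how far the integral for \<open>F\<close> can exceed the one for the balls.
  It can be made arbitrarily small among families that are at least as good as \<open>E\<close>, so
  the integral for \<open>E\<close> is bounded by the one for the balls up to any error.\<close>

lemma rearrangement_bounded:
  assumes E: "\<And>i. E i \<in> sets borel" "\<And>i. E i \<subseteq> ball 0 R"
    and r: "\<And>i. 0 \<le> r i" "\<And>i. r i \<le> R" "\<And>i. emeasure lborel (ball (0::'a) (r i)) = emeasure lborel (E i)" and R: "R > 0"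
  shows "emeasure lborel_pow (A \<inter> {x. \<forall>i. x i \<in> E i}) \<le> emeasure lborel_pow (A \<inter> {x. \<forall>i. x i \<in> ball 0 (r i)})"
proof -
  let ?\<Phi> = "\<lambda>F. emeasure lborel_pow (A \<inter> {x. \<forall>i. x i \<in> F i})"
  define B where "B i = ball (0::'a) (r i)" for i
  define V where "V = measure lborel (ball (0::'a) (2*R))"
  have V: "V > 0" using R by (simp add: V_def content_ball_pos)
  define d where "d F i = measure lborel (F i - B i)" for F i
  \<comment> \<open>All competitors with the right measures and an integral at least that of
    \<open>E\<close>, whether or not they are iterated symmetrals; the class is closed under
    symmetrization, and this is all that the infimum argument uses.\<close>
  define P where "P F \<longleftrightarrow> (\<forall>i. F i \<in> sets borel \<and> F i \<subseteq> ball 0 R \<and> emeasure lborel (F i) = emeasure lborel (E i)) \<and> ?\<Phi> E \<le> ?\<Phi> F" for F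
  define D where "D F = (\<Sum>i\<in>UNIV. d F i)" for F
  define m where "m = real CARD('m)"
  have m: "m > 0" by (simp add: m_def)
  have d0: "d F i \<ge> 0" for F i by (simp add: d_def)
  have D0: "D F \<ge> 0" for F unfolding D_def by (intro sum_nonneg d0)
  have BR: "B i \<subseteq> ball 0 R" for i using r(2)[of i] by (auto simp: B_def)
  have step: "\<exists>F'. P F' \<and> D F' \<le> D F - (D F / m)^2 / (2 * V)" if PF: "P F" and pos: "D F > 0" for F
  proof -
    have F: "\<And>i. F i \<in> sets borel" "\<And>i. F i \<subseteq> ball 0 R" "\<And>i. emeasure lborel (F i) = emeasure lborel (E i)" "?\<Phi> E \<le> ?\<Phi> F"
      using PF by (auto simp: P_def)
    \<comment> \<open>Some factor has at least the average deficit, and a direction is chosen for it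
      alone. The other factors are symmetrized along the same direction and at least do not get
      worse.\<close>
    obtain i where i: "D F / m \<le> d F i"
    proof (rule ccontr)
      assume "\<not> thesis"
      then have "d F i < D F / m" for i using that by (meson not_le)
      then have "D F < (\<Sum>i\<in>(UNIV::'m set). D F / m)" unfolding D_def by (intro sum_strict_mono) auto
      then show False using m by (simp add: m_def)
    qed
    have di: "d F i > 0" using i pos m by (smt (verit) divide_pos_pos)
    have e1: "emeasure lborel (F i - B i) = ennreal (d F i)"
      unfolding d_def using F(2)[of i] by (intro finite_measure_subset_ball[of _ R]) auto
    have e2: "emeasure lborel (B i - F i) = ennreal (d F i)"
    proof -
      have fi: "emeasure lborel G = ennreal (measure lborel G)" if "G \<subseteq> F i \<or> G \<subseteq> B i" for G
        using that F(2)[of i] BR[of i] by (intro finite_measure_subset_ball[of _ R]) auto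
      have "measure lborel (F i) = measure lborel (F i \<inter> B i) + measure lborel (F i - B i)"
        using measure_Union[of lborel "F i \<inter> B i" "F i - B i"] fi[of "F i \<inter> B i"] fi[of "F i - B i"] F(1)[of i]
        by (simp add: Int_Diff_Un Int_Diff_disjoint B_def)
      moreover have "measure lborel (B i) = measure lborel (B i \<inter> F i) + measure lborel (B i - F i)"
        using measure_Union[of lborel "B i \<inter> F i" "B i - F i"] fi[of "B i \<inter> F i"] fi[of "B i - F i"] F(1)[of i]
        by (simp add: Int_Diff_Un Int_Diff_disjoint B_def)
      moreover have "measure lborel (F i) = measure lborel (B i)" using F(3)[of i] r(3)[of i] by (simp add: measure_def B_def)
      ultimately have "measure lborel (B i - F i) = d F i" by (simp add: d_def Int_commute)
      then show ?thesis using fi[of "B i - F i"] by simp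
    qed
    obtain \<theta> c where \<theta>: "norm \<theta> = 1" and gain: "(d F i)^2 / (2 * V) \<le> measure lborel {x \<in> F i - B i. x + c *\<^sub>R \<theta> \<in> B i - F i}"
      using exists_overlapping_shift[of "F i - B i" "B i - F i" R "d F i"] F(1,2)[of i] BR[of i] R di e1 e2
      unfolding V_def by (auto simp: B_def)
    define F' where "F' k = steiner \<theta> (F k)" for k
    have "P F'"
      unfolding P_def
    proof (intro conjI allI)
      show "F' k \<in> sets borel" "F' k \<subseteq> ball 0 R" "emeasure lborel (F' k) = emeasure lborel (E k)" for k
        using F(1)[of k] F(3)[of k] steiner_subset_ball[OF \<theta> less_imp_le[OF R] F(1,2), of k] by (simp_all add: F'_def emeasure_steiner[OF \<theta>])
      show "?\<Phi> E \<le> ?\<Phi> F'"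
        using F(4) emeasure_steiner_mono[OF A msA \<theta> less_imp_le[OF R] F(1,2)] unfolding F'_def by (rule order_trans)
    qed
    moreover have "D F' \<le> D F - (D F / m)^2 / (2 * V)"
    proof -
      have le: "d F' k + measure lborel {x \<in> F k - B k. x + c *\<^sub>R \<theta> \<in> B k - F k} \<le> d F k" for k
        unfolding d_def F'_def B_def using F(1,2) R r(1) by (intro measure_steiner_deficit[OF \<theta>, of _ R]) auto
      have le': "d F' k \<le> d F k" for k
        using le[of k] measure_nonneg[of lborel "{x \<in> F k - B k. x + c *\<^sub>R \<theta> \<in> B k - F k}"] by linarith
      have "(D F / m)^2 / (2 * V) \<le> (d F i)^2 / (2 * V)"
        using i pos m V by (intro divide_right_mono power_mono) auto
      then have "d F' i \<le> d F i - (D F / m)^2 / (2 * V)" using le[of i] gain by linarith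
      moreover have "D F' = d F' i + (\<Sum>k\<in>UNIV - {i}. d F' k)" "D F = d F i + (\<Sum>k\<in>UNIV - {i}. d F k)"
        by (simp_all add: D_def sum.remove)
      moreover have "(\<Sum>k\<in>UNIV - {i}. d F' k) \<le> (\<Sum>k\<in>UNIV - {i}. d F k)" by (intro sum_mono le')
      ultimately show ?thesis by linarith
    qed
    ultimately show ?thesis by blast
  qed
  have PE: "P E" using E by (simp add: P_def)
  have small: "\<exists>F. P F \<and> D F < e" if "e > 0" for e
  proof -
    define T where "T = D ` {F. P F}"
    have T: "T \<noteq> {}" "bdd_below T" using PE D0 by (auto simp: T_def intro!: bdd_belowI[of _ 0])
    have "Inf T \<le> 0"
    proof (rule ccontr)
      assume "\<not> Inf T \<le> 0"
      then have pos: "Inf T > 0" by simp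
      \<comment> \<open>The guaranteed improvement is increasing in the deficit, so
        \<open>\<eta>\<close> is available at every competitor. One whose deficit is within
        \<open>\<eta>\<close> of the infimum would be improved to below the infimum.\<close>
      define \<eta> where "\<eta> = (Inf T / m)^2 / (2 * V)"
      have "\<eta> > 0" using pos m V by (simp add: \<eta>_def)
      then obtain F where F: "P F" "D F < Inf T + \<eta>"
        using cInf_lessD[of T "Inf T + \<eta>"] T by (auto simp: T_def)
      have DF: "Inf T \<le> D F" using F T by (intro cInf_lower) (auto simp: T_def)
      then obtain F' where F': "P F'" "D F' \<le> D F - (D F / m)^2 / (2 * V)" using step[of F] F pos by auto
      have "\<eta> \<le> (D F / m)^2 / (2 * V)"
        unfolding \<eta>_def using DF pos m V by (intro divide_right_mono power_mono) auto
      then have "D F' < Inf T" using F' F by linarith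
      moreover have "Inf T \<le> D F'" using F' T by (intro cInf_lower) (auto simp: T_def)
      ultimately show False by simp
    qed
    then have "Inf T < e" using that by linarith
    then obtain x where "x \<in> T" "x < e" using cInf_lessD[OF T(1)] by blast
    then show ?thesis by (auto simp: T_def)
  qed
  \<comment> \<open>Bounds the product of the measures of all factors but one, whichever is left
    out; the maximum with 1 makes omitting a factor harmless.\<close>
  define W where "W = (\<Prod>k\<in>(UNIV::'m set). max 1 (measure lborel (E k)))"
  have W: "W \<ge> 1" unfolding W_def by (intro prod_ge_1) auto
  have bound: "?\<Phi> E \<le> ?\<Phi> B + ennreal (D F * W)" if "P F" for F
  proof -
    have F: "\<And>i. F i \<in> sets borel" "\<And>i. F i \<subseteq> ball 0 R" "\<And>i. emeasure lborel (F i) = emeasure lborel (E i)" "?\<Phi> E \<le> ?\<Phi> F"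
      using that by (auto simp: P_def)
    have Bm: "B i \<in> sets borel" for i by (simp add: B_def)
    \<comment> \<open>A point of the product of the \<open>F i\<close> that is not in the product of
      balls has some coordinate \<open>i\<close> outside its ball; \<open>G i\<close> is the product
      set containing such points, with measure proportional to the deficit of factor
      \<open>i\<close>.\<close>
    define G where "G i k = (if k = i then F i - B i else F k)" for i k
    have Gm: "G i k \<in> sets borel" for i k using F(1) Bm by (simp add: G_def)
    have "?\<Phi> F \<le> emeasure lborel_pow ((A \<inter> {x. \<forall>i. x i \<in> B i}) \<union> (\<Union>i. {x. \<forall>k. x k \<in> G i k}))"
    proof (rule emeasure_mono)
      show "A \<inter> {x. \<forall>i. x i \<in> F i} \<subseteq> (A \<inter> {x. \<forall>i. x i \<in> B i}) \<union> (\<Union>i. {x. \<forall>k. x k \<in> G i k})"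
        by (auto simp: G_def)
      show "(A \<inter> {x. \<forall>i. x i \<in> B i}) \<union> (\<Union>i. {x. \<forall>k. x k \<in> G i k}) \<in> sets lborel_pow"
        using Gm Bm by (intro sets.Un sets.Int A sets_lborel_pow_Pi sets.finite_UN) auto
    qed
    also have "\<dots> \<le> ?\<Phi> B + emeasure lborel_pow (\<Union>i. {x. \<forall>k. x k \<in> G i k})"
      using Gm Bm by (intro emeasure_subadditive sets.Int A sets_lborel_pow_Pi sets.finite_UN) auto
    also have "emeasure lborel_pow (\<Union>i. {x. \<forall>k. x k \<in> G i k}) \<le> (\<Sum>i\<in>UNIV. emeasure lborel_pow {x. \<forall>k. x k \<in> G i k})"
      using Gm by (intro emeasure_subadditive_finite) (auto intro!: sets_lborel_pow_Pi)
    also have "\<dots> \<le> (\<Sum>i\<in>UNIV. ennreal (d F i * W))"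
    proof (rule sum_mono)
      fix i
      have "emeasure lborel_pow {x. \<forall>k. x k \<in> G i k} = (\<Prod>k\<in>UNIV. emeasure lborel (G i k))" by (rule emeasure_lborel_pow_Pi) (rule Gm)
      also have "\<dots> = emeasure lborel (G i i) * (\<Prod>k\<in>UNIV - {i}. emeasure lborel (G i k))" by (simp add: prod.remove)
      also have "emeasure lborel (G i i) = ennreal (d F i)"
        unfolding d_def using F(2)[of i] by (simp add: G_def) (intro finite_measure_subset_ball[of _ R], auto)
      also have "(\<Prod>k\<in>UNIV - {i}. emeasure lborel (G i k)) = (\<Prod>k\<in>UNIV - {i}. ennreal (measure lborel (E k)))"
      proof (intro prod.cong refl)
        fix k assume "k \<in> UNIV - {i}"
        then show "emeasure lborel (G i k) = ennreal (measure lborel (E k))"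
          using F(3)[of k] finite_measure_subset_ball[OF E(2)[of k]] by (simp add: G_def)
      qed
      also have "\<dots> = ennreal (\<Prod>k\<in>UNIV - {i}. measure lborel (E k))" by (simp add: prod_ennreal)
      also have "\<dots> \<le> ennreal W"
      proof (rule ennreal_leI)
        have "(\<Prod>k\<in>UNIV - {i}. measure lborel (E k)) \<le> (\<Prod>k\<in>UNIV - {i}. max 1 (measure lborel (E k)))" by (intro prod_mono) auto
        also have "\<dots> = 1 * \<dots>" by simp
        also have "\<dots> \<le> max 1 (measure lborel (E i)) * (\<Prod>k\<in>UNIV - {i}. max 1 (measure lborel (E k)))"
          by (intro mult_right_mono prod_nonneg) auto
        also have "\<dots> = W" by (simp add: W_def prod.remove)
        finally show "(\<Prod>k\<in>UNIV - {i}. measure lborel (E k)) \<le> W" .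
      qed
      finally show "emeasure lborel_pow {x. \<forall>k. x k \<in> G i k} \<le> ennreal (d F i * W)"
        using d0 W by (simp add: ennreal_mult mult_left_mono)
    qed
    also have "\<dots> = ennreal (D F * W)" using d0 W by (subst sum_ennreal) (auto simp: D_def sum_distrib_right)
    finally show ?thesis using F(4) by (auto intro: order_trans add_left_mono)
  qed
  have "?\<Phi> E \<le> ?\<Phi> B"
  proof (rule ennreal_le_epsilon)
    fix e :: real assume "e > 0"
    then obtain F where F: "P F" "D F < e / W" using small[of "e / W"] W by auto
    then have "D F * W \<le> e" using W by (simp add: pos_less_divide_eq)
    then have "?\<Phi> B + ennreal (D F * W) \<le> ?\<Phi> B + ennreal e" by (intro add_left_mono ennreal_leI)
    with bound[OF F(1)] show "?\<Phi> E \<le> ?\<Phi> B + ennreal e" by (rule order_trans)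
  qed
  then show ?thesis by (simp add: B_def)
qed

lemma rearrangement_finite_measure:
  assumes E: "\<And>i. E i \<in> sets borel"
    and r: "\<And>i. 0 \<le> r i" "\<And>i. emeasure lborel (ball (0::'a) (r i)) = emeasure lborel (E i)"
  shows "emeasure lborel_pow (A \<inter> {x. \<forall>i. x i \<in> E i}) \<le> emeasure lborel_pow (A \<inter> {x. \<forall>i. x i \<in> ball 0 (r i)})"
proof -
  define F where "F n i = E i \<inter> ball 0 (real n)" for n i
  have Fm: "F n i \<in> sets borel" for n i using E by (simp add: F_def)
  have le: "emeasure lborel_pow (A \<inter> {x. \<forall>i. x i \<in> F n i}) \<le> emeasure lborel_pow (A \<inter> {x. \<forall>i. x i \<in> ball 0 (r i)})" for n
  proof -
    have "\<exists>s\<ge>0. emeasure lborel (ball (0::'a) s) = emeasure lborel (F n i)" for i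
    proof -
      have "emeasure lborel (F n i) = ennreal (measure lborel (F n i))" by (rule finite_measure_subset_ball[of _ "real n"]) (simp add: F_def)
      then show ?thesis using ball_of_measure[of "measure lborel (F n i)", where 'a = 'a] by auto
    qed
    then obtain s where s: "\<And>i. s i \<ge> 0" "\<And>i. emeasure lborel (ball (0::'a) (s i)) = emeasure lborel (F n i)" by metis
    define R where "R = 1 + real n + (\<Sum>i\<in>UNIV. s i)"
    have sR: "s i \<le> R" for i
    proof -
      have "s i \<le> (\<Sum>i\<in>UNIV. s i)" using s(1) by (intro member_le_sum) auto
      then show ?thesis by (simp add: R_def)
    qed
    have "R \<ge> 1 + real n" using s(1) by (simp add: R_def sum_nonneg)
    then have R: "R > 0" "F n i \<subseteq> ball 0 R" for i by (auto simp: F_def)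
    have sr: "s i \<le> r i" for i
    proof (rule ball_radius_mono[OF s(1) r(1)])
      have "emeasure lborel (F n i) \<le> emeasure lborel (E i)" using E by (intro emeasure_mono) (auto simp: F_def)
      then show "emeasure lborel (ball (0::'a) (s i)) \<le> emeasure lborel (ball (0::'a) (r i))" unfolding s(2) r(2) .
    qed
    have "emeasure lborel_pow (A \<inter> {x. \<forall>i. x i \<in> F n i}) \<le> emeasure lborel_pow (A \<inter> {x. \<forall>i. x i \<in> ball 0 (s i)})"
      by (rule rearrangement_bounded[OF Fm R(2) s(1) sR s(2) R(1)])
    also have "\<dots> \<le> emeasure lborel_pow (A \<inter> {x. \<forall>i. x i \<in> ball 0 (r i)})"
    proof (rule emeasure_mono)
      show "A \<inter> {x. \<forall>i. x i \<in> ball 0 (s i)} \<subseteq> A \<inter> {x. \<forall>i. x i \<in> ball 0 (r i)}"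
        using sr by (auto intro: less_le_trans)
      show "A \<inter> {x. \<forall>i. x i \<in> ball 0 (r i)} \<in> sets lborel_pow"
        by (intro sets.Int A sets_lborel_pow_Pi) simp
    qed
    finally show ?thesis .
  qed
  have FU: "(\<Union>n. A \<inter> {x. \<forall>i. x i \<in> F n i}) = A \<inter> {x. \<forall>i. x i \<in> E i}"
  proof (intro equalityI subsetI)
    fix x assume x: "x \<in> A \<inter> {x. \<forall>i. x i \<in> E i}"
    obtain n where n: "(\<Sum>i\<in>UNIV. norm (x i)) < real n" using reals_Archimedean2 by blast
    have "norm (x i) \<le> (\<Sum>i\<in>UNIV. norm (x i))" for i by (rule member_le_sum) auto
    then have "norm (x i) < real n" for i using n by (rule le_less_trans)
    then show "x \<in> (\<Union>n. A \<inter> {x. \<forall>i. x i \<in> F n i})" using x by (auto simp: F_def)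
  qed (auto simp: F_def)
  have "incseq (\<lambda>n. A \<inter> {x. \<forall>i. x i \<in> F n i})"
  proof (rule incseq_SucI)
    show "A \<inter> {x. \<forall>i. x i \<in> F n i} \<subseteq> A \<inter> {x. \<forall>i. x i \<in> F (Suc n) i}" for n
      by (auto simp: F_def intro: less_trans)
  qed
  then have "(SUP n. emeasure lborel_pow (A \<inter> {x. \<forall>i. x i \<in> F n i})) = emeasure lborel_pow (A \<inter> {x. \<forall>i. x i \<in> E i})"
    unfolding FU[symmetric] using Fm by (intro SUP_emeasure_incseq) (auto intro!: sets.Int sets_lborel_pow_Pi)
  moreover have "(SUP n. emeasure lborel_pow (A \<inter> {x. \<forall>i. x i \<in> F n i})) \<le> emeasure lborel_pow (A \<inter> {x. \<forall>i. x i \<in> ball 0 (r i)})"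
    by (intro SUP_least le)
  ultimately show ?thesis by simp
qed

end

text \<open>A multilinear layer cake, with an independent level \<open>t i\<close> for each factor.
  A product of layer integrals is one integral over all levels, and exchanging it with the integral
  over \<open>x\<close> leaves product sets only. Sets and rearranged sets are covered alike by
  leaving the layers \<open>L\<close> general.\<close>

lemma nn_integral_layers:
  fixes A :: "('m::finite \<Rightarrow> 'a::euclidean_space) set" and L :: "'m \<Rightarrow> real \<Rightarrow> 'a set"
  assumes A [measurable]: "A \<in> sets lborel_pow"
    and L: "\<And>i. {p. fst p \<in> L i (snd p)} \<in> sets (borel \<Otimes>\<^sub>M borel)"
  shows "(\<integral>\<^sup>+x. (\<Prod>i\<in>UNIV. \<integral>\<^sup>+t. indicator (L i t) (x i) * indicator {0<..} t \<partial>lborel) * indicator A x \<partial>lborel_pow)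
    = (\<integral>\<^sup>+t. (\<Prod>i\<in>UNIV. indicator {0<..} (t i)) * emeasure lborel_pow (A \<inter> {x. \<forall>i. x i \<in> L i (t i)}) \<partial>(lborel_pow :: ('m \<Rightarrow> real) measure))"
proof -
  let ?M = "lborel_pow :: ('m \<Rightarrow> 'a) measure" and ?T = "lborel_pow :: ('m \<Rightarrow> real) measure"
  interpret M: sigma_finite_measure ?M by (rule sigma_finite_lborel_pow)
  interpret T: sigma_finite_measure ?T by (rule sigma_finite_lborel_pow)
  interpret MT: pair_sigma_finite ?M ?T ..
  interpret P: product_sigma_finite "\<lambda>_. lborel :: real measure" ..
  have ind [measurable]: "(\<lambda>p. indicator (L i (snd p)) (fst p) :: ennreal) \<in> borel_measurable (borel \<Otimes>\<^sub>M borel)" for i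
  proof -
    have "(indicator {p. fst p \<in> L i (snd p)} :: _ \<Rightarrow> ennreal) \<in> borel_measurable (borel \<Otimes>\<^sub>M borel)" using L by simp
    moreover have "(\<lambda>p. indicator (L i (snd p)) (fst p) :: ennreal) = indicator {p. fst p \<in> L i (snd p)}" by (auto simp: indicator_def fun_eq_iff)
    ultimately show ?thesis by simp
  qed
  have indx: "(\<lambda>t. indicator (L i t) y :: ennreal) \<in> borel_measurable borel" for i y
    using measurable_compose[OF measurable_Pair1'[of y borel borel] ind] by simp
  have Lm: "L i t \<in> sets borel" for i t
  proof -
    have "(\<lambda>y. (y, t)) \<in> borel \<rightarrow>\<^sub>M borel \<Otimes>\<^sub>M borel" by measurable
    from measurable_sets[OF this L[of i]] show ?thesis by (simp add: vimage_def)
  qed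
  have m: "(\<lambda>p. (\<Prod>i\<in>UNIV. indicator (L i (snd p i)) (fst p i) * indicator {0<..} (snd p i)) * indicator A (fst p) :: ennreal) \<in> borel_measurable (?M \<Otimes>\<^sub>M ?T)"
  proof -
    have "(\<lambda>p. (fst p i, snd p i)) \<in> ?M \<Otimes>\<^sub>M ?T \<rightarrow>\<^sub>M borel \<Otimes>\<^sub>M borel" for i by measurable
    from measurable_compose[OF this ind] have [measurable]: "(\<lambda>p. indicator (L i (snd p i)) (fst p i) :: ennreal) \<in> borel_measurable (?M \<Otimes>\<^sub>M ?T)" for i by simp
    show ?thesis by measurable
  qed
  have "(\<integral>\<^sup>+x. (\<Prod>i\<in>UNIV. \<integral>\<^sup>+t. indicator (L i t) (x i) * indicator {0<..} t \<partial>lborel) * indicator A x \<partial>?M)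
    = (\<integral>\<^sup>+x. \<integral>\<^sup>+t. (\<Prod>i\<in>UNIV. indicator (L i (t i)) (x i) * indicator {0<..} (t i)) * indicator A x \<partial>?T \<partial>?M)"
  proof (rule nn_integral_cong)
    fix x :: "'m \<Rightarrow> 'a"
    have "(\<Prod>i\<in>UNIV. \<integral>\<^sup>+t. indicator (L i t) (x i) * indicator {0<..} t \<partial>lborel)
      = (\<integral>\<^sup>+t. (\<Prod>i\<in>UNIV. indicator (L i (t i)) (x i) * indicator {0<..} (t i)) \<partial>?T)"
      using indx by (intro P.product_nn_integral_prod[symmetric]) auto
    moreover have "(\<lambda>t. (\<Prod>i\<in>UNIV. indicator (L i (t i)) (x i) * indicator {0<..} (t i)) :: ennreal) \<in> borel_measurable ?T"
    proof -
      have [measurable]: "(\<lambda>t. indicator (L i (t i)) (x i) :: ennreal) \<in> borel_measurable ?T" for i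
        using measurable_compose[of "\<lambda>t. t i" ?T borel, OF _ indx] by simp
      show ?thesis by measurable
    qed
    ultimately show "(\<Prod>i\<in>UNIV. \<integral>\<^sup>+t. indicator (L i t) (x i) * indicator {0<..} t \<partial>lborel) * indicator A x
      = (\<integral>\<^sup>+t. (\<Prod>i\<in>UNIV. indicator (L i (t i)) (x i) * indicator {0<..} (t i)) * indicator A x \<partial>?T)"
      by (simp add: nn_integral_multc)
  qed
  also have "\<dots> = (\<integral>\<^sup>+t. \<integral>\<^sup>+x. (\<Prod>i\<in>UNIV. indicator (L i (t i)) (x i) * indicator {0<..} (t i)) * indicator A x \<partial>?M \<partial>?T)"
    using m by (intro MT.Fubini'[symmetric]) (simp add: case_prod_beta)
  also have "\<dots> = (\<integral>\<^sup>+t. (\<Prod>i\<in>UNIV. indicator {0<..} (t i)) * emeasure ?M (A \<inter> {x. \<forall>i. x i \<in> L i (t i)}) \<partial>?T)"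
  proof (rule nn_integral_cong)
    fix t :: "'m \<Rightarrow> real"
    have AL: "A \<inter> {x. \<forall>i. x i \<in> L i (t i)} \<in> sets ?M" by (intro sets.Int A sets_lborel_pow_Pi Lm)
    have "(\<integral>\<^sup>+x. (\<Prod>i\<in>UNIV. indicator (L i (t i)) (x i) * indicator {0<..} (t i)) * indicator A x \<partial>?M)
      = (\<integral>\<^sup>+x. (\<Prod>i\<in>UNIV. indicator {0<..} (t i)) * indicator (A \<inter> {x. \<forall>i. x i \<in> L i (t i)}) x \<partial>?M)"
    proof (rule nn_integral_cong)
      fix x
      have "(\<Prod>i\<in>UNIV. indicator (L i (t i)) (x i) :: ennreal) = indicator {x. \<forall>i. x i \<in> L i (t i)} x"
        by (auto simp: indicator_def prod_zero_iff)
      then show "(\<Prod>i\<in>UNIV. indicator (L i (t i)) (x i) * indicator {0<..} (t i)) * indicator A x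
        = (\<Prod>i\<in>UNIV. indicator {0<..} (t i)) * (indicator (A \<inter> {x. \<forall>i. x i \<in> L i (t i)}) x :: ennreal)"
        by (simp add: prod.distrib indicator_inter_arith mult_ac)
    qed
    also have "\<dots> = (\<Prod>i\<in>UNIV. indicator {0<..} (t i)) * emeasure ?M (A \<inter> {x. \<forall>i. x i \<in> L i (t i)})"
      using AL by (simp add: nn_integral_cmult)
    finally show "(\<integral>\<^sup>+x. (\<Prod>i\<in>UNIV. indicator (L i (t i)) (x i) * indicator {0<..} (t i)) * indicator A x \<partial>?M)
      = (\<Prod>i\<in>UNIV. indicator {0<..} (t i)) * emeasure ?M (A \<inter> {x. \<forall>i. x i \<in> L i (t i)})" .
  qed
  finally show ?thesis .
qed

section \<open>The rearrangement inequality for densities\<close>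

lemma symm_ball_eq_ball:
  fixes A :: "'a::euclidean_space set"
  assumes "r \<ge> 0" "emeasure lborel A = emeasure lborel (ball (0::'a) r)"
  shows "symm_ball A = ball 0 r"
  unfolding symm_ball_def
proof (rule the_equality)
  show "\<exists>s\<ge>0. ball (0::'a) r = ball 0 s \<and> emeasure lborel (ball (0::'a) r) = emeasure lborel A" using assms by auto
  fix S :: "'a set" assume "\<exists>s\<ge>0. S = ball 0 s \<and> emeasure lborel S = emeasure lborel A"
  then obtain s where s: "s \<ge> 0" "S = ball 0 s" "emeasure lborel S = emeasure lborel A" by blast
  have "emeasure lborel (ball (0::'a) s) = emeasure lborel (ball (0::'a) r)" using s(2,3) assms(2) by metis
  then have "s \<le> r" "r \<le> s" using ball_radius_mono[OF s(1) assms(1), where 'a='a] ball_radius_mono[OF assms(1) s(1), where 'a='a] by simp_all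
  then have "s = r" by simp
  then show "S = ball 0 r" using s by simp
qed

lemma symm_ball_ex_radius:
  fixes A :: "'a::euclidean_space set"
  assumes "emeasure lborel A < \<infinity>"
  obtains r where "r \<ge> 0" "symm_ball A = ball 0 r" "emeasure lborel (ball (0::'a) r) = emeasure lborel A"
proof -
  have eA: "emeasure lborel A = ennreal (measure lborel A)" using assms by (intro emeasure_eq_ennreal_measure) auto
  obtain r where r: "r \<ge> 0" "emeasure lborel (ball (0::'a) r) = ennreal (measure lborel A)"
    using ball_of_measure[of "measure lborel A", where 'a='a] by auto
  show ?thesis using r eA symm_ball_eq_ball[of r A] by (intro that[of r]) auto
qed

text \<open>Expressing membership through the measure of \<open>A\<close>, with no radius, exposes
  measurability when \<open>A\<close> varies with a level.\<close>

lemma mem_symm_ball_iff: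
  fixes A :: "'a::euclidean_space set"
  assumes "emeasure lborel A < \<infinity>"
  shows "x \<in> symm_ball A \<longleftrightarrow> ennreal (unit_ball_vol (real DIM('a)) * norm x ^ DIM('a)) < emeasure lborel A"
proof -
  obtain r where r: "r \<ge> 0" "symm_ball A = ball 0 r" "emeasure lborel (ball (0::'a) r) = emeasure lborel A"
    using symm_ball_ex_radius[OF assms] by blast
  have "norm x < r \<longleftrightarrow> norm x ^ DIM('a) < r ^ DIM('a)" using power_mono_iff[of r "norm x" "DIM('a)"] r(1) by (simp add: not_le[symmetric])
  also have "\<dots> \<longleftrightarrow> ennreal (unit_ball_vol (real DIM('a)) * norm x ^ DIM('a)) < emeasure lborel (ball (0::'a) r)"
    using r(1) by (simp add: emeasure_ball ennreal_less_iff)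
  finally show ?thesis using r by simp
qed

section \<open>Levels of a density and of its rearrangement\<close>

context
  fixes f :: "'a::euclidean_space \<Rightarrow> real"
  assumes f: "prob_density f"
begin

lemma density_measurable: "f \<in> borel_measurable borel"
  using f by (simp add: prob_density_def)

lemma density_nonneg: "0 \<le> f x"
  using f by (simp add: prob_density_def)

lemma superlevel_sets: "{x. t < f x} \<in> sets borel"
proof -
  note [measurable] = density_measurable
  have "{x \<in> space borel. t < f x} \<in> sets borel" by measurable
  then show ?thesis by simp
qed

lemma superlevel_finite:
  assumes "t > 0"
  shows "emeasure lborel {x. t < f x} < \<infinity>"
proof -
  note [measurable] = density_measurable superlevel_sets
  have "ennreal t * emeasure lborel {x. t < f x} = (\<integral>\<^sup>+x. ennreal t * indicator {x. t < f x} x \<partial>lborel)"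
    by (simp add: nn_integral_cmult_indicator)
  also have "\<dots> \<le> (\<integral>\<^sup>+x. ennreal (f x) \<partial>lborel)"
    by (intro nn_integral_mono) (auto simp: indicator_def ennreal_leI)
  also have "\<dots> = 1" using f by (simp add: prob_density_def)
  finally show ?thesis using assms by (auto simp: less_top[symmetric] ennreal_mult_top top_unique)
qed

lemma density_layers: "ennreal (f x) = (\<integral>\<^sup>+t. indicator {y. t < f y} x * indicator {0<..} t \<partial>lborel)"
proof -
  have "(\<integral>\<^sup>+t. indicator {y. t < f y} x * indicator {0<..} t \<partial>lborel) = (\<integral>\<^sup>+t. indicator {0<..<f x} t \<partial>lborel)"
    by (intro nn_integral_cong) (auto simp: indicator_def)
  then show ?thesis using density_nonneg[of x] by simp
qed

text \<open>An explicit form of \<open>symm_ball\<close> of the superlevel set, jointly measurable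
  in the point and the level. Levels \<open>t \<le> 0\<close> are excluded because the superlevel
  set may then have infinite measure.\<close>

definition symm_level :: "real \<Rightarrow> 'a set" where
  "symm_level t = {x. 0 < t \<and> ennreal (unit_ball_vol (real DIM('a)) * norm x ^ DIM('a)) < emeasure lborel {y. t < f y}}"

lemma symm_level_eq: "t > 0 \<Longrightarrow> symm_level t = symm_ball {y. t < f y}"
  using mem_symm_ball_iff[OF superlevel_finite] by (auto simp: symm_level_def)

lemma symm_decr_rearr_layers: "symm_decr_rearr f x = (\<integral>\<^sup>+t. indicator (symm_level t) x * indicator {0<..} t \<partial>lborel)"
  unfolding symm_decr_rearr_def by (intro nn_integral_cong) (auto simp: indicator_def symm_level_eq)

lemma symm_decr_rearr_radial: "norm x = norm y \<Longrightarrow> symm_decr_rearr f x = symm_decr_rearr f y"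
  unfolding symm_decr_rearr_layers by (simp add: symm_level_def indicator_def)

lemma superlevel_joint: "{p. fst p \<in> {x. snd p < f x}} \<in> sets (borel \<Otimes>\<^sub>M borel)"
proof -
  note [measurable] = density_measurable superlevel_sets
  have "{p \<in> space (borel \<Otimes>\<^sub>M borel). snd p < f (fst p)} \<in> sets (borel \<Otimes>\<^sub>M borel)" by measurable
  then show ?thesis by (simp add: space_pair_measure)
qed

lemma symm_level_joint: "{p. fst p \<in> symm_level (snd p)} \<in> sets (borel \<Otimes>\<^sub>M borel)"
proof -
  note [measurable] = density_measurable superlevel_sets
  have "{p \<in> space (borel \<Otimes>\<^sub>M lborel). fst p < f (snd p)} \<in> sets (borel \<Otimes>\<^sub>M lborel)" by measurable
  from lborel.measurable_emeasure_Pair[OF this]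
  have [measurable]: "(\<lambda>t. emeasure lborel {y. t < f y}) \<in> borel_measurable borel"
    by (simp add: vimage_def space_pair_measure)
  have "{p \<in> space (borel \<Otimes>\<^sub>M borel). 0 < snd p \<and>
    ennreal (unit_ball_vol (real DIM('a)) * norm (fst p :: 'a) ^ DIM('a)) < emeasure lborel {y. snd p < f y}} \<in> sets (borel \<Otimes>\<^sub>M borel)"
    by measurable
  then show ?thesis by (simp add: space_pair_measure symm_level_def)
qed

text \<open>Superlevel sets at \<open>t \<ge> 1\<close> are null, and the ball attached to a null
  set is empty. An almost everywhere bound on \<open>f\<close> thus becomes a bound on the
  rearrangement at every point, the origin included.\<close>

lemma symm_decr_rearr_le_1:
  assumes "esssup lborel (\<lambda>x. ereal \<bar>f x\<bar>) \<le> 1"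
  shows "symm_decr_rearr f x \<le> 1"
proof -
  note [measurable] = density_measurable superlevel_sets
  have "AE x in lborel. ereal \<bar>f x\<bar> \<le> esssup lborel (\<lambda>x. ereal \<bar>f x\<bar>)" by (rule esssup_AE) measurable
  then have le1: "AE x in lborel. f x \<le> 1"
    by eventually_elim (use assms density_nonneg in \<open>metis abs_of_nonneg ereal_less_eq(5) one_ereal_def order_trans ereal_less_eq(3)\<close>)
  have "emeasure lborel {y. t < f y} = 0" if "t \<ge> 1" for t
  proof -
    have "AE x in lborel. x \<notin> {y. t < f y}" using le1 by eventually_elim (use that in auto)
    then show ?thesis by (subst (asm) AE_iff_measurable[of "{y. t < f y}"]) auto
  qed
  then have "symm_level t = {}" if "t \<ge> 1" for t using that by (simp add: symm_level_def)
  then have "indicator (symm_level t) x * indicator {0<..} t \<le> (indicator {0<..<1} t :: ennreal)" for t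
    by (cases "t \<ge> 1") (auto simp: indicator_def)
  then have "symm_decr_rearr f x \<le> (\<integral>\<^sup>+t. indicator {0<..<1::real} t \<partial>lborel)"
    unfolding symm_decr_rearr_layers by (intro nn_integral_mono)
  then show ?thesis by simp
qed

end

theorem rearrangement_densities:
  fixes A :: "('m::finite \<Rightarrow> 'a::euclidean_space) set"
  assumes A: "A \<in> sets lborel_pow" and msA: "midconvex_symmetric_along_lines A" and f: "\<And>i. prob_density (f i)"
  shows "(\<integral>\<^sup>+x. (\<Prod>i\<in>UNIV. ennreal (f i (x i))) * indicator A x \<partial>lborel_pow) \<le>
    (\<integral>\<^sup>+x. (\<Prod>i\<in>UNIV. symm_decr_rearr (f i) (x i)) * indicator A x \<partial>lborel_pow)"
proof -
  let ?L = "\<lambda>i t. {y. t < f i y}" and ?S = "\<lambda>i t. symm_level (f i) t"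
  have le: "emeasure lborel_pow (A \<inter> {x. \<forall>i. x i \<in> ?L i (t i)}) \<le> emeasure lborel_pow (A \<inter> {x. \<forall>i. x i \<in> ?S i (t i)})"
    if t: "\<And>i. t i > 0" for t
  proof -
    have "\<exists>r\<ge>0. ?S i (t i) = ball 0 r \<and> emeasure lborel (ball (0::'a) r) = emeasure lborel (?L i (t i))" for i
    proof (rule symm_ball_ex_radius[OF superlevel_finite[OF f t]])
      fix r assume "r \<ge> 0" "symm_ball {x. t i < f i x} = ball 0 r" "emeasure lborel (ball (0::'a) r) = emeasure lborel {x. t i < f i x}"
      then show ?thesis using symm_level_eq[OF f t] by blast
    qed
    then obtain r where r: "\<And>i. r i \<ge> 0" "\<And>i. ?S i (t i) = ball 0 (r i)" "\<And>i. emeasure lborel (ball (0::'a) (r i)) = emeasure lborel (?L i (t i))" by metis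
    show ?thesis unfolding r(2) by (rule rearrangement_finite_measure[OF A msA superlevel_sets[OF f] r(1) r(3)])
  qed
  have "(\<Prod>i\<in>UNIV. indicator {0<..} (t i)) * emeasure lborel_pow (A \<inter> {x. \<forall>i. x i \<in> ?L i (t i)})
    \<le> (\<Prod>i\<in>UNIV. indicator {0<..} (t i)) * emeasure lborel_pow (A \<inter> {x. \<forall>i. x i \<in> ?S i (t i)})" for t :: "'m \<Rightarrow> real"
  proof (cases "\<forall>i. t i > 0")
    case True
    then show ?thesis by (intro mult_left_mono le) auto
  next
    case False
    then have z: "(\<Prod>i\<in>UNIV. indicator {0<..} (t i)) = (0::ennreal)" by (auto simp: prod_zero_iff indicator_def)
    show ?thesis unfolding z by simp
  qed
  then show ?thesis
    unfolding density_layers[OF f] symm_decr_rearr_layers[OF f]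
      nn_integral_layers[OF A superlevel_joint[OF f]] nn_integral_layers[OF A symm_level_joint[OF f]]
    by (rule nn_integral_mono)
qed

section \<open>Volumes of convex bodies along a direction\<close>

definition convex_body :: "'a::euclidean_space set \<Rightarrow> bool" where
  "convex_body K \<longleftrightarrow> compact K \<and> convex K \<and> K \<noteq> {}"

definition seg :: "'a::euclidean_space \<Rightarrow> 'a set" where
  "seg v = (\<lambda>s. s *\<^sub>R v) ` {-1..1}"

lemma convex_body_plus:
  assumes "convex_body K" "convex_body L"
  shows "convex_body (K + L)"
proof -
  have "K + L = {x + y | x y. x \<in> K \<and> y \<in> L}" by (auto simp: set_plus_def)
  then have "compact (K + L)" using compact_sums[of K L] assms by (simp add: convex_body_def)
  then show ?thesis using assms by (auto simp: convex_body_def convex_set_plus set_plus_intro)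
qed

lemma convex_body_seg: "convex_body (seg v)"
  unfolding convex_body_def seg_def
  by (intro conjI compact_continuous_image continuous_intros convex_linear_image) (auto intro: linearI simp: algebra_simps)

lemma convex_body_singleton: "convex_body {a}"
  by (simp add: convex_body_def)

lemma zero_mem_seg: "0 \<in> seg v"
  by (auto simp: seg_def intro!: image_eqI[of _ _ 0])

lemma subset_plus_zero: "0 \<in> L \<Longrightarrow> K \<subseteq> K + (L :: 'a::euclidean_space set)"
  using set_zero_plus2[of L K] by (simp add: add.commute)

lemma fibre_interval:
  fixes K :: "'a::euclidean_space set"
  assumes "convex_body K" "\<theta> \<noteq> 0"
  shows "{t. x + t *\<^sub>R \<theta> \<in> K} = {} \<or> (\<exists>a b. a \<le> b \<and> {t. x + t *\<^sub>R \<theta> \<in> K} = {a..b})"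
proof -
  let ?T = "{t. x + t *\<^sub>R \<theta> \<in> K}"
  have K: "compact K" "convex K" using assms by (auto simp: convex_body_def)
  have "closed ?T"
    using continuous_closed_vimage[of K "\<lambda>t. x + t *\<^sub>R \<theta>"] compact_imp_closed[OF K(1)]
    by (simp add: vimage_def continuous_intros)
  moreover have "bounded ?T"
  proof -
    obtain B where B: "\<And>y. y \<in> K \<Longrightarrow> norm y \<le> B" using compact_imp_bounded[OF K(1)] by (auto simp: bounded_iff)
    have "norm t \<le> (B + norm x) / norm \<theta>" if "t \<in> ?T" for t
    proof -
      have "\<bar>t\<bar> * norm \<theta> = norm ((x + t *\<^sub>R \<theta>) - x)" by simp
      also have "\<dots> \<le> norm (x + t *\<^sub>R \<theta>) + norm x" by (rule norm_triangle_ineq4)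
      also have "\<dots> \<le> B + norm x" using B that by simp
      finally show ?thesis using assms(2) by (simp add: pos_le_divide_eq)
    qed
    then show ?thesis unfolding bounded_iff by blast
  qed
  ultimately have "compact ?T" by (simp add: compact_eq_bounded_closed)
  moreover have "convex ?T"
  proof (rule convexI)
    fix s t u v :: real assume st: "s \<in> ?T" "t \<in> ?T" and uv: "0 \<le> u" "0 \<le> v" "u + v = 1"
    have "u *\<^sub>R (x + s *\<^sub>R \<theta>) + v *\<^sub>R (x + t *\<^sub>R \<theta>) \<in> K" using convexD[OF K(2)] st uv by auto
    also have "u *\<^sub>R (x + s *\<^sub>R \<theta>) + v *\<^sub>R (x + t *\<^sub>R \<theta>) = (u + v) *\<^sub>R x + (u * s + v * t) *\<^sub>R \<theta>" by (simp add: algebra_simps)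
    finally show "u *\<^sub>R s + v *\<^sub>R t \<in> ?T" using uv by simp
  qed
  ultimately obtain a b where "?T = {a..b}" using connected_compact_interval_1[of ?T] convex_connected by blast
  then show ?thesis by (cases "a \<le> b") auto
qed

lemma body_borel: "convex_body K \<Longrightarrow> K \<in> sets borel"
  by (simp add: convex_body_def borel_closed compact_imp_closed)

lemma emeasure_body:
  assumes "convex_body K"
  shows "emeasure lborel K = ennreal (measure lborel K)"
proof (rule emeasure_eq_ennreal_measure)
  have "emeasure lborel K < \<infinity>" using assms by (intro emeasure_compact_finite) (simp add: convex_body_def)
  then show "emeasure lborel K \<noteq> top" by simp
qed

lemma fibre_length_interval:
  assumes "{t. x + t *\<^sub>R \<theta> \<in> K} = {a..b}" "a \<le> b"
  shows "fibre_length \<theta> K x = ennreal (b - a)"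
  using assms by (simp add: fibre_length_def)

text \<open>In the direction of \<open>v\<close> every nonempty fibre of \<open>K\<close> is an
  interval, which adding \<open>r [-v, v]\<close> lengthens by \<open>2 r |v|\<close>; empty fibres
  stay empty. The affine dependence on \<open>r\<close> is written without differences, so that it
  can be proved fibrewise in \<open>ennreal\<close> and integrated.\<close>

lemma measure_plus_seg:
  fixes K :: "'a::euclidean_space set"
  assumes K: "convex_body K" and r: "r \<ge> 0"
  shows "measure lborel (K + seg (r *\<^sub>R v)) + r * measure lborel K = measure lborel K + r * measure lborel (K + seg v)"
proof (cases "v = 0")
  case True
  have "seg (0::'a) = {0}" by (auto simp: seg_def image_constant_conv)
  then show ?thesis using True by (simp add: set_plus_def)
next
  case False
  define \<theta> where "\<theta> = v /\<^sub>R norm v"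
  have \<theta>: "norm \<theta> = 1" "v = norm v *\<^sub>R \<theta>" using False by (auto simp: \<theta>_def)
  have \<theta>0: "\<theta> \<noteq> 0" using \<theta>(1) by auto
  have Kr: "convex_body (K + seg (q *\<^sub>R v))" for q by (intro convex_body_plus K convex_body_seg)
  note [measurable] = body_borel[OF K] body_borel[OF Kr] 
  have fib: "{t. x + t *\<^sub>R \<theta> \<in> K + seg (q *\<^sub>R v)} = {a - q * norm v..b + q * norm v}"
    if q: "q \<ge> 0" and ab: "{t. x + t *\<^sub>R \<theta> \<in> K} = {a..b}" "a \<le> b" for x q a b
  proof (intro equalityI subsetI)
    fix t assume "t \<in> {t. x + t *\<^sub>R \<theta> \<in> K + seg (q *\<^sub>R v)}"
    then obtain k s where k: "k \<in> K" "s \<in> {-1..1}" "x + t *\<^sub>R \<theta> = k + s *\<^sub>R q *\<^sub>R v"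
      by (auto simp: seg_def elim!: set_plus_elim)
    then have "k = x + (t - s * q * norm v) *\<^sub>R \<theta>" using \<theta>(2) by (metis add_diff_cancel_right' diff_diff_eq2 scaleR_left_diff_distrib scaleR_scaleR add_diff_eq)
    then have "t - s * q * norm v \<in> {a..b}" using k(1) ab(1) by auto
    moreover have "\<bar>s * (q * norm v)\<bar> \<le> 1 * (q * norm v)" unfolding abs_mult using k(2) q by (intro mult_mono) auto
    ultimately show "t \<in> {a - q * norm v..b + q * norm v}" by (simp add: mult.assoc abs_le_iff)
  next
    fix t assume t: "t \<in> {a - q * norm v..b + q * norm v}"
    \<comment> \<open>The point of \<open>[a, b]\<close> nearest to \<open>t\<close>; the remaining
      distance is at most \<open>q |v|\<close> and is covered by the segment.\<close>
    define t' where "t' = max a (min b t)"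
    have "0 \<le> q * norm v" using q by simp
    then have t': "t' \<in> {a..b}" "\<bar>t - t'\<bar> \<le> q * norm v" using t ab(2) unfolding t'_def atLeastAtMost_iff by linarith+
    have "x + t' *\<^sub>R \<theta> \<in> K" using t'(1) ab(1) by blast
    moreover have "(t - t') *\<^sub>R \<theta> \<in> seg (q *\<^sub>R v)"
    proof (cases "q = 0")
      case True
      then show ?thesis using t'(2) zero_mem_seg by simp
    next
      case q0: False
      have "(t - t') *\<^sub>R \<theta> = ((t - t') / (q * norm v)) *\<^sub>R q *\<^sub>R v" using q0 False by (subst \<theta>(2)) simp
      moreover have "(t - t') / (q * norm v) \<in> {-1..1}" using t'(2) q q0 False by (auto simp: abs_le_iff field_simps)
      ultimately show ?thesis unfolding seg_def by blast
    qed
    ultimately have "(x + t' *\<^sub>R \<theta>) + (t - t') *\<^sub>R \<theta> \<in> K + seg (q *\<^sub>R v)" by (rule set_plus_intro)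
    then show "t \<in> {t. x + t *\<^sub>R \<theta> \<in> K + seg (q *\<^sub>R v)}" by (simp add: algebra_simps)
  qed
  have fib0: "{t. x + t *\<^sub>R \<theta> \<in> K + seg (q *\<^sub>R v)} = {}" if "{t. x + t *\<^sub>R \<theta> \<in> K} = {}" for x q
  proof (rule equals0I)
    fix t assume "t \<in> {t. x + t *\<^sub>R \<theta> \<in> K + seg (q *\<^sub>R v)}"
    then obtain k s where k: "k \<in> K" "x + t *\<^sub>R \<theta> = k + s *\<^sub>R q *\<^sub>R v"
      by (auto simp: seg_def elim!: set_plus_elim)
    then have "k = x + (t - s * q * norm v) *\<^sub>R \<theta>" using \<theta>(2) by (metis add_diff_cancel_right' diff_diff_eq2 scaleR_left_diff_distrib scaleR_scaleR add_diff_eq)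
    then show False using k(1) that by blast
  qed
  have eq: "fibre_length \<theta> (K + seg (r *\<^sub>R v)) x + ennreal r * fibre_length \<theta> K x
      = fibre_length \<theta> K x + ennreal r * fibre_length \<theta> (K + seg v) x" for x
    using fibre_interval[OF K \<theta>0, of x]
  proof (elim disjE exE conjE)
    assume "{t. x + t *\<^sub>R \<theta> \<in> K} = {}"
    then show ?thesis using fib0[of x r] fib0[of x 1] by (simp add: fibre_length_def)
  next
    fix a b assume ab: "a \<le> b" "{t. x + t *\<^sub>R \<theta> \<in> K} = {a..b}"
    have n: "a - q * norm v \<le> b + q * norm v" if "q \<ge> 0" for q
      using ab(1) mult_nonneg_nonneg[OF that norm_ge_zero[of v]] by linarith
    have "fibre_length \<theta> K x = ennreal (b - a)" by (rule fibre_length_interval[OF ab(2,1)])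
    moreover have "fibre_length \<theta> (K + seg (r *\<^sub>R v)) x = ennreal ((b + r * norm v) - (a - r * norm v))"
      using ab r n[OF r] by (intro fibre_length_interval fib)
    moreover have "fibre_length \<theta> (K + seg (1 *\<^sub>R v)) x = ennreal ((b + 1 * norm v) - (a - 1 * norm v))"
      using ab n[of 1] by (intro fibre_length_interval fib) simp_all
    moreover have "ennreal (u + 2 * (r * p)) + ennreal r * ennreal u = ennreal u + ennreal r * ennreal (u + 2 * p)"
      if "0 \<le> u" "0 \<le> p" for u p
    proof -
      have "ennreal (u + 2 * (r * p)) + ennreal (r * u) = ennreal u + ennreal (r * (u + 2 * p))"
        using that r by (subst (1 2) ennreal_plus[symmetric]) (auto simp: algebra_simps)
      then show ?thesis using that r by (simp add: ennreal_mult)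
    qed
    from this[of "b - a" "norm v"] have "ennreal ((b + r * norm v) - (a - r * norm v)) + ennreal r * ennreal (b - a)
      = ennreal (b - a) + ennreal r * ennreal ((b + 1 * norm v) - (a - 1 * norm v))"
      using ab by (simp add: algebra_simps)
    ultimately show ?thesis by (simp only: scaleR_one)
  qed
  have "emeasure lborel (K + seg (r *\<^sub>R v)) + ennreal r * emeasure lborel K = 
    (\<integral>\<^sup>+x. indicator {0..<1} (x \<bullet> \<theta>) * (fibre_length \<theta> (K + seg (r *\<^sub>R v)) x + ennreal r * fibre_length \<theta> K x) \<partial>lborel)"
    by (simp add: emeasure_eq_fibre_length[OF \<theta>(1)] nn_integral_add nn_integral_cmult[symmetric] distrib_left mult.left_commute)
  also have "\<dots> = (\<integral>\<^sup>+x. indicator {0..<1} (x \<bullet> \<theta>) * (fibre_length \<theta> K x + ennreal r * fibre_length \<theta> (K + seg (1 *\<^sub>R v)) x) \<partial>lborel)"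
    unfolding eq by simp
  also have "\<dots> = emeasure lborel K + ennreal r * emeasure lborel (K + seg (1 *\<^sub>R v))"
    by (simp add: emeasure_eq_fibre_length[OF \<theta>(1)] nn_integral_add nn_integral_cmult[symmetric] distrib_left mult.left_commute del: scaleR_one)
  finally show ?thesis unfolding emeasure_body[OF K] emeasure_body[OF Kr] using r
    by (simp add: ennreal_mult[symmetric] ennreal_plus[symmetric] del: ennreal_plus)
qed

text \<open>For fixed coefficients \<open>c\<close> in \<open>C\<close> and fixed \<open>w\<close>
  in \<open>W\<close>, the point travels along \<open>\<theta>\<close>, with position affine in the
  displacements. Each point of the middle body is therefore the midpoint of points of the two outer
  bodies on the same line; all fibres are intervals, so their lengths compare, and Fubini
  finishes.\<close>

lemma measure_shadow_midpoint:
  fixes C :: "(real ^ 'm::finite) set" and y :: "'m \<Rightarrow> 'a::euclidean_space"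
  assumes C: "\<And>x :: 'm \<Rightarrow> 'a. convex_body (column_image x C)" and W: "convex_body W" and \<theta>: "norm \<theta> = 1"
  shows "measure lborel (column_image (\<lambda>i. y i + ((s i + t i) / 2) *\<^sub>R \<theta>) C + W)
    \<le> (measure lborel (column_image (\<lambda>i. y i + s i *\<^sub>R \<theta>) C + W) + measure lborel (column_image (\<lambda>i. y i + t i *\<^sub>R \<theta>) C + W)) / 2"
proof -
  let ?K = "\<lambda>t. column_image (\<lambda>i. y i + t i *\<^sub>R \<theta>) C + W"
  let ?m = "\<lambda>i. (s i + t i) / 2"
  have K: "convex_body (?K t)" for t by (intro convex_body_plus C W)
  note [measurable] = body_borel[OF K]
  have \<theta>0: "\<theta> \<noteq> 0" using \<theta> by auto
  have pt: "(\<Sum>i\<in>UNIV. (c $ i) *\<^sub>R (y i + u i *\<^sub>R \<theta>)) = (\<Sum>i\<in>UNIV. (c $ i) *\<^sub>R y i) + (\<Sum>i\<in>UNIV. c $ i * u i) *\<^sub>R \<theta>" for c and u :: "'m \<Rightarrow> real"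
    by (simp add: scaleR_right_distrib sum.distrib scaleR_sum_left)
  have split: "\<exists>a\<in>{q. x + q *\<^sub>R \<theta> \<in> ?K s}. \<exists>b\<in>{q. x + q *\<^sub>R \<theta> \<in> ?K t}. q = (a + b) / 2"
    if hq: "x + q *\<^sub>R \<theta> \<in> ?K ?m" for x q
  proof -
    obtain k w where kw: "k \<in> column_image (\<lambda>i. y i + ?m i *\<^sub>R \<theta>) C" "w \<in> W" "x + q *\<^sub>R \<theta> = k + w"
      by (rule set_plus_elim[OF hq])
    then obtain c where cw: "c \<in> C" "w \<in> W" "x + q *\<^sub>R \<theta> = (\<Sum>i\<in>UNIV. (c $ i) *\<^sub>R (y i + ?m i *\<^sub>R \<theta>)) + w"
      unfolding column_image_def by blast
    \<comment> \<open>The position on the line once the contribution of the moving part is removed;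
      restoring it with another displacement \<open>u\<close> gives a point of the body for
      \<open>u\<close>.\<close>
    define \<alpha> where "\<alpha> = q - (\<Sum>i\<in>UNIV. c $ i * ?m i)"
    have \<alpha>: "x + \<alpha> *\<^sub>R \<theta> = (\<Sum>i\<in>UNIV. (c $ i) *\<^sub>R y i) + w"
      using cw(3) unfolding pt \<alpha>_def by (simp add: algebra_simps)
    have mem: "x + (\<alpha> + (\<Sum>i\<in>UNIV. c $ i * u i)) *\<^sub>R \<theta> \<in> ?K u" for u
    proof -
      have "x + (\<alpha> + (\<Sum>i\<in>UNIV. c $ i * u i)) *\<^sub>R \<theta> = (x + \<alpha> *\<^sub>R \<theta>) + (\<Sum>i\<in>UNIV. c $ i * u i) *\<^sub>R \<theta>"
        by (simp add: algebra_simps)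
      also have "\<dots> = (\<Sum>i\<in>UNIV. (c $ i) *\<^sub>R (y i + u i *\<^sub>R \<theta>)) + w" unfolding \<alpha> pt by (simp add: algebra_simps)
      also have "\<dots> \<in> ?K u" using cw(1,2) by (intro set_plus_intro) (auto simp: column_image_def)
      finally show ?thesis .
    qed
    have "q = ((\<alpha> + (\<Sum>i\<in>UNIV. c $ i * s i)) + (\<alpha> + (\<Sum>i\<in>UNIV. c $ i * t i))) / 2"
      by (simp add: \<alpha>_def sum.distrib[symmetric] sum_divide_distrib[symmetric] distrib_left[symmetric] field_simps)
    then show ?thesis using mem[of s] mem[of t] by blast
  qed
  have le: "2 * fibre_length \<theta> (?K ?m) x \<le> fibre_length \<theta> (?K s) x + fibre_length \<theta> (?K t) x" for x
  proof (cases "{q. x + q *\<^sub>R \<theta> \<in> ?K ?m} = {}")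
    case True
    then have "fibre_length \<theta> (?K ?m) x = 0" unfolding fibre_length_def by (simp only: emeasure_empty)
    then show ?thesis by simp
  next
    case False
    then have "{q. x + q *\<^sub>R \<theta> \<in> ?K s} \<noteq> {}" "{q. x + q *\<^sub>R \<theta> \<in> ?K t} \<noteq> {}" using split by fast+
    then obtain a b a' b' where ab: "a \<le> b" "{q. x + q *\<^sub>R \<theta> \<in> ?K s} = {a..b}" "a' \<le> b'" "{q. x + q *\<^sub>R \<theta> \<in> ?K t} = {a'..b'}"
      using fibre_interval[OF K \<theta>0, of x s] fibre_interval[OF K \<theta>0, of x t] by metis
    have "{q. x + q *\<^sub>R \<theta> \<in> ?K ?m} \<subseteq> {(a + a')/2..(b + b')/2}"
    proof
      fix q assume "q \<in> {q. x + q *\<^sub>R \<theta> \<in> ?K ?m}"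
      then obtain c d where "c \<in> {a..b}" "d \<in> {a'..b'}" "q = (c + d)/2" using split[of x q] unfolding ab(2,4) by blast
      then show "q \<in> {(a + a')/2..(b + b')/2}" by auto
    qed
    then have "fibre_length \<theta> (?K ?m) x \<le> emeasure lborel {(a + a')/2..(b + b')/2}"
      unfolding fibre_length_def by (intro emeasure_mono) auto
    then have "2 * fibre_length \<theta> (?K ?m) x \<le> 2 * emeasure lborel {(a + a')/2..(b + b')/2}" by (rule mult_left_mono) simp
    also have "\<dots> = ennreal (b - a) + ennreal (b' - a')"
      using ab(1,3) by (simp add: ennreal_plus[symmetric] ennreal_mult'[symmetric] ennreal_numeral[symmetric] diff_divide_distrib[symmetric] del: ennreal_plus ennreal_numeral)
    finally show ?thesis using ab by (simp add: fibre_length_interval[OF ab(2,1)] fibre_length_interval[OF ab(4,3)])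
  qed
  have "2 * emeasure lborel (?K ?m) = (\<integral>\<^sup>+x. indicator {0..<1} (x \<bullet> \<theta>) * (2 * fibre_length \<theta> (?K ?m) x) \<partial>lborel)"
    by (simp add: emeasure_eq_fibre_length[OF \<theta>] nn_integral_cmult[symmetric] mult.left_commute)
  also have "\<dots> \<le> (\<integral>\<^sup>+x. indicator {0..<1} (x \<bullet> \<theta>) * (fibre_length \<theta> (?K s) x + fibre_length \<theta> (?K t) x) \<partial>lborel)"
    by (intro nn_integral_mono mult_left_mono le) auto
  also have "\<dots> = emeasure lborel (?K s) + emeasure lborel (?K t)"
    by (simp add: emeasure_eq_fibre_length[OF \<theta>] nn_integral_add distrib_left)
  finally have "ennreal (2 * measure lborel (?K ?m)) \<le> ennreal (measure lborel (?K s) + measure lborel (?K t))"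
    unfolding emeasure_body[OF K] by (simp add: ennreal_mult)
  then show ?thesis by (simp add: ennreal_le_iff del: ennreal_plus)
qed

section \<open>Parallel bodies of zonotopes\<close>

lemma convex_body_column_image:
  assumes "compact C" "convex C" "C \<noteq> {}"
  shows "convex_body (column_image x C :: 'a::euclidean_space set)"
proof -
  have eq: "column_image x C = (\<lambda>c. \<Sum>i\<in>UNIV. (c $ i) *\<^sub>R x i) ` C" by (auto simp: column_image_def)
  have "linear (\<lambda>c. \<Sum>i\<in>UNIV. (c $ i) *\<^sub>R x i)"
    by (intro linearI) (simp_all add: scaleR_left_distrib sum.distrib scaleR_right.sum)
  then show ?thesis unfolding eq convex_body_def using assms
    by (intro conjI compact_continuous_image convex_linear_image continuous_intros) auto
qed

text \<open>
  The properties shared by the coefficients of \<open>r \<mapsto> vol (K + r Z)\<close> for a zonotope \<open>Z\<close>. The affine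
  clause turns \<open>c (K + seg v) - c K\<close> into the limit of \<open>c (K + seg (r v)) / r\<close> for large \<open>r\<close>, and this is
  how monotonicity and convexity pass to the difference.
\<close>

definition steiner_coefficient :: "(real ^ 'm::finite) set \<Rightarrow> ('a::euclidean_space set \<Rightarrow> real) \<Rightarrow> bool" where
  "steiner_coefficient C c \<longleftrightarrow>
     (\<forall>K. convex_body K \<longrightarrow> 0 \<le> c K) \<and>
     (\<forall>K L. convex_body K \<longrightarrow> convex_body L \<longrightarrow> K \<subseteq> L \<longrightarrow> c K \<le> c L) \<and>
     (\<forall>K r v. convex_body K \<longrightarrow> 0 \<le> r \<longrightarrow> c (K + seg (r *\<^sub>R v)) + r * c K = c K + r * c (K + seg v)) \<and>
     (\<forall>W \<theta> y s t. convex_body W \<longrightarrow> norm \<theta> = 1 \<longrightarrow>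
        c (column_image (\<lambda>i. y i + ((s i + t i) / 2) *\<^sub>R \<theta>) C + W) \<le>
          (c (column_image (\<lambda>i. y i + s i *\<^sub>R \<theta>) C + W) + c (column_image (\<lambda>i. y i + t i *\<^sub>R \<theta>) C + W)) / 2)"

lemma steiner_coefficientD:
  assumes "steiner_coefficient C c"
  shows "convex_body K \<Longrightarrow> 0 \<le> c K"
    "convex_body K \<Longrightarrow> convex_body L \<Longrightarrow> K \<subseteq> L \<Longrightarrow> c K \<le> c L"
    "convex_body K \<Longrightarrow> 0 \<le> r \<Longrightarrow> c (K + seg (r *\<^sub>R v)) + r * c K = c K + r * c (K + seg v)"
    "convex_body W \<Longrightarrow> norm \<theta> = 1 \<Longrightarrow> c (column_image (\<lambda>i. y i + ((s i + t i) / 2) *\<^sub>R \<theta>) C + W) \<le>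
          (c (column_image (\<lambda>i. y i + s i *\<^sub>R \<theta>) C + W) + c (column_image (\<lambda>i. y i + t i *\<^sub>R \<theta>) C + W)) / 2"
  using assms unfolding steiner_coefficient_def by blast+

lemma slope_le:
  fixes a b a' b' :: real
  assumes "\<And>r. r > 0 \<Longrightarrow> a + r * b \<le> a' + r * b'"
  shows "b \<le> b'"
proof (rule ccontr)
  assume "\<not> b \<le> b'"
  then have bb: "b - b' > 0" by simp
  \<comment> \<open>At this \<open>r\<close> the steeper line has gained
    \<open>|a' - a| + 1\<close>, more than the offset can compensate.\<close>
  define r where "r = (\<bar>a' - a\<bar> + 1) / (b - b')"
  have "r > 0" using bb by (simp add: r_def)
  then have "r * (b - b') \<le> a' - a" using assms[of r] by (simp add: algebra_simps)
  then show False using bb by (simp add: r_def)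
qed

primrec zonotope :: "'a::euclidean_space list \<Rightarrow> 'a set" where
  "zonotope [] = {0}"
| "zonotope (v # vs) = seg v + zonotope vs"

lemma convex_body_zonotope: "convex_body (zonotope vs)"
  by (induction vs) (auto intro: convex_body_plus convex_body_seg convex_body_singleton)

lemma zonotope_scale_bound: "z \<in> zonotope (map ((*\<^sub>R) r) vs) \<Longrightarrow> norm z \<le> \<bar>r\<bar> * (\<Sum>v\<leftarrow>vs. norm v)"
proof (induction vs arbitrary: z)
  case (Cons v vs)
  then obtain s w where sw: "s \<in> {-1..1}" "w \<in> zonotope (map ((*\<^sub>R) r) vs)" "z = s *\<^sub>R r *\<^sub>R v + w"
    by (auto simp: seg_def elim!: set_plus_elim)
  have "norm z \<le> norm (s *\<^sub>R r *\<^sub>R v) + norm w" unfolding sw(3) by (rule norm_triangle_ineq)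
  also have "norm (s *\<^sub>R r *\<^sub>R v) \<le> 1 * (\<bar>r\<bar> * norm v)" unfolding norm_scaleR using sw(1) by (intro mult_right_mono) auto
  also have "norm w \<le> \<bar>r\<bar> * (\<Sum>v\<leftarrow>vs. norm v)" by (rule Cons.IH[OF sw(2)])
  finally show ?case by (simp add: algebra_simps)
qed simp

text \<open>The formal degree is the number of segments, but \<open>K + r Z\<close> sits in a ball
  of radius proportional to \<open>r\<close>, so its volume is of order at most \<open>r^n\<close>.
  Nonnegative coefficients cannot cancel: each single term is bounded by the whole, which forces
  those beyond the dimension to vanish.\<close>

lemma zonotope_coefficient_vanishes:
  fixes vs :: "'a::euclidean_space list"
  assumes c: "\<And>k. c k \<ge> 0" and vol: "\<And>r. r \<ge> 0 \<Longrightarrow> measure lborel (K + zonotope (map ((*\<^sub>R) r) vs)) = (\<Sum>k\<le>length vs. c k * r ^ k)"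
    and K: "convex_body K" and k: "k > DIM('a)" "k \<le> length vs"
  shows "c k = 0"
proof -
  let ?n = "DIM('a)" and ?\<omega> = "unit_ball_vol (real DIM('a))"
  obtain B where B: "B > 0" "\<And>x. x \<in> K \<Longrightarrow> norm x \<le> B"
    using K compact_imp_bounded[of K] by (auto simp: convex_body_def bounded_pos)
  define a where "a = B + (\<Sum>v\<leftarrow>vs. norm v)"
  have a: "a > 0" unfolding a_def using B(1) by (intro add_pos_nonneg sum_list_nonneg) auto
  have le: "c k * r \<le> ?\<omega> * a ^ ?n" if r: "r \<ge> 1" for r
  proof -
    have "c k * r ^ k \<le> (\<Sum>k\<le>length vs. c k * r ^ k)" using k(2) c r by (intro member_le_sum) auto
    also have "\<dots> = measure lborel (K + zonotope (map ((*\<^sub>R) r) vs))" using r by (simp add: vol)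
    also have "\<dots> \<le> measure lborel (cball (0::'a) (a * r))"
    proof (rule measure_mono_fmeasurable)
      show "K + zonotope (map ((*\<^sub>R) r) vs) \<subseteq> cball 0 (a * r)"
      proof
        fix x assume "x \<in> K + zonotope (map ((*\<^sub>R) r) vs)"
        then obtain y z where yz: "y \<in> K" "z \<in> zonotope (map ((*\<^sub>R) r) vs)" "x = y + z" by (rule set_plus_elim)
        have "norm x \<le> norm y + norm z" unfolding yz(3) by (rule norm_triangle_ineq)
        also have "\<dots> \<le> B * r + r * (\<Sum>v\<leftarrow>vs. norm v)"
        proof (rule add_mono)
          show "norm y \<le> B * r" using B(2)[OF yz(1)] mult_left_mono[OF r less_imp_le[OF B(1)]] by simp
        qed (use zonotope_scale_bound[OF yz(2)] r in simp)
        finally show "x \<in> cball 0 (a * r)" by (simp add: a_def algebra_simps)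
      qed
      show "K + zonotope (map ((*\<^sub>R) r) vs) \<in> sets lborel"
        using body_borel[OF convex_body_plus[OF K convex_body_zonotope]] by simp
      show "cball (0::'a) (a * r) \<in> fmeasurable lborel" by (intro fmeasurable_compact) auto
    qed
    also have "\<dots> = ?\<omega> * (a * r) ^ ?n" using a r by (simp add: content_cball)
    finally have "c k * r ^ k \<le> (?\<omega> * a ^ ?n) * r ^ ?n" by (simp add: power_mult_distrib)
    moreover have "c k * r * r ^ ?n \<le> c k * r ^ k"
    proof -
      have "r ^ Suc ?n \<le> r ^ k" using k(1) r by (intro power_increasing) auto
      then show ?thesis using mult_left_mono[OF _ c[of k], of "r ^ Suc ?n" "r ^ k"] by (simp add: mult.assoc)
    qed
    ultimately have "(c k * r) * r ^ ?n \<le> (?\<omega> * a ^ ?n) * r ^ ?n" by simp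
    then show ?thesis using r by (simp add: mult_le_cancel_right_pos)
  qed
  have "c k \<le> 0"
  \<comment> \<open>The estimate holds for arguments at least 1, hence it is used at
    \<open>1 + r\<close>; boundedness of a linear function of \<open>r\<close> leaves no positive
    slope.\<close>
  proof (rule slope_le[of 0 "c k" "?\<omega> * a ^ ?n + c k" 0])
    fix r :: real assume "r > 0"
    then show "0 + r * c k \<le> ?\<omega> * a ^ ?n + c k + r * 0"
      using le[of "1 + r"] c[of k] by (simp add: algebra_simps)
  qed
  then show ?thesis using c[of k] by simp
qed

context
  fixes C :: "(real ^ 'm::finite) set"
  assumes C: "compact C" "convex C" "C \<noteq> {}"
begin

lemma steiner_coefficient_measure: "steiner_coefficient C (measure lborel)"
  unfolding steiner_coefficient_def
proof (intro conjI allI impI)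
  fix K L :: "'a::euclidean_space set" assume "convex_body K" "convex_body L" "K \<subseteq> L"
  then show "measure lborel K \<le> measure lborel L"
    using emeasure_mono[of K L lborel] body_borel[of L] by (simp add: emeasure_body ennreal_le_iff)
next
  fix W :: "'a set" and \<theta> :: 'a and y :: "'m \<Rightarrow> 'a" and s t assume "convex_body W" "norm \<theta> = 1"
  then show "measure lborel (column_image (\<lambda>i. y i + ((s i + t i) / 2) *\<^sub>R \<theta>) C + W)
    \<le> (measure lborel (column_image (\<lambda>i. y i + s i *\<^sub>R \<theta>) C + W) + measure lborel (column_image (\<lambda>i. y i + t i *\<^sub>R \<theta>) C + W)) / 2"
    by (intro measure_shadow_midpoint convex_body_column_image C)
qed (auto intro: measure_plus_seg)

lemma steiner_coefficient_zero: "steiner_coefficient C (\<lambda>_. 0)"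
  by (simp add: steiner_coefficient_def)

lemma steiner_coefficient_add:
  fixes c d :: "'a::euclidean_space set \<Rightarrow> real"
  assumes "steiner_coefficient C c" "steiner_coefficient C d"
  shows "steiner_coefficient C (\<lambda>K. c K + d K)"
  unfolding steiner_coefficient_def
proof (intro conjI allI impI)
  fix K :: "'a set" and r v assume "convex_body K" "0 \<le> (r::real)"
  then show "c (K + seg (r *\<^sub>R v)) + d (K + seg (r *\<^sub>R v)) + r * (c K + d K) = c K + d K + r * (c (K + seg v) + d (K + seg v))"
    using steiner_coefficientD(3)[OF assms(1), of K r v] steiner_coefficientD(3)[OF assms(2), of K r v] by (simp add: algebra_simps)
next
  fix W :: "'a set" and \<theta> :: 'a and y :: "'m \<Rightarrow> 'a" and s t assume "convex_body W" "norm \<theta> = 1"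
  note hyps = this
  have avg: "a1 + a2 \<le> (b1 + b2 + (c1 + c2)) / 2" if "a1 \<le> (b1 + c1) / 2" "a2 \<le> (b2 + c2) / 2" for a1 a2 b1 b2 c1 c2 :: real
    using add_mono[OF that] by (simp add: add_divide_distrib)
  show "c (column_image (\<lambda>i. y i + ((s i + t i) / 2) *\<^sub>R \<theta>) C + W) + d (column_image (\<lambda>i. y i + ((s i + t i) / 2) *\<^sub>R \<theta>) C + W) \<le>
    (c (column_image (\<lambda>i. y i + s i *\<^sub>R \<theta>) C + W) + d (column_image (\<lambda>i. y i + s i *\<^sub>R \<theta>) C + W) +
    (c (column_image (\<lambda>i. y i + t i *\<^sub>R \<theta>) C + W) + d (column_image (\<lambda>i. y i + t i *\<^sub>R \<theta>) C + W))) / 2"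
    by (rule avg[OF steiner_coefficientD(4)[OF assms(1) hyps] steiner_coefficientD(4)[OF assms(2) hyps]])
qed (use steiner_coefficientD(1,2)[OF assms(1)] steiner_coefficientD(1,2)[OF assms(2)] in \<open>auto intro!: add_mono add_nonneg_nonneg\<close>)

lemma steiner_coefficient_diff:
  fixes c :: "'a::euclidean_space set \<Rightarrow> real"
  assumes c: "steiner_coefficient C c"
  shows "steiner_coefficient C (\<lambda>K. c (K + seg v) - c K)"
  unfolding steiner_coefficient_def
proof (intro conjI allI impI)
  note D = steiner_coefficientD[OF c]
  have aff: "c K + r * (c (K + seg v) - c K) = c (K + seg (r *\<^sub>R v))" if "convex_body K" "0 \<le> r" for K r
    using D(3)[OF that, of v] by (simp add: algebra_simps)
  show "0 \<le> c (K + seg v) - c K" if "convex_body K" for K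
    using D(2)[OF that convex_body_plus[OF that convex_body_seg] subset_plus_zero[OF zero_mem_seg], of v] by simp
  show "c (K + seg v) - c K \<le> c (L + seg v) - c L" if KL: "convex_body K" "convex_body L" "K \<subseteq> L" for K L
  \<comment> \<open>Both affine functions of \<open>r\<close> are values of \<open>c\<close> itself,
    at \<open>K + seg (r v)\<close> and \<open>L + seg (r v)\<close>, where monotonicity of
    \<open>c\<close> applies.\<close>
  proof (rule slope_le)
    fix r :: real assume "r > 0"
    then show "c K + r * (c (K + seg v) - c K) \<le> c L + r * (c (L + seg v) - c L)"
      using KL by (simp add: aff) (intro D(2) convex_body_plus convex_body_seg set_plus_mono2, auto)
  qed
  show "c (K + seg (r *\<^sub>R w) + seg v) - c (K + seg (r *\<^sub>R w)) + r * (c (K + seg v) - c K)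
     = c (K + seg v) - c K + r * (c (K + seg w + seg v) - c (K + seg w))" if K: "convex_body K" "0 \<le> r" for K r w
  proof -
    \<comment> \<open>Segments may be added in either order, so the affine law in the direction
      \<open>w\<close> holds for \<open>c\<close> both at \<open>K\<close> and at
      \<open>K + seg v\<close>, and subtracts.\<close>
    have "K + seg u + seg v = K + seg v + seg u" for u by (simp add: ac_simps)
    then show ?thesis
      using D(3)[OF K, of w] D(3)[OF convex_body_plus[OF K(1) convex_body_seg] K(2), of v w] by (simp add: algebra_simps)
  qed
  show "c (column_image (\<lambda>i. y i + ((s i + t i) / 2) *\<^sub>R \<theta>) C + W + seg v) - c (column_image (\<lambda>i. y i + ((s i + t i) / 2) *\<^sub>R \<theta>) C + W)
    \<le> (c (column_image (\<lambda>i. y i + s i *\<^sub>R \<theta>) C + W + seg v) - c (column_image (\<lambda>i. y i + s i *\<^sub>R \<theta>) C + W) +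
       (c (column_image (\<lambda>i. y i + t i *\<^sub>R \<theta>) C + W + seg v) - c (column_image (\<lambda>i. y i + t i *\<^sub>R \<theta>) C + W))) / 2"
    if W: "convex_body W" and \<theta>: "norm \<theta> = 1" for W \<theta> y s t
  proof -
    let ?K = "\<lambda>u. column_image (\<lambda>i. y i + u i *\<^sub>R \<theta>) C + W" and ?d = "\<lambda>K. c (K + seg v) - c K"
    let ?m = "\<lambda>i. (s i + t i) / 2"
    have K: "convex_body (?K u)" for u by (intro convex_body_plus convex_body_column_image C W)
    have avg: "(c1 + c2) / 2 = (a1 + a2) / 2 + r * ((d1 + d2) / 2)" if "a1 + r * d1 = c1" "a2 + r * d2 = c2" for a1 a2 c1 c2 d1 d2 r :: real
      unfolding that[symmetric] by (simp add: field_simps)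
    have "?d (?K ?m) \<le> (?d (?K s) + ?d (?K t)) / 2"
    proof (rule slope_le)
      fix r :: real assume r: "r > 0"
      have "c (?K ?m) + r * ?d (?K ?m) = c (?K ?m + seg (r *\<^sub>R v))" using r by (intro aff K) simp
      \<comment> \<open>The segment is absorbed into the fixed summand \<open>W\<close>; this is why
        the convexity clause is stated with an arbitrary \<open>W\<close> and not for the shadows
        alone.\<close>
      also have "\<dots> \<le> (c (?K s + seg (r *\<^sub>R v)) + c (?K t + seg (r *\<^sub>R v))) / 2"
        using D(4)[OF convex_body_plus[OF W convex_body_seg] \<theta>, of y s t "r *\<^sub>R v"] by (simp only: add.assoc)
      also have "\<dots> = (c (?K s) + c (?K t)) / 2 + r * ((?d (?K s) + ?d (?K t)) / 2)"
        by (rule avg[OF aff[OF K less_imp_le[OF r]] aff[OF K less_imp_le[OF r]]])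
      finally show "c (?K ?m) + r * ?d (?K ?m) \<le> (c (?K s) + c (?K t)) / 2 + r * ((?d (?K s) + ?d (?K t)) / 2)" .
    qed
    then show ?thesis .
  qed
qed

text \<open>When one segment is split off, the body \<open>K + seg (r v)\<close> itself depends on
  \<open>r\<close>. Each coefficient evaluated there is affine in \<open>r\<close>, so the result is
  again a polynomial, of degree one higher, whose coefficients are old ones plus increments of old
  ones and so keep all the closure properties.\<close>

lemma measure_plus_zonotope:
  fixes vs :: "'a::euclidean_space list"
  shows "\<exists>c. (\<forall>k. steiner_coefficient C (c k)) \<and> (\<forall>k > length vs. \<forall>K. convex_body K \<longrightarrow> c k K = 0) \<and>
    (\<forall>K. convex_body K \<longrightarrow> (\<forall>r\<ge>0. measure lborel (K + zonotope (map ((*\<^sub>R) r) vs)) = (\<Sum>k\<le>length vs. c k K * r ^ k)))"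
proof (induction vs)
  case Nil
  have z: "K + {0} = K" for K :: "'a set" by (auto simp: set_plus_def)
  show ?case
    by (intro exI[of _ "\<lambda>k. if k = 0 then measure lborel else (\<lambda>_. 0)"])
       (auto simp: z steiner_coefficient_measure steiner_coefficient_zero)
next
  case (Cons v vs)
  then obtain c where c: "\<And>k. steiner_coefficient C (c k)" "\<And>k K. k > length vs \<Longrightarrow> convex_body K \<Longrightarrow> c k K = 0"
    "\<And>K r. convex_body K \<Longrightarrow> r \<ge> 0 \<Longrightarrow> measure lborel (K + zonotope (map ((*\<^sub>R) r) vs)) = (\<Sum>k\<le>length vs. c k K * r ^ k)"
    by metis
  \<comment> \<open>The slope of the coefficient of \<open>r^l\<close> contributes to
    \<open>r^(l+1)\<close>, hence the shift; nothing is contributed to the constant term.\<close>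
  define d where "d k K = (case k of 0 \<Rightarrow> 0 | Suc l \<Rightarrow> c l (K + seg v) - c l K)" for k K
  have d: "steiner_coefficient C (d k)" for k
    by (cases k) (simp_all add: d_def[abs_def] steiner_coefficient_zero steiner_coefficient_diff c)
  show ?case
  proof (intro exI[of _ "\<lambda>k K. c k K + d k K"] conjI allI impI)
    show "steiner_coefficient C (\<lambda>K. c k K + d k K)" for k by (intro steiner_coefficient_add c d)
    show "c k K + d k K = 0" if "k > length (v # vs)" "convex_body K" for k K
      using that c(2) convex_body_plus[OF that(2) convex_body_seg] by (cases k) (auto simp: d_def)
    fix K :: "'a set" and r :: real assume K: "convex_body K" and r: "0 \<le> r"
    have "measure lborel (K + zonotope (map ((*\<^sub>R) r) (v # vs))) = measure lborel ((K + seg (r *\<^sub>R v)) + zonotope (map ((*\<^sub>R) r) vs))"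
      by (simp add: add.assoc)
    also have "\<dots> = (\<Sum>k\<le>length vs. c k (K + seg (r *\<^sub>R v)) * r ^ k)"
      by (rule c(3)[OF convex_body_plus[OF K convex_body_seg] r])
    also have "\<dots> = (\<Sum>k\<le>length vs. c k K * r ^ k + d (Suc k) K * r ^ Suc k)"
    proof (intro sum.cong refl)
      fix k
      have "c k (K + seg (r *\<^sub>R v)) = c k K + r * d (Suc k) K"
        using steiner_coefficientD(3)[OF c(1) K r, of k v] by (simp add: d_def algebra_simps)
      then show "c k (K + seg (r *\<^sub>R v)) * r ^ k = c k K * r ^ k + d (Suc k) K * r ^ Suc k" by (simp add: algebra_simps)
    qed
    also have "\<dots> = (\<Sum>k\<le>length vs. c k K * r ^ k) + (\<Sum>k\<le>length vs. d (Suc k) K * r ^ Suc k)" by (rule sum.distrib)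
    also have "(\<Sum>k\<le>length vs. c k K * r ^ k) = (\<Sum>k\<le>Suc (length vs). c k K * r ^ k)" using c(2) K by simp
    also have "(\<Sum>k\<le>length vs. d (Suc k) K * r ^ Suc k) = (\<Sum>k\<le>Suc (length vs). d k K * r ^ k)"
      by (subst sum.atMost_Suc_shift) (simp add: d_def)
    finally show "measure lborel (K + zonotope (map ((*\<^sub>R) r) (v # vs))) = (\<Sum>k\<le>length (v # vs). (c k K + d k K) * r ^ k)"
      by (simp add: sum.distrib distrib_right)
  qed
qed

end

section \<open>Approximating the ball by zonotopes\<close>

definition reflection :: "'a::euclidean_space \<Rightarrow> 'a \<Rightarrow> 'a" where
  "reflection \<theta> v = v - (2 * (v \<bullet> \<theta>)) *\<^sub>R \<theta>"

lemma reflection_measurable [measurable]: "reflection \<theta> \<in> borel_measurable borel"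
  unfolding reflection_def[abs_def] by measurable

lemma linear_reflection: "linear (reflection \<theta>)"
  by (intro linearI) (simp_all add: reflection_def inner_add_left algebra_simps)

lemma reflection_reflection: "norm \<theta> = 1 \<Longrightarrow> reflection \<theta> (reflection \<theta> v) = v"
  by (simp add: reflection_def inner_diff_left norm_eq_1 algebra_simps)

lemma inner_reflection: "reflection \<theta> v \<bullet> w = v \<bullet> reflection \<theta> w"
  by (simp add: reflection_def inner_diff_left inner_diff_right inner_commute mult.commute mult.left_commute)

lemma norm_reflection: "norm \<theta> = 1 \<Longrightarrow> norm (reflection \<theta> v) = norm v"
  by (simp add: norm_eq_sqrt_inner inner_reflection reflection_reflection)

lemma reflection_orthogonal_part:
  assumes "norm \<theta> = 1"
  shows "reflection \<theta> (x - (x \<bullet> \<theta>) *\<^sub>R \<theta> + t *\<^sub>R \<theta>) = x - (x \<bullet> \<theta>) *\<^sub>R \<theta> - t *\<^sub>R \<theta>"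
proof -
  have "(2 * t) *\<^sub>R \<theta> = t *\<^sub>R \<theta> + t *\<^sub>R \<theta>" by (metis mult_2 scaleR_left_distrib)
  then show ?thesis unfolding reflection_def orthogonal_part(2)[OF assms] by simp
qed

text \<open>The reflection reverses each line parallel to \<open>\<theta>\<close>, so invariance
  comes from \<open>t \<mapsto> - t\<close> on the fibres.\<close>

lemma nn_integral_reflection:
  fixes g :: "'a::euclidean_space \<Rightarrow> ennreal"
  assumes \<theta>: "norm \<theta> = 1" and g [measurable]: "g \<in> borel_measurable borel"
  shows "(\<integral>\<^sup>+v. g (reflection \<theta> v) \<partial>lborel) = (\<integral>\<^sup>+v. g v \<partial>lborel)"
proof -
  have "(\<integral>\<^sup>+t. g (reflection \<theta> (x - (x \<bullet> \<theta>) *\<^sub>R \<theta> + t *\<^sub>R \<theta>)) \<partial>lborel) = (\<integral>\<^sup>+t. g (x - (x \<bullet> \<theta>) *\<^sub>R \<theta> + t *\<^sub>R \<theta>) \<partial>lborel)" for x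
  proof -
    have "(\<integral>\<^sup>+t. g (x - (x \<bullet> \<theta>) *\<^sub>R \<theta> + t *\<^sub>R \<theta>) \<partial>lborel) = (\<integral>\<^sup>+t. g (x - (x \<bullet> \<theta>) *\<^sub>R \<theta> + t *\<^sub>R \<theta>) \<partial>distr lborel borel uminus)"
      by (simp add: lborel_distr_uminus)
    also have "\<dots> = (\<integral>\<^sup>+t. g (x - (x \<bullet> \<theta>) *\<^sub>R \<theta> + (- t) *\<^sub>R \<theta>) \<partial>lborel)" by (subst nn_integral_distr) auto
    finally show ?thesis by (simp add: reflection_orthogonal_part[OF \<theta>])
  qed
  then show ?thesis
    by (subst (1 2) nn_integral_along_direction[OF \<theta>]) simp_all
qed

lemma measure_reflection:
  fixes E :: "'a::euclidean_space set"
  assumes \<theta>: "norm \<theta> = 1" and E [measurable]: "E \<in> sets borel"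
  shows "measure lborel (reflection \<theta> ` E) = measure lborel E"
proof -
  have eq: "reflection \<theta> ` E = reflection \<theta> -` E"
  proof (intro equalityI subsetI)
    fix x assume "x \<in> reflection \<theta> -` E"
    then show "x \<in> reflection \<theta> ` E" by (intro image_eqI[of _ _ "reflection \<theta> x"]) (simp_all add: reflection_reflection[OF \<theta>])
  qed (auto simp: reflection_reflection[OF \<theta>])
  have m: "reflection \<theta> -` E \<in> sets borel" using measurable_sets[OF reflection_measurable E, of \<theta>] by simp
  have "emeasure lborel (reflection \<theta> -` E) = (\<integral>\<^sup>+v. indicator (reflection \<theta> -` E) v \<partial>lborel)" using m by simp
  also have "\<dots> = (\<integral>\<^sup>+v. indicator E (reflection \<theta> v) \<partial>lborel)" by (simp add: indicator_vimage)
  also have "\<dots> = (\<integral>\<^sup>+v. indicator E v \<partial>lborel)" by (rule nn_integral_reflection[OF \<theta>]) simp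
  finally show ?thesis using eq by (simp add: measure_def)
qed

text \<open>The support function, at \<open>x\<close>, of the Minkowski average of the segments
  \<open>[-v, v]\<close> over the unit ball. By symmetry it is a multiple of the norm, so replacing
  the integral by a finite sum produces zonotopes that are nearly balls.\<close>

definition ball_width :: "'a::euclidean_space \<Rightarrow> ennreal" where
  "ball_width x = (\<integral>\<^sup>+v. ennreal \<bar>v \<bullet> x\<bar> * indicator (ball 0 1) v \<partial>lborel)"

lemma ball_width_reflection:
  assumes "norm \<theta> = 1"
  shows "ball_width (reflection \<theta> x) = ball_width x"
proof -
  have [measurable]: "ball (0::'a) 1 \<in> sets borel" by simp
  have "ball_width (reflection \<theta> x) = (\<integral>\<^sup>+v. ennreal \<bar>reflection \<theta> v \<bullet> x\<bar> * indicator (ball 0 1) (reflection \<theta> v) \<partial>lborel)"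
    unfolding ball_width_def using norm_reflection[OF assms] by (simp add: inner_reflection indicator_def)
  also have "\<dots> = ball_width x"
    unfolding ball_width_def by (rule nn_integral_reflection[OF assms]) measurable
  finally show ?thesis .
qed

text \<open>Two distinct vectors of equal norm are exchanged by the reflection in the hyperplane
  bisecting them; no other rotations are needed.\<close>

lemma ball_width_cong_norm:
  fixes x y :: "'a::euclidean_space"
  assumes "norm x = norm y"
  shows "ball_width x = ball_width y"
proof (cases "x = y")
  case False
  define \<theta> where "\<theta> = (x - y) /\<^sub>R norm (x - y)"
  have \<theta>: "norm \<theta> = 1" using False by (simp add: \<theta>_def)
  have "x \<bullet> x = y \<bullet> y" using assms by (simp add: norm_eq)
  then have "2 * (x \<bullet> (x - y)) = (norm (x - y))^2" by (simp add: power2_norm_eq_inner inner_diff_left inner_diff_right inner_commute)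
  moreover have "x \<bullet> \<theta> = (x \<bullet> (x - y)) / norm (x - y)" unfolding \<theta>_def inner_scaleR_right by (simp only: divide_inverse mult.commute)
  ultimately have "2 * (x \<bullet> \<theta>) = norm (x - y)" using False by (simp add: power2_eq_square)
  then have "(2 * (x \<bullet> \<theta>)) *\<^sub>R \<theta> = x - y" using False by (simp add: \<theta>_def)
  then have "reflection \<theta> x = y" by (simp add: reflection_def)
  then show ?thesis using ball_width_reflection[OF \<theta>, of x] by simp
qed simp

lemma ball_width_eq_norm:
  obtains \<kappa> :: real where "\<kappa> > 0" "\<And>x :: 'a::euclidean_space. ball_width x = ennreal (\<kappa> * norm x)"
proof -
  have [measurable]: "ball (0::'a) 1 \<in> sets borel" by simp
  obtain e :: 'a where e: "e \<in> Basis" using nonempty_Basis by blast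
  then have ne: "norm e = 1" by simp
  have "ball_width e \<le> (\<integral>\<^sup>+v. indicator (ball 0 1) v \<partial>(lborel :: 'a measure))"
    unfolding ball_width_def
  proof (intro nn_integral_mono)
    fix v :: 'a
    have "\<bar>v \<bullet> e\<bar> \<le> norm v" using Cauchy_Schwarz_ineq2[of v e] ne by simp
    then show "ennreal \<bar>v \<bullet> e\<bar> * indicator (ball 0 1) v \<le> indicator (ball 0 1) v"
      by (auto simp: indicator_def)
  qed
  also have "\<dots> < \<infinity>" using emeasure_lborel_ball_finite[of "0::'a" 1] by simp
  finally have fin: "ball_width e < \<infinity>" .
  have pos: "ball_width e \<noteq> 0"
  proof
    \<comment> \<open>If the width vanished at \<open>e\<close>, it would vanish at every basis
      vector. Almost every point of the ball would then have all coordinates 0, although the ball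
      has positive measure.\<close>
    assume z: "ball_width e = 0"
    have AE0: "AE v in lborel. ennreal \<bar>v \<bullet> b\<bar> * indicator (ball (0::'a) 1) v = 0" if "b \<in> Basis" for b
    proof -
      have "ball_width b = 0" using ball_width_cong_norm[of b e] that ne z by simp
      then show ?thesis unfolding ball_width_def by (subst (asm) nn_integral_0_iff_AE) auto
    qed
    have "AE v in lborel. \<forall>b\<in>Basis. ennreal \<bar>v \<bullet> b\<bar> * indicator (ball (0::'a) 1) v = 0"
      using AE0 by (subst AE_finite_all[OF finite_Basis]) blast
    moreover have "AE v in lborel. v \<noteq> (0::'a)" by (rule AE_lborel_singleton)
    ultimately have "AE v in lborel. v \<notin> ball (0::'a) 1"
    proof eventually_elim
      case (elim v)
      then show ?case using euclidean_eq_iff[of v 0] by (auto simp: indicator_def split: if_splits)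
    qed
    then have "emeasure lborel (ball (0::'a) 1) = 0" by (subst (asm) AE_iff_measurable[of "ball 0 1"]) auto
    then show False using unit_ball_vol_pos[of "real DIM('a)"] by (simp add: emeasure_ball)
  qed
  define \<kappa> where "\<kappa> = enn2real (ball_width e)"
  have \<kappa>: "\<kappa> > 0" "ball_width e = ennreal \<kappa>" using fin pos by (auto simp: \<kappa>_def enn2real_positive_iff zero_less_iff_neq_zero)
  have "ball_width x = ennreal (\<kappa> * norm x)" for x :: 'a
  proof -
    have "ball_width x = ball_width (norm x *\<^sub>R e)" by (rule ball_width_cong_norm) (simp add: ne)
    also have "\<dots> = (\<integral>\<^sup>+v. ennreal (norm x) * (ennreal \<bar>v \<bullet> e\<bar> * indicator (ball 0 1) v) \<partial>lborel)"
      unfolding ball_width_def by (intro nn_integral_cong) (simp add: abs_mult ennreal_mult mult.assoc)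
    also have "\<dots> = ennreal (norm x) * ball_width e" unfolding ball_width_def by (intro nn_integral_cmult) measurable
    finally show ?thesis using \<kappa> by (simp add: ennreal_mult[symmetric] mult.commute)
  qed
  then show ?thesis using \<kappa>(1) that by blast
qed

section \<open>Support functions of zonotopes\<close>

lemma zonotope_support_le: "z \<in> zonotope ws \<Longrightarrow> z \<bullet> x \<le> (\<Sum>w\<leftarrow>ws. \<bar>w \<bullet> x\<bar>)"
proof (induction ws arbitrary: z)
  case (Cons w ws)
  then obtain s y where sy: "s \<in> {-1..1}" "y \<in> zonotope ws" "z = s *\<^sub>R w + y"
    by (auto simp: seg_def elim!: set_plus_elim)
  have "s * (w \<bullet> x) \<le> \<bar>s\<bar> * \<bar>w \<bullet> x\<bar>" by (metis abs_ge_self abs_mult)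
  also have "\<dots> \<le> 1 * \<bar>w \<bullet> x\<bar>" using sy(1) by (intro mult_right_mono) auto
  finally show ?case using Cons.IH[OF sy(2)] sy(3) by (simp add: inner_add_left)
qed simp

lemma zonotope_support_attained: "\<exists>z\<in>zonotope ws. z \<bullet> x = (\<Sum>w\<leftarrow>ws. \<bar>w \<bullet> x\<bar>)"
proof (induction ws)
  case (Cons w ws)
  then obtain y where y: "y \<in> zonotope ws" "y \<bullet> x = (\<Sum>w\<leftarrow>ws. \<bar>w \<bullet> x\<bar>)" by blast
  have "sgn (w \<bullet> x) *\<^sub>R w \<in> seg w" unfolding seg_def by (rule imageI) (auto simp: sgn_if)
  then have "sgn (w \<bullet> x) *\<^sub>R w + y \<in> zonotope (w # ws)" using y(1) by (auto intro: set_plus_intro)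
  moreover have "(sgn (w \<bullet> x) *\<^sub>R w + y) \<bullet> x = (\<Sum>w\<leftarrow>w # ws. \<bar>w \<bullet> x\<bar>)"
    using y(2) by (simp add: inner_add_left sgn_if abs_if)
  ultimately show ?case by blast
qed simp

text \<open>Inclusion of convex bodies is comparison of support functions. For the inner ball a
  separating hyperplane would contradict the lower bound; for the outer one each \<open>z\<close> is
  tested in its own direction.\<close>

lemma zonotope_between_balls:
  assumes lo: "\<And>x. norm x \<le> (\<Sum>w\<leftarrow>ws. \<bar>w \<bullet> x\<bar>)" and hi: "\<And>x. (\<Sum>w\<leftarrow>ws. \<bar>w \<bullet> x\<bar>) \<le> b * norm x"
  shows "cball 0 1 \<subseteq> zonotope ws" "zonotope ws \<subseteq> cball 0 b"
proof -
  show "cball 0 1 \<subseteq> zonotope ws"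
  proof
    fix p :: 'a assume p: "p \<in> cball 0 1"
    show "p \<in> zonotope ws"
    proof (rule ccontr)
      assume "p \<notin> zonotope ws"
      then obtain a c where ac: "a \<bullet> p < c" "\<And>x. x \<in> zonotope ws \<Longrightarrow> a \<bullet> x > c"
        using separating_hyperplane_closed_point[of "zonotope ws" p] convex_body_zonotope[of ws] compact_imp_closed
        unfolding convex_body_def by metis
      obtain z where z: "z \<in> zonotope ws" "z \<bullet> (- a) = (\<Sum>w\<leftarrow>ws. \<bar>w \<bullet> (- a)\<bar>)" using zonotope_support_attained by blast
      have "norm a \<le> z \<bullet> (- a)" using lo[of "- a"] z(2) by simp
      also have "\<dots> < - c" using ac(2)[OF z(1)] by (simp add: inner_commute)
      also have "\<dots> < - (a \<bullet> p)" using ac(1) by simp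
      also have "\<dots> \<le> norm a * norm p" using Cauchy_Schwarz_ineq2[of a p] by linarith
      also have "\<dots> \<le> norm a" using p mult_left_mono[of "norm p" 1 "norm a"] by simp
      finally show False by simp
    qed
  qed
  show "zonotope ws \<subseteq> cball 0 b"
  proof
    fix z assume z: "z \<in> zonotope ws"
    have "norm z * norm z \<le> b * norm z" 
      using zonotope_support_le[OF z, of z] hi[of z] by (simp add: power2_norm_eq_inner[symmetric] power2_eq_square)
    moreover have "0 \<le> b"
    proof -
      obtain e :: 'a where "e \<in> Basis" using nonempty_Basis by blast
      then show ?thesis using order_trans[OF lo[of e] hi[of e]] by simp
    qed
    ultimately have "norm z \<le> b" by (cases "norm z = 0") (simp_all add: mult_le_cancel_right)
    then show "z \<in> cball 0 b" by simp
  qed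
qed

lemma finite_range_rounding:
  assumes "\<delta> > 0"
  obtains q :: "'a::euclidean_space \<Rightarrow> 'a" where "q \<in> borel_measurable borel" "finite (q ` ball 0 1)" "\<And>v. norm (q v - v) \<le> \<delta>"
proof -
  \<comment> \<open>Rounding down to the grid of mesh \<open>1 / k\<close> costs at most
    \<open>1 / k\<close> per coordinate, hence at most the dimension divided by \<open>k\<close> in
    norm.\<close>
  obtain k :: nat where k: "real DIM('a) / \<delta> < real k" using reals_Archimedean2 by blast
  moreover have "0 < real DIM('a) / \<delta>" using assms by simp
  ultimately have k0: "real k > 0" by linarith
  have k1: "real DIM('a) / real k \<le> \<delta>" using k k0 assms by (simp add: field_simps)
  define q :: "'a \<Rightarrow> 'a" where "q v = (\<Sum>b\<in>Basis. (real_of_int \<lfloor>real k * (v \<bullet> b)\<rfloor> / real k) *\<^sub>R b)" for v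
  have [measurable]: "q \<in> borel_measurable borel" unfolding q_def[abs_def] by measurable
  have "q ` ball 0 1 \<subseteq> (\<lambda>g. \<Sum>b\<in>Basis. (real_of_int (g b) / real k) *\<^sub>R b) ` (PiE Basis (\<lambda>_. {- int k - 1..int k}))"
  proof
    fix y assume "y \<in> q ` ball 0 1"
    then obtain v where v: "norm v < 1" "y = q v" by auto
    have "\<lfloor>real k * (v \<bullet> b)\<rfloor> \<in> {- int k - 1..int k}" if b: "b \<in> Basis" for b
    proof -
      have "\<bar>v \<bullet> b\<bar> \<le> 1" using Basis_le_norm[OF b, of v] v(1) by linarith
      then have "\<bar>real k * (v \<bullet> b)\<bar> \<le> real k" using mult_left_mono[of "\<bar>v \<bullet> b\<bar>" 1 "real k"] by (simp add: abs_mult)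
      then have "- real k \<le> real k * (v \<bullet> b)" "real k * (v \<bullet> b) \<le> real k" by linarith+
      then show ?thesis by (simp add: le_floor_iff floor_le_iff)
    qed
    then show "y \<in> (\<lambda>g. \<Sum>b\<in>Basis. (real_of_int (g b) / real k) *\<^sub>R b) ` (PiE Basis (\<lambda>_. {- int k - 1..int k}))"
      unfolding v(2) q_def by (intro image_eqI[of _ _ "\<lambda>b\<in>Basis. \<lfloor>real k * (v \<bullet> b)\<rfloor>"]) auto
  qed
  then have "finite (q ` ball 0 1)" by (rule finite_subset) (intro finite_imageI finite_PiE, auto)
  moreover have "norm (q v - v) \<le> \<delta>" for v
  proof -
    have "norm (q v - v) \<le> (\<Sum>b\<in>Basis. \<bar>(q v - v) \<bullet> b\<bar>)" by (rule norm_le_l1)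
    also have "\<dots> \<le> (\<Sum>b\<in>(Basis::'a set). 1 / real k)"
    proof (rule sum_mono)
      fix b :: 'a assume b: "b \<in> Basis"
      have qb: "q v \<bullet> b = real_of_int \<lfloor>real k * (v \<bullet> b)\<rfloor> / real k"
        unfolding q_def using b by (simp add: inner_sum_left inner_Basis if_distrib sum.delta cong: if_cong)
      have fl: "\<bar>real_of_int \<lfloor>real k * (v \<bullet> b)\<rfloor> - real k * (v \<bullet> b)\<bar> \<le> 1" by linarith
      have "(q v - v) \<bullet> b = (real_of_int \<lfloor>real k * (v \<bullet> b)\<rfloor> - real k * (v \<bullet> b)) / real k"
        using k0 by (simp add: inner_diff_left qb diff_divide_distrib)
      then show "\<bar>(q v - v) \<bullet> b\<bar> \<le> 1 / real k" using fl k0 by (simp add: divide_right_mono)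
    qed
    also have "\<dots> \<le> \<delta>" using k1 by simp
    finally show ?thesis .
  qed
  ultimately show ?thesis using that[of q] by auto
qed

section \<open>The Steiner formula\<close>

text \<open>Rounding the ball to finitely many vectors by \<open>q\<close> changes
  \<open>|v \<bullet> x|\<close> by at most \<open>\<delta> |x|\<close>. The integrated error is
  thus a small multiple of \<open>|x|\<close>, of the same form as the support function
  \<open>\<kappa> |x|\<close>, and the bounds are uniform in the direction.\<close>

lemma zonotope_approximates_ball:
  assumes "\<epsilon> > 0"
  shows "\<exists>ws :: 'a::euclidean_space list. cball 0 1 \<subseteq> zonotope ws \<and> zonotope ws \<subseteq> cball 0 (1 + \<epsilon>)"
proof -
  obtain \<kappa> :: real where \<kappa>: "\<kappa> > 0" "\<And>x :: 'a. ball_width x = ennreal (\<kappa> * norm x)" using ball_width_eq_norm by blast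
  let ?B = "ball (0::'a) 1"
  have [measurable]: "?B \<in> sets borel" by simp
  define \<omega> where "\<omega> = measure lborel ?B"
  have \<omega>: "\<omega> > 0" by (simp add: \<omega>_def content_ball_pos)
  have em\<omega>: "emeasure lborel ?B = ennreal \<omega>" unfolding \<omega>_def by (rule finite_measure_subset_ball[of _ 1]) simp
  \<comment> \<open>The solution of \<open>(1 + \<eta>) / (1 - \<eta>) = 1 + \<epsilon>\<close>, the
    ratio of the outer to the inner radius at relative error \<open>\<eta>\<close>.\<close>
  define \<eta> where "\<eta> = \<epsilon> / (2 + \<epsilon>)"
  have \<eta>: "0 < \<eta>" "\<eta> < 1" "(1 + \<eta>) / (1 - \<eta>) = 1 + \<epsilon>" using assms by (auto simp: \<eta>_def field_simps)
  \<comment> \<open>Integrated over a ball of volume \<open>\<omega>\<close>, the pointwise error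
    \<open>\<delta> |x|\<close> becomes \<open>\<kappa> \<eta> |x|\<close>.\<close>
  define \<delta> where "\<delta> = \<kappa> * \<eta> / \<omega>"
  have \<delta>: "\<delta> > 0" "\<delta> * \<omega> = \<kappa> * \<eta>" using \<kappa>(1) \<eta> \<omega> by (auto simp: \<delta>_def)
  obtain q :: "'a \<Rightarrow> 'a" where q: "q \<in> borel_measurable borel" "finite (q ` ?B)" "\<And>v. norm (q v - v) \<le> \<delta>"
    using finite_range_rounding[OF \<delta>(1)] by blast
  note [measurable] = q(1)
  define P where "P u = {v \<in> ?B. q v = u}" for u
  have P [measurable]: "P u \<in> sets borel" for u
  proof -
    have "{v \<in> space borel. v \<in> ?B \<and> q v = u} \<in> sets borel" by measurable
    then show ?thesis by (simp add: P_def)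
  qed
  have emP: "emeasure lborel (P u) = ennreal (measure lborel (P u))" for u
    by (rule finite_measure_subset_ball[of _ 1]) (auto simp: P_def)
  \<comment> \<open>The integral of \<open>|q v \<bullet> x|\<close> over the ball, which is a
    finite sum because \<open>q\<close> has finite range there: the support function of the zonotope
    with generators \<open>u\<close> weighted by the volume of \<open>P u\<close>.\<close>
  define S where "S x = (\<Sum>u\<in>q ` ?B. measure lborel (P u) * \<bar>u \<bullet> x\<bar>)" for x
  have S: "ennreal (S x) = (\<integral>\<^sup>+v. ennreal \<bar>q v \<bullet> x\<bar> * indicator ?B v \<partial>lborel)" for x
  proof -
    have "(\<integral>\<^sup>+v. ennreal \<bar>q v \<bullet> x\<bar> * indicator ?B v \<partial>lborel) = (\<integral>\<^sup>+v. (\<Sum>u\<in>q ` ?B. ennreal \<bar>u \<bullet> x\<bar> * indicator (P u) v) \<partial>lborel)"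
    proof (rule nn_integral_cong)
      fix v
      show "ennreal \<bar>q v \<bullet> x\<bar> * indicator ?B v = (\<Sum>u\<in>q ` ?B. ennreal \<bar>u \<bullet> x\<bar> * indicator (P u) v)"
      proof (cases "v \<in> ?B")
        case True
        have "(\<Sum>u\<in>q ` ?B. ennreal \<bar>u \<bullet> x\<bar> * indicator (P u) v) = (\<Sum>u\<in>q ` ?B. if u = q v then ennreal \<bar>u \<bullet> x\<bar> else 0)"
          using True by (intro sum.cong) (auto simp: P_def indicator_def)
        then show ?thesis using True q(2) by (simp add: sum.delta)
      next
        case False
        then show ?thesis by (simp add: P_def)
      qed
    qed
    also have "\<dots> = (\<Sum>u\<in>q ` ?B. ennreal \<bar>u \<bullet> x\<bar> * emeasure lborel (P u))"
      by (subst nn_integral_sum) (auto simp: nn_integral_cmult_indicator)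
    also have "\<dots> = (\<Sum>u\<in>q ` ?B. ennreal (measure lborel (P u) * \<bar>u \<bullet> x\<bar>))"
      by (simp add: emP ennreal_mult mult.commute)
    finally show ?thesis by (simp add: S_def sum_ennreal)
  qed
  have close: "\<bar>\<bar>q v \<bullet> x\<bar> - \<bar>v \<bullet> x\<bar>\<bar> \<le> \<delta> * norm x" for v x
  proof -
    have "\<bar>\<bar>q v \<bullet> x\<bar> - \<bar>v \<bullet> x\<bar>\<bar> \<le> \<bar>(q v - v) \<bullet> x\<bar>" by (simp add: inner_diff_left)
    also have "\<dots> \<le> norm (q v - v) * norm x" by (rule Cauchy_Schwarz_ineq2)
    also have "\<dots> \<le> \<delta> * norm x" using q(3) by (rule mult_right_mono) simp
    finally show ?thesis .
  qed
  have cmp: "(\<integral>\<^sup>+v. ennreal (f v) * indicator ?B v \<partial>lborel) \<le> (\<integral>\<^sup>+v. ennreal (g v) * indicator ?B v \<partial>lborel) + ennreal (\<delta> * norm x) * ennreal \<omega>"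
    if "\<And>v. f v \<le> g v + \<delta> * norm x" "\<And>v. g v \<ge> 0" and [measurable]: "g \<in> borel_measurable borel" for f g and x :: 'a
  proof -
    have "(\<integral>\<^sup>+v. ennreal (f v) * indicator ?B v \<partial>lborel) \<le> (\<integral>\<^sup>+v. ennreal (g v) * indicator ?B v + ennreal (\<delta> * norm x) * indicator ?B v \<partial>lborel)"
    proof (rule nn_integral_mono)
      fix v
      have "ennreal (f v) \<le> ennreal (g v) + ennreal (\<delta> * norm x)"
        using that(1)[of v] that(2)[of v] \<delta>(1) by (simp add: ennreal_plus[symmetric] ennreal_leI del: ennreal_plus)
      then show "ennreal (f v) * indicator ?B v \<le> ennreal (g v) * indicator ?B v + ennreal (\<delta> * norm x) * indicator ?B v"
        by (auto simp: indicator_def)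
    qed
    also have "\<dots> = (\<integral>\<^sup>+v. ennreal (g v) * indicator ?B v \<partial>lborel) + ennreal (\<delta> * norm x) * ennreal \<omega>"
      by (subst nn_integral_add) (auto simp: nn_integral_cmult_indicator em\<omega>)
    finally show ?thesis .
  qed
  have dn: "ennreal (\<delta> * norm x) * ennreal \<omega> = ennreal (\<kappa> * \<eta> * norm x)" for x :: 'a
  proof -
    have "\<delta> * norm x * \<omega> = (\<delta> * \<omega>) * norm x" by simp
    then have e: "\<delta> * norm x * \<omega> = \<kappa> * \<eta> * norm x" unfolding \<delta>(2) .
    have "ennreal (\<delta> * norm x) * ennreal \<omega> = ennreal (\<delta> * norm x * \<omega>)"
      using \<delta>(1) \<omega> by (intro ennreal_mult[symmetric]) auto
    then show ?thesis unfolding e .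
  qed
  have S0: "S x \<ge> 0" for x unfolding S_def by (intro sum_nonneg) auto
  have hi: "S x \<le> \<kappa> * (1 + \<eta>) * norm x" for x
  proof -
    have "ennreal (S x) \<le> ennreal (\<kappa> * norm x) + ennreal (\<kappa> * \<eta> * norm x)"
      unfolding S dn[symmetric] \<kappa>(2)[symmetric] ball_width_def
    proof (rule cmp)
      show "\<bar>q v \<bullet> x\<bar> \<le> \<bar>v \<bullet> x\<bar> + \<delta> * norm x" for v using close[of v x] by linarith
    qed auto
    also have "\<dots> = ennreal (\<kappa> * norm x + \<kappa> * \<eta> * norm x)" using \<kappa>(1) \<eta> by (subst ennreal_plus) auto
    finally show ?thesis using \<kappa>(1) \<eta> by (subst (asm) ennreal_le_iff) (auto simp: algebra_simps)
  qed
  have lo: "\<kappa> * (1 - \<eta>) * norm x \<le> S x" for x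
  proof -
    have "ennreal (\<kappa> * norm x) \<le> ennreal (S x) + ennreal (\<kappa> * \<eta> * norm x)"
      unfolding S dn[symmetric] \<kappa>(2)[symmetric] ball_width_def
    proof (rule cmp)
      show "\<bar>v \<bullet> x\<bar> \<le> \<bar>q v \<bullet> x\<bar> + \<delta> * norm x" for v using close[of v x] by linarith
    qed auto
    also have "\<dots> = ennreal (S x + \<kappa> * \<eta> * norm x)" using \<kappa>(1) \<eta> S0 by (subst ennreal_plus) auto
    finally show ?thesis using \<kappa>(1) \<eta> S0[of x] by (subst (asm) ennreal_le_iff) (auto simp: algebra_simps)
  qed
  obtain us where us: "set us = q ` ?B" "distinct us" using finite_distinct_list[OF q(2)] by blast
  \<comment> \<open>Scales the lower bound \<open>\<kappa> (1 - \<eta>) |x|\<close> to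
    \<open>|x|\<close>, so that the unit ball fits inside.\<close>
  define s where "s = 1 / (\<kappa> * (1 - \<eta>))"
  have s: "s > 0" using \<kappa>(1) \<eta> by (simp add: s_def)
  define ws where "ws = map (\<lambda>u. (s * measure lborel (P u)) *\<^sub>R u) us"
  have sum: "(\<Sum>w\<leftarrow>ws. \<bar>w \<bullet> x\<bar>) = s * S x" for x
  proof -
    have "(\<Sum>w\<leftarrow>ws. \<bar>w \<bullet> x\<bar>) = (\<Sum>u\<leftarrow>us. s * (measure lborel (P u) * \<bar>u \<bullet> x\<bar>))"
      using s by (simp add: ws_def o_def abs_mult mult.assoc)
    also have "\<dots> = (\<Sum>u\<in>q ` ?B. s * (measure lborel (P u) * \<bar>u \<bullet> x\<bar>))"
      using sum_list_distinct_conv_sum_set[OF us(2)] us(1) by simp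
    finally show ?thesis by (simp add: S_def sum_distrib_left)
  qed
  have "norm x \<le> (\<Sum>w\<leftarrow>ws. \<bar>w \<bullet> x\<bar>)" for x
  proof -
    have "norm x = s * (\<kappa> * (1 - \<eta>) * norm x)" using \<kappa>(1) \<eta> by (simp add: s_def)
    also have "\<dots> \<le> s * S x" using lo s by (intro mult_left_mono) auto
    finally show ?thesis by (simp add: sum)
  qed
  moreover have "(\<Sum>w\<leftarrow>ws. \<bar>w \<bullet> x\<bar>) \<le> (1 + \<epsilon>) * norm x" for x
  proof -
    have "s * S x \<le> s * (\<kappa> * (1 + \<eta>) * norm x)" using hi s by (intro mult_left_mono) auto
    also have "\<dots> = (1 + \<eta>) / (1 - \<eta>) * norm x" using \<kappa>(1) by (simp add: s_def)
    finally show ?thesis unfolding sum \<eta>(3) .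
  qed
  ultimately show ?thesis using zonotope_between_balls[of ws "1 + \<epsilon>"] by blast
qed

lemma zonotope_scale: "zonotope (map ((*\<^sub>R) r) ws) = (*\<^sub>R) r ` zonotope ws"
proof (induction ws)
  case (Cons w ws)
  have "seg (r *\<^sub>R w) = (*\<^sub>R) r ` seg w" by (auto simp: seg_def image_image mult.commute)
  moreover have "(*\<^sub>R) r ` A + (*\<^sub>R) r ` B = (*\<^sub>R) r ` (A + B)" for A B :: "'a set"
    by (auto simp: set_plus_def image_iff scaleR_right_distrib) (metis scaleR_right_distrib)+
  ultimately show ?case using Cons.IH by simp
qed simp

text \<open>Lagrange interpolation at the nodes \<open>1, ..., n + 1\<close>: the coefficients of a
  polynomial of degree at most \<open>n\<close> are fixed linear combinations of its values there,
  so they converge whenever the values do. The nodes are positive because volumes of parallel bodies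
  are considered at positive radii.\<close>

lemma interpolation_coefficients:
  "\<exists>L :: nat \<Rightarrow> nat \<Rightarrow> real. \<forall>a. \<forall>j\<le>n. (\<Sum>i\<le>n. L j i * (\<Sum>k\<le>n. a k * real (Suc i) ^ k)) = a j"
proof -
  define l :: "nat \<Rightarrow> real poly" where
    "l i = (\<Prod>k\<in>{..n} - {i}. smult (1 / (real i - real k)) [:- real (Suc k), 1:])" for i
  have deg_l: "degree (l i) \<le> n" if "i \<le> n" for i
  proof -
    have "degree (l i) \<le> sum (degree \<circ> (\<lambda>k. smult (1 / (real i - real k)) [:- real (Suc k), 1:])) ({..n} - {i})"
      unfolding l_def by (rule degree_prod_sum_le) simp
    also have "\<dots> \<le> (\<Sum>k\<in>{..n} - {i}. 1)" by (intro sum_mono) auto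
    also have "\<dots> = n" using that by simp
    finally show ?thesis .
  qed
  have eval_l: "poly (l i) (real (Suc m)) = (if m = i then 1 else 0)" if "i \<le> n" "m \<le> n" for i m
  proof (cases "m = i")
    case True
    have "poly (l i) (real (Suc m)) = (\<Prod>k\<in>{..n} - {i}. 1)"
      unfolding l_def poly_prod by (intro prod.cong) (auto simp: True add_divide_distrib[symmetric])
    then show ?thesis using True by simp
  next
    case False
    then have "m \<in> {..n} - {i}" using that by simp
    then have "poly (l i) (real (Suc m)) = 0"
      unfolding l_def poly_prod by (intro prod_zero) (auto intro!: bexI[of _ m] simp: add_divide_distrib[symmetric])
    then show ?thesis using False by simp
  qed
  have "(\<Sum>i\<le>n. coeff (l i) j * (\<Sum>k\<le>n. a k * real (Suc i) ^ k)) = a j" if j: "j \<le> n" for a j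
  proof -
    define p where "p = (\<Sum>k\<le>n. monom (a k) k)"
    have pe: "poly p x = (\<Sum>k\<le>n. a k * x ^ k)" for x by (simp add: p_def poly_sum poly_monom)
    have degp: "degree p \<le> n" unfolding p_def by (intro degree_sum_le) (auto intro: order_trans[OF degree_monom_le])
    define r where "r = (\<Sum>i\<le>n. smult (poly p (real (Suc i))) (l i))"
    have degr: "degree r \<le> n" unfolding r_def using deg_l by (intro degree_sum_le) (auto intro: order_trans[OF degree_smult_le])
    have "p = r"
    proof (rule poly_eqI_degree[of "(\<lambda>i. real (Suc i)) ` {..n}"])
      fix x assume "x \<in> (\<lambda>i. real (Suc i)) ` {..n}"
      then obtain m where m: "m \<le> n" "x = real (Suc m)" by auto
      have "poly r x = (\<Sum>i\<le>n. if m = i then poly p (real (Suc i)) else 0)"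
        unfolding r_def poly_sum m(2) using m(1) by (intro sum.cong) (auto simp: eval_l simp del: of_nat_Suc)
      also have "\<dots> = poly p x" using m by (simp add: sum.delta)
      finally show "poly p x = poly r x" by simp
    next
      have "card ((\<lambda>i. real (Suc i)) ` {..n}) = Suc n" by (subst card_image) (auto simp: inj_on_def)
      then show "card ((\<lambda>i. real (Suc i)) ` {..n}) > degree p" "card ((\<lambda>i. real (Suc i)) ` {..n}) > degree r"
        using degp degr by auto
    qed
    then have "coeff p j = coeff r j" by (rule arg_cong)
    also have "\<dots> = (\<Sum>i\<le>n. poly p (real (Suc i)) * coeff (l i) j)" unfolding r_def by (simp add: coeff_sum)
    finally have "coeff p j = (\<Sum>i\<le>n. poly p (real (Suc i)) * coeff (l i) j)" .
    moreover have "coeff p j = a j" unfolding p_def using j by (simp add: coeff_sum coeff_monom)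
    ultimately show ?thesis by (simp add: pe mult.commute)
  qed
  then show ?thesis by (intro exI[of _ "\<lambda>j i. coeff (l i) j"]) auto
qed

lemma set_plus_image_linear:
  assumes "linear f"
  shows "f ` A + f ` B = f ` (A + B)"
proof (intro equalityI subsetI)
  fix x assume "x \<in> f ` A + f ` B"
  then obtain a b where "a \<in> A" "b \<in> B" "x = f a + f b" by (auto elim!: set_plus_elim)
  then show "x \<in> f ` (A + B)" by (intro image_eqI[of _ _ "a + b"]) (auto simp: linear_add[OF assms])
next
  fix x assume "x \<in> f ` (A + B)"
  then obtain a b where "a \<in> A" "b \<in> B" "x = f (a + b)" by (auto elim!: set_plus_elim)
  then show "x \<in> f ` A + f ` B" by (auto simp: linear_add[OF assms])
qed

section \<open>Parallel bodies and their coefficients\<close>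

lemma outer_parallel_eq: "\<epsilon> > 0 \<Longrightarrow> outer_parallel K \<epsilon> = K + cball 0 \<epsilon>"
proof (intro equalityI subsetI)
  fix x assume "\<epsilon> > 0" "x \<in> outer_parallel K \<epsilon>"
  then obtain y b where "y \<in> K" "norm b \<le> 1" "x = y + \<epsilon> *\<^sub>R b" by (auto simp: outer_parallel_def)
  then show "x \<in> K + cball 0 \<epsilon>" using \<open>\<epsilon> > 0\<close> by (auto intro!: set_plus_intro simp: mult_left_le)
next
  fix x assume e: "\<epsilon> > 0" "x \<in> K + cball 0 \<epsilon>"
  then obtain y z where yz: "y \<in> K" "norm z \<le> \<epsilon>" "x = y + z" by (auto elim!: set_plus_elim)
  have "norm (z /\<^sub>R \<epsilon>) \<le> 1" using yz(2) e(1) by (simp add: field_simps)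
  moreover have "x = y + \<epsilon> *\<^sub>R (z /\<^sub>R \<epsilon>)" using yz(3) e(1) by simp
  ultimately show "x \<in> outer_parallel K \<epsilon>" unfolding outer_parallel_def using yz(1) by fastforce
qed

lemma convex_body_cball: "r \<ge> 0 \<Longrightarrow> convex_body (cball (a::'a::euclidean_space) r)"
  by (simp add: convex_body_def)

lemma mem_parallel_body_iff:
  assumes "convex_body K"
  shows "x \<in> K + cball 0 r \<longleftrightarrow> infdist x K \<le> r"
proof
  have K: "closed K" "K \<noteq> {}" using assms by (auto simp: convex_body_def compact_imp_closed)
  show "infdist x K \<le> r" if h: "x \<in> K + cball 0 r"
  proof -
    obtain y z where "y \<in> K" "z \<in> cball 0 r" "x = y + z" by (rule set_plus_elim[OF h])
    then show ?thesis using infdist_le[of y K x] by (simp add: dist_norm)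
  qed
  show "x \<in> K + cball 0 r" if "infdist x K \<le> r"
  proof -
    obtain y where y: "y \<in> K" "infdist x K = dist x y" using infdist_attains_inf[OF K] by blast
    then have "y + (x - y) \<in> K + cball 0 r" using that by (intro set_plus_intro) (auto simp: dist_norm norm_minus_commute)
    then show ?thesis by simp
  qed
qed

lemma measure_convex_body_mono: "convex_body K \<Longrightarrow> convex_body L \<Longrightarrow> K \<subseteq> L \<Longrightarrow> measure lborel K \<le> measure lborel L"
  using emeasure_mono[of K L lborel] body_borel[of L] by (simp add: emeasure_body ennreal_le_iff)

text \<open>The upper side of the squeeze: adding \<open>r\<close> times a zonotope between the
  balls of radius 1 and \<open>1 + 1 / (k + 1)\<close> gives at least \<open>K + cball 0 r\<close>
  and at most the bodies considered here. The latter decrease to \<open>K + cball 0 r\<close>, since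
  membership is the closed condition \<open>infdist x K \<le> r\<close>.\<close>

lemma measure_parallel_right_continuous:
  fixes K :: "'a::euclidean_space set"
  assumes K: "convex_body K" and r: "r > 0"
  shows "(\<lambda>k. measure lborel (K + cball 0 (r * (1 + 1 / real (Suc k))))) \<longlonglongrightarrow> measure lborel (K + cball 0 r)"
proof -
  let ?r = "\<lambda>k. r * (1 + 1 / real (Suc k))"
  have r': "?r k > 0" for k using r by (simp add: add_pos_pos)
  have body: "convex_body (K + cball 0 (?r k))" for k using r'[of k] by (intro convex_body_plus K convex_body_cball) simp
  have "(\<lambda>k. measure lborel (K + cball 0 (?r k))) \<longlonglongrightarrow> measure lborel (\<Inter>k. K + cball 0 (?r k))"
  proof (rule Lim_measure_decseq)
    show "range (\<lambda>k. K + cball 0 (?r k)) \<subseteq> sets lborel" using body_borel[OF body] by auto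
    show "decseq (\<lambda>k. K + cball 0 (?r k))"
    proof (rule decseq_SucI)
      fix k
      have "?r (Suc k) \<le> ?r k" using r by (intro mult_left_mono add_left_mono divide_left_mono) auto
      then show "K + cball 0 (?r (Suc k)) \<subseteq> K + cball 0 (?r k)" by (intro set_plus_mono2) auto
    qed
    show "emeasure lborel (K + cball 0 (?r k)) \<noteq> \<infinity>" for k using emeasure_body[OF body] by simp
  qed
  moreover have "(\<Inter>k. K + cball 0 (?r k)) = K + cball 0 r"
  proof (intro equalityI subsetI)
    fix x assume "x \<in> (\<Inter>k. K + cball 0 (?r k))"
    then have le: "infdist x K \<le> r * (1 + 1 / real (Suc k))" for k using mem_parallel_body_iff[OF K] by blast
    have "(\<lambda>k. r * (1 + 1 / real (Suc k))) \<longlonglongrightarrow> r * (1 + 0)"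
      by (intro tendsto_intros LIMSEQ_Suc lim_1_over_n)
    then have "infdist x K \<le> r" using le by (intro LIMSEQ_le_const) auto
    then show "x \<in> K + cball 0 r" using mem_parallel_body_iff[OF K] by blast
  next
    fix x assume "x \<in> K + cball 0 r"
    moreover have "r \<le> ?r k" for k using r by (simp add: field_simps)
    then have "cball (0::'a) r \<subseteq> cball 0 (?r k)" for k by (intro subset_cball) blast
    then have "K + cball 0 r \<subseteq> K + cball 0 (?r k)" for k by (intro set_plus_mono2) auto
    ultimately show "x \<in> (\<Inter>k. K + cball 0 (?r k))" by blast
  qed
  ultimately show ?thesis by simp
qed


definition steiner_weight :: "nat \<Rightarrow> nat \<Rightarrow> nat \<Rightarrow> real" where
  "steiner_weight n = (SOME L. \<forall>a. \<forall>j\<le>n. (\<Sum>i\<le>n. L j i * (\<Sum>k\<le>n. a k * real (Suc i) ^ k)) = a j)"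

lemma steiner_weight:
  assumes "j \<le> n"
  shows "(\<Sum>i\<le>n. steiner_weight n j i * (\<Sum>k\<le>n. a k * real (Suc i) ^ k)) = a j"
  using someI_ex[OF interpolation_coefficients[of n]] assms unfolding steiner_weight_def by blast

text \<open>For convex bodies this is the coefficient of \<open>r^j\<close> in the volume of
  \<open>K + cball 0 r\<close>, that is, \<open>V_(n-j)\<close> times the volume of the
  \<open>j\<close>-dimensional unit ball. As a fixed finite combination of volumes it inherits
  reflection invariance and measurability directly, while monotonicity and convexity must come from
  the zonotope limit because the weights have both signs in general.\<close>

definition parallel_coefficient :: "nat \<Rightarrow> 'a::euclidean_space set \<Rightarrow> real" where
  "parallel_coefficient j K = (\<Sum>i\<le>DIM('a). steiner_weight DIM('a) j i * measure lborel (K + cball 0 (real (Suc i))))"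

lemma approximating_coefficients:
  fixes C :: "(real ^ 'm::finite) set"
  assumes C: "compact C" "convex C" "C \<noteq> {}"
  shows "\<exists>c :: nat \<Rightarrow> nat \<Rightarrow> 'a::euclidean_space set \<Rightarrow> real. (\<forall>k j. steiner_coefficient C (c k j)) \<and>
     (\<forall>K. convex_body K \<longrightarrow> (\<forall>j\<le>DIM('a). (\<lambda>k. c k j K) \<longlonglongrightarrow> parallel_coefficient j K) \<and>
       (\<forall>r>0. (\<lambda>k. \<Sum>j\<le>DIM('a). c k j K * r ^ j) \<longlonglongrightarrow> measure lborel (K + cball 0 r)))"
proof -
  let ?n = "DIM('a)"
  have "\<exists>ws :: 'a list. cball 0 1 \<subseteq> zonotope ws \<and> zonotope ws \<subseteq> cball 0 (1 + 1 / real (Suc k))" for k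
    by (rule zonotope_approximates_ball) simp
  then obtain ws :: "nat \<Rightarrow> 'a list" where ws: "\<And>k. cball 0 1 \<subseteq> zonotope (ws k)" "\<And>k. zonotope (ws k) \<subseteq> cball 0 (1 + 1 / real (Suc k))"
    by metis
  have "\<exists>c. (\<forall>j. steiner_coefficient C (c j)) \<and>
      (\<forall>K. convex_body K \<longrightarrow> (\<forall>r\<ge>0. measure lborel (K + zonotope (map ((*\<^sub>R) r) (ws k))) = (\<Sum>j\<le>?n. c j K * r ^ j)))" for k
  proof -
    obtain c where c: "\<And>j. steiner_coefficient C (c j)" "\<And>j K. j > length (ws k) \<Longrightarrow> convex_body K \<Longrightarrow> c j K = 0"
      "\<And>K r. convex_body K \<Longrightarrow> r \<ge> 0 \<Longrightarrow> measure lborel (K + zonotope (map ((*\<^sub>R) r) (ws k))) = (\<Sum>j\<le>length (ws k). c j K * r ^ j)"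
      using measure_plus_zonotope[OF C, of "ws k"] by metis
    have "measure lborel (K + zonotope (map ((*\<^sub>R) r) (ws k))) = (\<Sum>j\<le>?n. c j K * r ^ j)" if K: "convex_body K" and r: "r \<ge> 0" for K r
    proof -
      \<comment> \<open>The number of segments may grow with \<open>k\<close>; discarding the
        coefficients beyond the dimension gives polynomials of one bounded degree, to which the same
        interpolation weights apply.\<close>
      have z: "c j K = 0" if j: "j > ?n" for j
      proof (cases "j \<le> length (ws k)")
        case True
        show ?thesis
          by (rule zonotope_coefficient_vanishes[OF _ c(3)[OF K] K j True]) (use steiner_coefficientD(1)[OF c(1) K] in auto)
      qed (use c(2) K in auto)
      have "(\<Sum>j\<le>length (ws k). c j K * r ^ j) = (\<Sum>j\<le>max ?n (length (ws k)). c j K * r ^ j)"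
        using c(2) K by (intro sum.mono_neutral_left) auto
      also have "\<dots> = (\<Sum>j\<le>?n. c j K * r ^ j)" using z by (intro sum.mono_neutral_right) auto
      finally show ?thesis using c(3)[OF K r] by simp
    qed
    then show ?thesis using c(1) by blast
  qed
  then obtain c where c: "\<And>k j. steiner_coefficient C (c k j)"
    "\<And>k K r. convex_body K \<Longrightarrow> r \<ge> 0 \<Longrightarrow> measure lborel (K + zonotope (map ((*\<^sub>R) r) (ws k))) = (\<Sum>j\<le>?n. c k j K * r ^ j)"
    by metis
  have lim: "(\<lambda>k. \<Sum>j\<le>?n. c k j K * r ^ j) \<longlonglongrightarrow> measure lborel (K + cball 0 r)" if K: "convex_body K" and r: "r > 0" for K r
  proof (rule tendsto_sandwich[OF _ _ tendsto_const measure_parallel_right_continuous[OF K r]]; intro always_eventually allI)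
    fix k
    have z: "cball 0 r \<subseteq> zonotope (map ((*\<^sub>R) r) (ws k))" "zonotope (map ((*\<^sub>R) r) (ws k)) \<subseteq> cball 0 (r * (1 + 1 / real (Suc k)))"
      using image_mono[OF ws(1)[of k], of "(*\<^sub>R) r"] image_mono[OF ws(2)[of k], of "(*\<^sub>R) r"] r
      unfolding zonotope_scale by (auto simp: cball_scale)
    have b: "convex_body (K + cball 0 r)" "convex_body (K + zonotope (map ((*\<^sub>R) r) (ws k)))" "convex_body (K + cball 0 (r * (1 + 1 / real (Suc k))))"
      using r by (intro convex_body_plus K convex_body_cball convex_body_zonotope; simp)+
    show "measure lborel (K + cball 0 r) \<le> (\<Sum>j\<le>?n. c k j K * r ^ j)"
      using measure_convex_body_mono[OF b(1,2) set_plus_mono2[OF order_refl z(1)]] c(2)[OF K less_imp_le[OF r], of k] by simp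
    show "(\<Sum>j\<le>?n. c k j K * r ^ j) \<le> measure lborel (K + cball 0 (r * (1 + 1 / real (Suc k))))"
      using measure_convex_body_mono[OF b(2,3) set_plus_mono2[OF order_refl z(2)]] c(2)[OF K less_imp_le[OF r], of k] by simp
  qed
  have "(\<lambda>k. c k j K) \<longlonglongrightarrow> parallel_coefficient j K" if K: "convex_body K" and j: "j \<le> ?n" for K j
  proof -
    have "(\<lambda>k. \<Sum>i\<le>?n. steiner_weight ?n j i * (\<Sum>l\<le>?n. c k l K * real (Suc i) ^ l)) \<longlonglongrightarrow> parallel_coefficient j K"
      unfolding parallel_coefficient_def by (intro tendsto_sum tendsto_mult tendsto_const lim K) simp
    then show ?thesis unfolding steiner_weight[OF j] .
  qed
  then show ?thesis using c(1) lim by (intro exI[of _ c]) blast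
qed

text \<open>For each fixed body the coefficients converge along the approximating zonotopes;
  midpoint inequality, monotonicity and the polynomial identity are closed under such
  limits.\<close>

lemma
  fixes C :: "(real ^ 'm::finite) set"
  assumes C: "compact C" "convex C" "C \<noteq> {}" and j: "j \<le> DIM('a::euclidean_space)"
  shows parallel_coefficient_midpoint: "norm \<theta> = 1 \<Longrightarrow>
      parallel_coefficient j (column_image (\<lambda>i. y i + ((s i + t i) / 2) *\<^sub>R \<theta>) C :: 'a set) \<le>
       (parallel_coefficient j (column_image (\<lambda>i. y i + s i *\<^sub>R \<theta>) C) + parallel_coefficient j (column_image (\<lambda>i. y i + t i *\<^sub>R \<theta>) C)) / 2"
    and parallel_coefficient_mono: "convex_body K \<Longrightarrow> convex_body L \<Longrightarrow> K \<subseteq> L \<Longrightarrow> parallel_coefficient j (K :: 'a set) \<le> parallel_coefficient j L"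
    and parallel_volume_polynomial: "convex_body K \<Longrightarrow> r > 0 \<Longrightarrow> measure lborel (K + cball 0 r) = (\<Sum>j\<le>DIM('a). parallel_coefficient j K * r ^ j)"
proof -
  obtain c :: "nat \<Rightarrow> nat \<Rightarrow> 'a set \<Rightarrow> real" where c0: "(\<forall>k j. steiner_coefficient C (c k j)) \<and>
     (\<forall>K. convex_body K \<longrightarrow> (\<forall>j\<le>DIM('a). (\<lambda>k. c k j K) \<longlonglongrightarrow> parallel_coefficient j K) \<and>
       (\<forall>r>0. (\<lambda>k. \<Sum>j\<le>DIM('a). c k j K * r ^ j) \<longlonglongrightarrow> measure lborel (K + cball 0 r)))"
    by (rule exE[OF approximating_coefficients[OF C, where 'a='a]])
  have c: "\<And>k j. steiner_coefficient C (c k j)"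
    "\<And>K j. convex_body K \<Longrightarrow> j \<le> DIM('a) \<Longrightarrow> (\<lambda>k. c k j K) \<longlonglongrightarrow> parallel_coefficient j K"
    "\<And>K r. convex_body K \<Longrightarrow> r > 0 \<Longrightarrow> (\<lambda>k. \<Sum>j\<le>DIM('a). c k j K * r ^ j) \<longlonglongrightarrow> measure lborel (K + cball 0 r)"
    using c0 by simp_all
  note lim = c(2)[OF _ j]
  have z: "K + {0} = K" for K :: "'a set" by (auto simp: set_plus_def)
  show "parallel_coefficient j (column_image (\<lambda>i. y i + ((s i + t i) / 2) *\<^sub>R \<theta>) C :: 'a set) \<le>
       (parallel_coefficient j (column_image (\<lambda>i. y i + s i *\<^sub>R \<theta>) C) + parallel_coefficient j (column_image (\<lambda>i. y i + t i *\<^sub>R \<theta>) C)) / 2"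
    if \<theta>: "norm \<theta> = 1"
  proof (rule LIMSEQ_le)
    show "(\<lambda>k. c k j (column_image (\<lambda>i. y i + ((s i + t i) / 2) *\<^sub>R \<theta>) C)) \<longlonglongrightarrow> parallel_coefficient j (column_image (\<lambda>i. y i + ((s i + t i) / 2) *\<^sub>R \<theta>) C)"
      by (intro lim convex_body_column_image C)
    show "(\<lambda>k. (c k j (column_image (\<lambda>i. y i + s i *\<^sub>R \<theta>) C) + c k j (column_image (\<lambda>i. y i + t i *\<^sub>R \<theta>) C)) / 2)
      \<longlonglongrightarrow> (parallel_coefficient j (column_image (\<lambda>i. y i + s i *\<^sub>R \<theta>) C) + parallel_coefficient j (column_image (\<lambda>i. y i + t i *\<^sub>R \<theta>) C)) / 2"
      by (intro tendsto_intros lim convex_body_column_image C) simp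
    show "\<exists>N. \<forall>k\<ge>N. c k j (column_image (\<lambda>i. y i + ((s i + t i) / 2) *\<^sub>R \<theta>) C)
      \<le> (c k j (column_image (\<lambda>i. y i + s i *\<^sub>R \<theta>) C) + c k j (column_image (\<lambda>i. y i + t i *\<^sub>R \<theta>) C)) / 2"
      using steiner_coefficientD(4)[OF c(1) convex_body_singleton[of 0] \<theta>, of _ j y s t] unfolding z by blast
  qed
  show "parallel_coefficient j K \<le> parallel_coefficient j L" if KL: "convex_body K" "convex_body L" "K \<subseteq> L"
    by (rule LIMSEQ_le[OF lim[OF KL(1)] lim[OF KL(2)]]) (use steiner_coefficientD(2)[OF c(1) KL] in blast)
  show "measure lborel (K + cball 0 r) = (\<Sum>j\<le>DIM('a). parallel_coefficient j K * r ^ j)" if K: "convex_body K" and r: "r > 0"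
  proof (rule LIMSEQ_unique[OF c(3)[OF K r]])
    show "(\<lambda>k. \<Sum>j\<le>DIM('a). c k j K * r ^ j) \<longlonglongrightarrow> (\<Sum>j\<le>DIM('a). parallel_coefficient j K * r ^ j)"
      by (intro tendsto_sum tendsto_mult tendsto_const c(2) K) simp
  qed
qed

lemma intrinsic_volume_eq:
  fixes K :: "'a::euclidean_space set"
  assumes K: "convex_body K" and j: "j \<le> DIM('a)"
  shows "intrinsic_volume j K = parallel_coefficient (DIM('a) - j) K / unit_ball_vol (real (DIM('a) - j))"
proof -
  let ?n = "DIM('a)"
  define w where "w j = unit_ball_vol (real (?n - j))" for j
  have w: "w j > 0" for j unfolding w_def by (rule unit_ball_vol_pos) simp
  define V where "V j = (if j \<le> ?n then parallel_coefficient (?n - j) K / w j else 0)" for j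
  let ?P = "\<lambda>V. (\<forall>j > ?n. V j = 0) \<and> (\<forall>\<epsilon> > 0. measure lborel (outer_parallel K \<epsilon>) = (\<Sum>j\<le>?n. w j * V j * \<epsilon> ^ (?n - j)))"
  have rev: "(\<Sum>j\<le>?n. f (?n - j)) = (\<Sum>j\<le>?n. f j)" for f :: "nat \<Rightarrow> real"
    by (rule sum.reindex_bij_witness[of _ "\<lambda>j. ?n - j" "\<lambda>j. ?n - j"]) auto
  \<comment> \<open>The polynomial formula does not mention \<open>C\<close>, so a singleton in
    dimension one serves to instantiate it.\<close>
  have one: "compact {0::real^1}" "convex {0::real^1}" "{0::real^1} \<noteq> {}" by auto
  have poly: "measure lborel (outer_parallel K \<epsilon>) = (\<Sum>j\<le>?n. parallel_coefficient j K * \<epsilon> ^ j)" if "\<epsilon> > 0" for \<epsilon>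
    unfolding outer_parallel_eq[OF that] by (rule parallel_volume_polynomial[OF one le0 K that])
  have "(THE V. ?P V) = V"
  proof (rule the_equality)
    show "?P V"
    proof (intro conjI allI impI)
      fix \<epsilon> :: real assume e: "\<epsilon> > 0"
      have "(\<Sum>j\<le>?n. w j * V j * \<epsilon> ^ (?n - j)) = (\<Sum>j\<le>?n. parallel_coefficient (?n - j) K * \<epsilon> ^ (?n - j))"
        using w less_imp_neq[OF w] by (intro sum.cong refl) (auto simp: V_def)
      then show "measure lborel (outer_parallel K \<epsilon>) = (\<Sum>j\<le>?n. w j * V j * \<epsilon> ^ (?n - j))"
        unfolding poly[OF e] using rev[of "\<lambda>j. parallel_coefficient j K * \<epsilon> ^ j"] by simp
    qed (simp add: V_def)
    fix U assume U: "?P U"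
    have "U i = V i" for i
    proof (cases "i \<le> ?n")
      case True
      \<comment> \<open>Uniqueness by the interpolation weights: two coefficient sequences with
        equal values at the integers \<open>1, ..., n + 1\<close> coincide. Reversing the summation
        matches \<open>\<epsilon> ^ (n - j)\<close> with increasing powers.\<close>
      have eq: "(\<Sum>k\<le>?n. (w (?n - k) * U (?n - k)) * real (Suc m) ^ k) = (\<Sum>k\<le>?n. parallel_coefficient k K * real (Suc m) ^ k)" for m
      proof -
        have "(\<Sum>k\<le>?n. (w (?n - k) * U (?n - k)) * real (Suc m) ^ k) = (\<Sum>k\<le>?n. w k * U k * real (Suc m) ^ (?n - k))"
          unfolding rev[of "\<lambda>k. (w (?n - k) * U (?n - k)) * real (Suc m) ^ k", symmetric] by (intro sum.cong) auto
        then show ?thesis using U poly[of "real (Suc m)"] by simp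
      qed
      have "w i * U i = parallel_coefficient (?n - i) K"
        using steiner_weight[of "?n - i" ?n "\<lambda>k. w (?n - k) * U (?n - k)"] steiner_weight[of "?n - i" ?n "\<lambda>k. parallel_coefficient k K"] True
        unfolding eq by simp
      then show ?thesis using True w[of i] by (simp add: V_def field_simps)
    qed (use U in \<open>simp add: V_def\<close>)
    then show "U = V" by auto
  qed
  then show ?thesis unfolding intrinsic_volume_def w_def[symmetric] using j by (simp add: V_def)
qed

lemma parallel_coefficient_reflection:
  fixes K :: "'a::euclidean_space set"
  assumes \<theta>: "norm \<theta> = 1" and K: "convex_body K"
  shows "parallel_coefficient j (reflection \<theta> ` K) = parallel_coefficient j K"
proof -
  have "reflection \<theta> ` K + cball 0 r = reflection \<theta> ` (K + cball 0 r)" for r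
  proof -
    have "cball 0 r = reflection \<theta> ` cball 0 r"
    proof (intro equalityI subsetI)
      fix x :: 'a assume "x \<in> cball 0 r"
      then show "x \<in> reflection \<theta> ` cball 0 r"
        by (intro image_eqI[of _ _ "reflection \<theta> x"]) (simp_all add: reflection_reflection[OF \<theta>] norm_reflection[OF \<theta>])
    qed (auto simp: norm_reflection[OF \<theta>])
    then have "reflection \<theta> ` K + cball 0 r = reflection \<theta> ` K + reflection \<theta> ` cball 0 r" by simp
    also have "\<dots> = reflection \<theta> ` (K + cball 0 r)" by (rule set_plus_image_linear[OF linear_reflection])
    finally show ?thesis .
  qed
  then show ?thesis unfolding parallel_coefficient_def
    using measure_reflection[OF \<theta> body_borel[OF convex_body_plus[OF K convex_body_cball]]] by simp
qed

section \<open>Radially symmetric densities and star-shaped sets\<close>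

lemma nn_integral_lborel_scale:
  fixes h :: "'a::euclidean_space \<Rightarrow> ennreal"
  assumes [measurable]: "h \<in> borel_measurable borel" and s: "s > 0"
  shows "(\<integral>\<^sup>+x. h (s *\<^sub>R x) \<partial>lborel) = ennreal (1 / s ^ DIM('a)) * (\<integral>\<^sup>+x. h x \<partial>lborel)"
proof -
  have "(\<integral>\<^sup>+x. h x \<partial>lborel) = (\<integral>\<^sup>+x. h x \<partial>density (distr lborel borel (\<lambda>x. 0 + s *\<^sub>R x)) (\<lambda>_. ennreal (\<bar>s\<bar> ^ DIM('a))))"
    using s by (subst lborel_affine[of s 0]) auto
  also have "\<dots> = ennreal (s ^ DIM('a)) * (\<integral>\<^sup>+x. h (s *\<^sub>R x) \<partial>lborel)"
    using s by (subst nn_integral_density) (auto simp: nn_integral_distr nn_integral_cmult)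
  finally have "ennreal (1 / s ^ DIM('a)) * (\<integral>\<^sup>+x. h x \<partial>lborel) = (ennreal (1 / s ^ DIM('a)) * ennreal (s ^ DIM('a))) * (\<integral>\<^sup>+x. h (s *\<^sub>R x) \<partial>lborel)"
    by (simp add: mult.assoc)
  also have "ennreal (1 / s ^ DIM('a)) * ennreal (s ^ DIM('a)) = 1" using s by (simp add: ennreal_mult[symmetric])
  finally show ?thesis by simp
qed

text \<open>The integral of \<open>1 / s\<close> over \<open>1/2 \<le> s \<le> 1\<close>, namely
  \<open>log 2\<close>; the argument cancels it, for which positivity and finiteness are
  enough.\<close>

definition log_length :: ennreal where
  "log_length = (\<integral>\<^sup>+s. indicator {0<..} s * indicator {1..2} (1 / s) * ennreal (1 / s) \<partial>(lborel :: real measure))"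

lemma log_length_bounds: "0 < log_length" "log_length < \<infinity>"
proof -
  have "(\<integral>\<^sup>+s. indicator {1/2..1} s \<partial>(lborel :: real measure)) \<le> log_length"
    unfolding log_length_def
  proof (rule nn_integral_mono)
    fix s :: real
    show "indicator {1/2..1} s \<le> indicator {0<..} s * indicator {1..2} (1 / s) * ennreal (1 / s)"
      by (auto simp: indicator_def field_simps)
  qed
  moreover have "(\<integral>\<^sup>+s. indicator {1/2..1} s \<partial>(lborel :: real measure)) = ennreal (1/2)" by simp
  ultimately show "0 < log_length" by (metis ennreal_less_zero_iff half_gt_zero less_le_trans zero_less_one)
  have "log_length \<le> (\<integral>\<^sup>+s. 2 * indicator {0..1} s \<partial>(lborel :: real measure))"
    unfolding log_length_def
  proof (rule nn_integral_mono)
    fix s :: real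
    show "indicator {0<..} s * indicator {1..2} (1 / s) * ennreal (1 / s) \<le> 2 * indicator {0..1} s"
    proof (cases "s > 0 \<and> 1 / s \<in> {1..2}")
      case True
      then have "s \<in> {0..1}" by (auto simp: field_simps)
      moreover have "ennreal (1 / s) \<le> ennreal 2" using True by (intro ennreal_leI) auto
      ultimately show ?thesis using True by simp
    qed (auto simp: indicator_def)
  qed
  also have "\<dots> = 2" by (simp add: nn_integral_cmult_indicator)
  also have "\<dots> < \<infinity>" by simp
  finally show "log_length < \<infinity>" .
qed

text \<open>
  Integration along rays without a surface measure: the sphere of directions is replaced by the
  annulus \<open>1 \<le> |x| \<le> 2\<close>, which every ray meets in a set of the same logarithmic length.
\<close>

lemma nn_integral_polar:
  fixes h :: "'a::euclidean_space \<Rightarrow> ennreal"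
  assumes h [measurable]: "h \<in> borel_measurable borel"
  shows "log_length * (\<integral>\<^sup>+x. h x \<partial>lborel) =
    (\<integral>\<^sup>+x. indicator {1..2} (norm x) * (\<integral>\<^sup>+s. indicator {0<..} s * ennreal (s ^ (DIM('a) - 1)) * h (s *\<^sub>R x) \<partial>lborel) \<partial>lborel)"
proof -
  let ?n = "DIM('a)"
  have "(\<integral>\<^sup>+x. indicator {1..2} (norm x) * (\<integral>\<^sup>+s. indicator {0<..} s * ennreal (s ^ (?n - 1)) * h (s *\<^sub>R x) \<partial>lborel) \<partial>lborel)
    = (\<integral>\<^sup>+x. \<integral>\<^sup>+s. indicator {1..2} (norm x) * (indicator {0<..} s * ennreal (s ^ (?n - 1)) * h (s *\<^sub>R x)) \<partial>lborel \<partial>lborel)"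
    by (simp add: nn_integral_cmult)
  also have "\<dots> = (\<integral>\<^sup>+s. \<integral>\<^sup>+x. indicator {1..2} (norm x) * (indicator {0<..} s * ennreal (s ^ (?n - 1)) * h (s *\<^sub>R x)) \<partial>lborel \<partial>lborel)"
    by (rule lborel_pair.Fubini'[symmetric]) (unfold case_prod_beta, measurable)
  also have "\<dots> = (\<integral>\<^sup>+s. \<integral>\<^sup>+x. indicator {0<..} s * ennreal (1 / s) * indicator {1..2} (norm x / s) * h x \<partial>lborel \<partial>lborel)"
  proof (rule nn_integral_cong)
    fix s :: real
    show "(\<integral>\<^sup>+x. indicator {1..2} (norm x) * (indicator {0<..} s * ennreal (s ^ (?n - 1)) * h (s *\<^sub>R x)) \<partial>lborel)
      = (\<integral>\<^sup>+x. indicator {0<..} s * ennreal (1 / s) * indicator {1..2} (norm x / s) * h x \<partial>lborel)"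
    proof (cases "s > 0")
      case True
      have pw: "ennreal (s ^ (?n - 1)) * ennreal (1 / s ^ ?n) = ennreal (1 / s)"
      proof -
        have "s ^ ?n = s ^ (?n - 1) * s" using DIM_positive[where 'a='a] by (metis power_minus_mult)
        then have "s ^ (?n - 1) * (1 / s ^ ?n) = 1 / s" using True by simp
        then show ?thesis using True by (simp add: ennreal_mult[symmetric])
      qed
      have "(\<integral>\<^sup>+x. indicator {1..2} (norm x) * (indicator {0<..} s * ennreal (s ^ (?n - 1)) * h (s *\<^sub>R x)) \<partial>lborel)
        = (\<integral>\<^sup>+x. ennreal (s ^ (?n - 1)) * (indicator {1..2} (norm (s *\<^sub>R x) / s) * h (s *\<^sub>R x)) \<partial>lborel)"
        using True by (intro nn_integral_cong) (simp add: mult_ac)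
      also have "\<dots> = ennreal (s ^ (?n - 1)) * (\<integral>\<^sup>+x. indicator {1..2} (norm (s *\<^sub>R x) / s) * h (s *\<^sub>R x) \<partial>lborel)"
        by (intro nn_integral_cmult) measurable
      also have "(\<integral>\<^sup>+x. indicator {1..2} (norm (s *\<^sub>R x) / s) * h (s *\<^sub>R x) \<partial>lborel)
        = ennreal (1 / s ^ ?n) * (\<integral>\<^sup>+x. indicator {1..2} (norm x / s) * h x \<partial>lborel)"
        using True by (intro nn_integral_lborel_scale[where h = "\<lambda>x. indicator {1..2} (norm x / s) * h x"]) measurable
      also have "ennreal (s ^ (?n - 1)) * (ennreal (1 / s ^ ?n) * (\<integral>\<^sup>+x. indicator {1..2} (norm x / s) * h x \<partial>lborel))
        = ennreal (1 / s) * (\<integral>\<^sup>+x. indicator {1..2} (norm x / s) * h x \<partial>lborel)"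
        by (simp only: mult.assoc[symmetric] pw)
      also have "\<dots> = (\<integral>\<^sup>+x. ennreal (1 / s) * (indicator {1..2} (norm x / s) * h x) \<partial>lborel)"
        by (intro nn_integral_cmult[symmetric]) measurable
      also have "\<dots> = (\<integral>\<^sup>+x. indicator {0<..} s * ennreal (1 / s) * indicator {1..2} (norm x / s) * h x \<partial>lborel)"
        using True by (simp add: mult.assoc)
      finally show ?thesis .
    qed simp
  qed
  also have "\<dots> = (\<integral>\<^sup>+x. \<integral>\<^sup>+s. indicator {0<..} s * ennreal (1 / s) * indicator {1..2} (norm x / s) * h x \<partial>lborel \<partial>lborel)"
    by (rule lborel_pair.Fubini') (unfold case_prod_beta, measurable)
  also have "\<dots> = (\<integral>\<^sup>+x. log_length * h x \<partial>lborel)"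
  proof (rule nn_integral_cong_AE)
    show "AE x in lborel. (\<integral>\<^sup>+s. indicator {0<..} s * ennreal (1 / s) * indicator {1..2} (norm x / s) * h x \<partial>lborel) = log_length * h x"
      using AE_lborel_singleton[of 0]
    proof eventually_elim
      fix x :: 'a assume "x \<noteq> 0"
      define a where "a = norm x"
      have a: "a > 0" using \<open>x \<noteq> 0\<close> by (simp add: a_def)
      have "(\<integral>\<^sup>+s. indicator {0<..} s * ennreal (1 / s) * indicator {1..2} (a / s) \<partial>lborel)
        = ennreal \<bar>a\<bar> * (\<integral>\<^sup>+s. indicator {0<..} (0 + a * s) * ennreal (1 / (0 + a * s)) * indicator {1..2} (a / (0 + a * s)) \<partial>lborel)"
        by (rule nn_integral_real_affine) (measurable, use a in simp)
      also have "\<dots> = (\<integral>\<^sup>+s. ennreal a * (indicator {0<..} (0 + a * s) * ennreal (1 / (0 + a * s)) * indicator {1..2} (a / (0 + a * s))) \<partial>lborel)"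
        using a by (simp add: nn_integral_cmult)
      also have "\<dots> = log_length"
        unfolding log_length_def
      proof (rule nn_integral_cong)
        fix s :: real
        show "ennreal a * (indicator {0<..} (0 + a * s) * ennreal (1 / (0 + a * s)) * indicator {1..2} (a / (0 + a * s))) =
          indicator {0<..} s * indicator {1..2} (1 / s) * ennreal (1 / s)"
        proof (cases "s > 0")
          case True
          have "ennreal a * ennreal (1 / (a * s)) = ennreal (1 / s)" using a True by (simp add: ennreal_mult[symmetric])
          then show ?thesis using a True by (simp add: mult.assoc[symmetric]) (simp add: mult.commute)
        next
          case False
          then have "\<not> a * s > 0" using a by (simp add: zero_less_mult_iff)
          then show ?thesis using False by simp
        qed
      qed
      finally show "(\<integral>\<^sup>+s. indicator {0<..} s * ennreal (1 / s) * indicator {1..2} (norm x / s) * h x \<partial>lborel) = log_length * h x"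
        by (simp add: nn_integral_multc a_def)
    qed
  qed
  also have "\<dots> = log_length * (\<integral>\<^sup>+x. h x \<partial>lborel)" by (rule nn_integral_cmult) simp
  finally show ?thesis by simp
qed

definition ray_integral :: "('a::euclidean_space \<Rightarrow> ennreal) \<Rightarrow> 'a \<Rightarrow> ennreal" where
  "ray_integral h x = (\<integral>\<^sup>+s. indicator {0<..} s * ennreal (s ^ (DIM('a) - 1)) * h (s *\<^sub>R x) \<partial>lborel)"

text \<open>Rays issuing from points of different norm are reparametrized by
  \<open>s \<mapsto> |x| s\<close>; the Jacobian weight produces the factor
  \<open>|x|^(-n)\<close>.\<close>

lemma ray_integral_radial:
  fixes g :: "'a::euclidean_space \<Rightarrow> ennreal"
  assumes [measurable]: "g \<in> borel_measurable borel" and rad: "\<And>x y. norm x = norm y \<Longrightarrow> g x = g y"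
    and x: "x \<noteq> 0" and e: "norm e = 1"
  shows "ray_integral g x = ennreal (1 / norm x ^ DIM('a)) * ray_integral g e"
proof -
  let ?n = "DIM('a)" 
  define a where "a = norm x"
  have a: "a > 0" using x by (simp add: a_def)
  have gx: "g (s *\<^sub>R x) = g ((a * s) *\<^sub>R e)" for s using e by (intro rad) (simp add: a_def abs_mult)
  have "ray_integral g e = ennreal \<bar>a\<bar> * (\<integral>\<^sup>+s. indicator {0<..} (0 + a * s) * ennreal ((0 + a * s) ^ (?n - 1)) * g ((0 + a * s) *\<^sub>R e) \<partial>lborel)"
    unfolding ray_integral_def by (rule nn_integral_real_affine) (measurable, use a in simp)
  also have "\<dots> = ennreal a * (\<integral>\<^sup>+s. ennreal (a ^ (?n - 1)) * (indicator {0<..} s * ennreal (s ^ (?n - 1)) * g (s *\<^sub>R x)) \<partial>lborel)"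
  proof -
    have "indicator {0<..} (0 + a * s) * ennreal ((0 + a * s) ^ (?n - 1)) * g ((0 + a * s) *\<^sub>R e) =
      ennreal (a ^ (?n - 1)) * (indicator {0<..} s * ennreal (s ^ (?n - 1)) * g (s *\<^sub>R x))" for s
    proof (cases "s > 0")
      case True
      then show ?thesis using a by (simp add: gx power_mult_distrib ennreal_mult mult_ac)
    next
      case False
      then have "\<not> a * s > 0" using a by (simp add: zero_less_mult_iff)
      then show ?thesis using False by simp
    qed
    then show ?thesis using a by simp
  qed
  also have "\<dots> = ennreal a * ennreal (a ^ (?n - 1)) * ray_integral g x"
    unfolding ray_integral_def by (subst nn_integral_cmult) (measurable, simp add: mult.assoc)
  also have "ennreal a * ennreal (a ^ (?n - 1)) = ennreal (a ^ ?n)"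
  proof -
    have "a ^ ?n = a * a ^ (?n - 1)" using DIM_positive[where 'a='a] by (metis power_minus_mult mult.commute)
    then show ?thesis using a by (simp add: ennreal_mult)
  qed
  finally have "ennreal (1 / a ^ ?n) * ray_integral g e = (ennreal (1 / a ^ ?n) * ennreal (a ^ ?n)) * ray_integral g x" by (simp add: mult.assoc)
  also have "ennreal (1 / a ^ ?n) * ennreal (a ^ ?n) = 1" using a by (simp add: ennreal_mult[symmetric])
  finally show ?thesis by (simp add: a_def)
qed

text \<open>Both radial densities have the same mass on each ray. If \<open>G\<close> stays within
  radius \<open>R\<close> on a ray, then \<open>g \<le> 1\<close> gives the comparison pointwise. If
  \<open>G\<close> goes beyond \<open>R\<close>, star-shapedness puts the entire part of the ray
  inside the ball into \<open>G\<close>, so the uniform density already has all its mass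
  there.\<close>

theorem radial_density_star_shaped:
  fixes g :: "'a::euclidean_space \<Rightarrow> ennreal" and G :: "'a set"
  assumes g [measurable]: "g \<in> borel_measurable borel" and rad: "\<And>x y. norm x = norm y \<Longrightarrow> g x = g y" and le1: "\<And>x. g x \<le> 1"
    and B: "(\<integral>\<^sup>+x. g x \<partial>lborel) = emeasure lborel (cball (0::'a) R)" and R: "R > 0"
    and G [measurable]: "G \<in> sets borel" and star: "\<And>x s. x \<in> G \<Longrightarrow> 0 \<le> s \<Longrightarrow> s \<le> 1 \<Longrightarrow> s *\<^sub>R x \<in> G"
  shows "(\<integral>\<^sup>+x. g x * indicator G x \<partial>lborel) \<le> (\<integral>\<^sup>+x. indicator (cball 0 R) x * indicator G x \<partial>lborel)"
proof -
  let ?b = "indicator (cball (0::'a) R) :: 'a \<Rightarrow> ennreal"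
  have [measurable]: "cball (0::'a) R \<in> sets borel" by simp
  obtain e :: 'a where "e \<in> Basis" using nonempty_Basis by blast
  then have e: "norm e = 1" by simp
  \<comment> \<open>The integral of \<open>|x|^(-n)\<close> over the annulus. The mass of a radial
    function is its ray integral times \<open>W / log_length\<close>, so equal masses force equal
    ray integrals once \<open>W\<close> is known to be positive and finite.\<close>
  define W where "W = (\<integral>\<^sup>+x. indicator {1..2} (norm x) * ennreal (1 / norm (x::'a) ^ DIM('a)) \<partial>lborel)"
  have polar: "log_length * (\<integral>\<^sup>+x. f x \<partial>lborel) = W * ray_integral f e"
    if f [measurable]: "f \<in> borel_measurable borel" and fr: "\<And>x y. norm x = norm y \<Longrightarrow> f x = f y" for f :: "'a \<Rightarrow> ennreal"
  proof -
    have "log_length * (\<integral>\<^sup>+x. f x \<partial>lborel) = (\<integral>\<^sup>+x. indicator {1..2} (norm x) * ray_integral f x \<partial>lborel)"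
      unfolding ray_integral_def by (rule nn_integral_polar) (rule f)
    also have "\<dots> = (\<integral>\<^sup>+x. indicator {1..2} (norm x) * ennreal (1 / norm (x::'a) ^ DIM('a)) * ray_integral f e \<partial>lborel)"
    proof (rule nn_integral_cong)
      fix x :: 'a
      show "indicator {1..2} (norm x) * ray_integral f x = indicator {1..2} (norm x) * ennreal (1 / norm x ^ DIM('a)) * ray_integral f e"
        by (cases "x = 0") (simp_all add: ray_integral_radial[OF f fr _ e] mult.assoc)
    qed
    also have "\<dots> = W * ray_integral f e" unfolding W_def by (rule nn_integral_multc) measurable
    finally show ?thesis .
  qed
  have br: "?b x = ?b y" if "norm x = norm y" for x y using that by (simp add: indicator_def)
  have bpos: "emeasure lborel (cball (0::'a) R) > 0"
    using R unit_ball_vol_pos[of "real DIM('a)"] by (simp add: emeasure_cball)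
  have WI: "W * ray_integral g e = W * ray_integral ?b e"
    using polar[OF g rad] polar[of ?b, OF _ br] B by simp
  have W0: "W \<noteq> 0" using polar[of ?b, OF _ br] bpos log_length_bounds(1) by auto
  have "W \<le> (\<integral>\<^sup>+x. indicator (cball (0::'a) 2) x \<partial>lborel)"
    unfolding W_def
  proof (rule nn_integral_mono)
    fix x :: 'a
    have "1 / norm x ^ DIM('a) \<le> 1" if "norm x \<ge> 1"
      using one_le_power[OF that, of "DIM('a)"] divide_left_mono[of 1 "norm x ^ DIM('a)" 1] by simp
    then show "indicator {1..2} (norm x) * ennreal (1 / norm x ^ DIM('a)) \<le> indicator (cball 0 2) x"
      by (auto simp: indicator_def)
  qed
  also have "\<dots> < \<infinity>" using emeasure_lborel_cball_finite[of "0::'a" 2] by simp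
  finally have Wf: "W \<noteq> top" by simp
  have Ie: "ray_integral g e = ray_integral ?b e" using WI W0 Wf by (simp add: ennreal_mult_cancel_left)
  have ray: "ray_integral (\<lambda>y. g y * indicator G y) x \<le> ray_integral (\<lambda>y. ?b y * indicator G y) x" if x: "x \<noteq> 0" for x
  proof (cases "\<exists>s>0. s *\<^sub>R x \<in> G \<and> norm (s *\<^sub>R x) > R")
    case False
    show ?thesis
      unfolding ray_integral_def
    proof (rule nn_integral_mono)
      fix s :: real
      show "indicator {0<..} s * ennreal (s ^ (DIM('a) - 1)) * (g (s *\<^sub>R x) * indicator G (s *\<^sub>R x))
        \<le> indicator {0<..} s * ennreal (s ^ (DIM('a) - 1)) * (?b (s *\<^sub>R x) * indicator G (s *\<^sub>R x))"
      proof (cases "s > 0 \<and> s *\<^sub>R x \<in> G")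
        case True
        then have "s *\<^sub>R x \<in> cball 0 R" using False by (auto simp: not_less)
        then show ?thesis using le1[of "s *\<^sub>R x"] True by (intro mult_left_mono) (auto simp: indicator_def)
      qed (auto simp: indicator_def)
    qed
  next
    case True
    then obtain s1 where s1: "s1 > 0" "s1 *\<^sub>R x \<in> G" "norm (s1 *\<^sub>R x) > R" by blast
    have "ray_integral (\<lambda>y. g y * indicator G y) x \<le> ray_integral g x"
      unfolding ray_integral_def by (intro nn_integral_mono mult_left_mono) (auto simp: indicator_def)
    also have "\<dots> = ray_integral ?b x"
      using ray_integral_radial[OF g rad x e] ray_integral_radial[of ?b, OF _ br x e] Ie by simp
    also have "\<dots> = ray_integral (\<lambda>y. ?b y * indicator G y) x"
      unfolding ray_integral_def
    proof (rule nn_integral_cong)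
      fix s :: real
      show "indicator {0<..} s * ennreal (s ^ (DIM('a) - 1)) * ?b (s *\<^sub>R x)
        = indicator {0<..} s * ennreal (s ^ (DIM('a) - 1)) * (?b (s *\<^sub>R x) * indicator G (s *\<^sub>R x))"
      proof (cases "s > 0 \<and> s *\<^sub>R x \<in> cball 0 R")
        case T: True
        then have "s * norm x \<le> R" by auto
        then have "s * norm x < s1 * norm x" using s1 by simp
        then have "s < s1" using x by simp
        then have "(s / s1) *\<^sub>R s1 *\<^sub>R x \<in> G" using star[OF s1(2), of "s / s1"] T s1(1) by simp
        then have "s *\<^sub>R x \<in> G" using s1(1) by simp
        then show ?thesis by simp
      qed (auto simp: indicator_def)
    qed
    finally show ?thesis .
  qed
  have "log_length * (\<integral>\<^sup>+x. g x * indicator G x \<partial>lborel) \<le> log_length * (\<integral>\<^sup>+x. ?b x * indicator G x \<partial>lborel)"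
  proof -
    have "(\<integral>\<^sup>+x. indicator {1..2} (norm x) * ray_integral (\<lambda>y. g y * indicator G y) x \<partial>lborel)
      \<le> (\<integral>\<^sup>+x. indicator {1..2} (norm x) * ray_integral (\<lambda>y. ?b y * indicator G y) x \<partial>lborel)"
    proof (rule nn_integral_mono)
      fix x :: 'a
      show "indicator {1..2} (norm x) * ray_integral (\<lambda>y. g y * indicator G y) x \<le> indicator {1..2} (norm x) * ray_integral (\<lambda>y. ?b y * indicator G y) x"
        using ray[of x] by (cases "x = 0") (auto intro: mult_left_mono)
    qed
    then show "log_length * (\<integral>\<^sup>+x. g x * indicator G x \<partial>lborel) \<le> log_length * (\<integral>\<^sup>+x. ?b x * indicator G x \<partial>lborel)"
      unfolding ray_integral_def
      by (subst (1 2) nn_integral_polar) simp_all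
  qed
  then show ?thesis using log_length_bounds by (subst (asm) ennreal_mult_le_mult_iff) auto
qed

section \<open>The theorem\<close>

lemma column_image_compose_linear:
  assumes "linear f"
  shows "column_image (\<lambda>i. f (x i)) C = f ` column_image x C"
proof -
  have "(\<Sum>i\<in>UNIV. (c $ i) *\<^sub>R f (x i)) = f (\<Sum>i\<in>UNIV. (c $ i) *\<^sub>R x i)" for c
    by (simp add: linear_sum[OF assms] linear_scale[OF assms])
  then show ?thesis unfolding column_image_def by (auto simp: image_def)
qed

text \<open>Membership in the parallel body is an uncountable condition over \<open>C\<close>. A
  countable dense subset \<open>D\<close> and slightly larger radii \<open>r + 1 / (k + 1)\<close>
  with strict inequalities make it countable, hence jointly measurable in the vectors and the point;
  the volume is the measure of its sections.\<close>

lemma measurable_parallel_volume: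
  fixes C :: "(real ^ 'm::finite) set"
  assumes C: "compact C" "convex C" "C \<noteq> {}"
  shows "(\<lambda>x. measure lborel (column_image x C + cball (0::'a::euclidean_space) r)) \<in> borel_measurable lborel_pow"
proof -
  let ?M = "lborel_pow :: ('m \<Rightarrow> 'a) measure"
  obtain D where D: "countable D" "D \<subseteq> C" "C \<subseteq> closure D" using separable by blast
  have cont: "continuous_on UNIV (\<lambda>c. \<Sum>i\<in>UNIV. (c $ i) *\<^sub>R x i)" for x :: "'m \<Rightarrow> 'a"
    by (intro continuous_intros)
  have iff: "y \<in> column_image x C + cball 0 r \<longleftrightarrow>
      (\<forall>k::nat. \<exists>c\<in>D. norm (y - (\<Sum>i\<in>UNIV. (c $ i) *\<^sub>R x i)) < r + 1 / real (Suc k))" (is "?l \<longleftrightarrow> ?r") for x and y :: 'a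
  proof
    assume ?l
    then obtain c z where cz: "c \<in> C" "norm z \<le> r" "y = (\<Sum>i\<in>UNIV. (c $ i) *\<^sub>R x i) + z"
      by (auto simp: column_image_def elim!: set_plus_elim)
    obtain d where d: "\<And>n. d n \<in> D" "d \<longlonglongrightarrow> c" using cz(1) D(3) closure_sequential by blast
    have "(\<lambda>n. \<Sum>i\<in>UNIV. (d n $ i) *\<^sub>R x i) \<longlonglongrightarrow> (\<Sum>i\<in>UNIV. (c $ i) *\<^sub>R x i)"
      by (intro tendsto_intros d)
    then have lim: "(\<lambda>n. norm (y - (\<Sum>i\<in>UNIV. (d n $ i) *\<^sub>R x i))) \<longlonglongrightarrow> norm (y - (\<Sum>i\<in>UNIV. (c $ i) *\<^sub>R x i))"
      by (intro tendsto_norm tendsto_diff tendsto_const)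
    show ?r
    proof
      fix k
      have "norm z < r + 1 / real (Suc k)" using add_le_less_mono[OF cz(2), of 0 "1 / real (Suc k)"] by simp
      then have "norm (y - (\<Sum>i\<in>UNIV. (c $ i) *\<^sub>R x i)) < r + 1 / real (Suc k)" using cz(3) by simp
      then have "\<forall>\<^sub>F n in sequentially. norm (y - (\<Sum>i\<in>UNIV. (d n $ i) *\<^sub>R x i)) < r + 1 / real (Suc k)"
        using order_tendstoD(2)[OF lim] by blast
      then obtain n where "norm (y - (\<Sum>i\<in>UNIV. (d n $ i) *\<^sub>R x i)) < r + 1 / real (Suc k)"
        by (meson eventually_sequentially order_refl)
      then show "\<exists>c\<in>D. norm (y - (\<Sum>i\<in>UNIV. (c $ i) *\<^sub>R x i)) < r + 1 / real (Suc k)" using d(1) by blast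
    qed
  next
    assume R: ?r
    have "infdist y (column_image x C) \<le> r"
    proof (rule field_le_epsilon)
      fix e :: real assume "e > 0"
      then obtain k where k: "1 / real (Suc k) < e" using nat_approx_posE by blast
      obtain c where c: "c \<in> D" "norm (y - (\<Sum>i\<in>UNIV. (c $ i) *\<^sub>R x i)) < r + 1 / real (Suc k)" using R by blast
      have "(\<Sum>i\<in>UNIV. (c $ i) *\<^sub>R x i) \<in> column_image x C" using c(1) D(2) by (auto simp: column_image_def)
      then have "infdist y (column_image x C) \<le> norm (y - (\<Sum>i\<in>UNIV. (c $ i) *\<^sub>R x i))" by (simp add: infdist_le dist_norm[symmetric])
      then show "infdist y (column_image x C) \<le> r + e" using c(2) k by linarith
    qed
    then show ?l using mem_parallel_body_iff[OF convex_body_column_image[OF C]] by blast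
  qed
  have eq: "column_image x C + cball 0 r = {y. \<forall>k::nat. \<exists>c\<in>D. norm (y - (\<Sum>i\<in>UNIV. (c $ i) *\<^sub>R x i)) < r + 1 / real (Suc k)}" for x :: "'m \<Rightarrow> 'a"
    using iff by blast
  have "{p \<in> space (?M \<Otimes>\<^sub>M lborel). \<forall>k::nat. \<exists>c\<in>D. norm (snd p - (\<Sum>i\<in>UNIV. (c $ i) *\<^sub>R fst p i)) < r + 1 / real (Suc k)} \<in> sets (?M \<Otimes>\<^sub>M lborel)"
    using D(1) by measurable
  from lborel.measurable_emeasure_Pair[OF this]
  have "(\<lambda>x. emeasure lborel (column_image x C + cball (0::'a) r)) \<in> borel_measurable ?M"
    unfolding eq by (simp add: vimage_def space_pair_measure)
  then show ?thesis unfolding measure_def by measurable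
qed

lemma intrinsic_volume_column_image:
  fixes C :: "(real ^ 'm::finite) set" and x :: "'m \<Rightarrow> 'a::euclidean_space"
  assumes "compact C" "convex C" "C \<noteq> {}" "j \<le> DIM('a)"
  shows "intrinsic_volume j (column_image x C) = parallel_coefficient (DIM('a) - j) (column_image x C) / unit_ball_vol (real (DIM('a) - j))"
  by (intro intrinsic_volume_eq convex_body_column_image assms)

section \<open>Sublevel sets of the intrinsic volume\<close>

context
  fixes C :: "(real ^ 'm::finite) set" and j :: nat and \<alpha> :: real and A :: "('m \<Rightarrow> 'a::euclidean_space) set"
  assumes C: "compact C" "convex C" "C \<noteq> {}" and j: "j \<le> DIM('a)"
  defines "A \<equiv> {x. intrinsic_volume j (column_image x C) \<le> \<alpha>}"
begin

lemma sublevel_eq: "A = {x. parallel_coefficient (DIM('a) - j) (column_image x C) \<le> \<alpha> * unit_ball_vol (real (DIM('a) - j))}"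
proof -
  have "unit_ball_vol (real (DIM('a) - j)) > 0" by (rule unit_ball_vol_pos) simp
  then show ?thesis unfolding A_def intrinsic_volume_column_image[OF C j] by (simp only: pos_divide_le_eq)
qed

lemma sublevel_sets: "A \<in> sets lborel_pow"
proof -
  note [measurable] = measurable_parallel_volume[OF C]
  have "{x \<in> space lborel_pow. parallel_coefficient (DIM('a) - j) (column_image x C :: 'a set) \<le> \<alpha> * unit_ball_vol (real (DIM('a) - j))} \<in> sets lborel_pow"
    unfolding parallel_coefficient_def by measurable
  then show ?thesis unfolding sublevel_eq by simp
qed

lemma sublevel_midconvex_symmetric: "midconvex_symmetric_along_lines A"
  unfolding midconvex_symmetric_along_lines_def midconvex_symmetric_def
proof (intro allI impI conjI ballI)
  fix \<theta> :: 'a and y :: "'m \<Rightarrow> 'a" assume \<theta>: "norm \<theta> = 1" and y: "\<forall>i. y i \<bullet> \<theta> = 0"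
  let ?c = "\<lambda>t. parallel_coefficient (DIM('a) - j) (column_image (\<lambda>i. y i + t i *\<^sub>R \<theta>) C)"
  fix s assume s: "s \<in> {t. (\<lambda>i. y i + t i *\<^sub>R \<theta>) \<in> A}"
  \<comment> \<open>All vectors are reflected by one linear isometry, so the whole image of
    \<open>C\<close> is reflected and its coefficients do not change.\<close>
  have "(\<lambda>i. y i + (- s i) *\<^sub>R \<theta>) = (\<lambda>i. reflection \<theta> (y i + s i *\<^sub>R \<theta>))"
  proof
    fix i
    have "(y i + s i *\<^sub>R \<theta>) \<bullet> \<theta> = s i" using y \<theta> by (simp add: inner_add_left norm_eq_1)
    moreover have "(2 * s i) *\<^sub>R \<theta> = s i *\<^sub>R \<theta> + s i *\<^sub>R \<theta>" by (metis mult_2 scaleR_left_distrib)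
    ultimately show "y i + (- s i) *\<^sub>R \<theta> = reflection \<theta> (y i + s i *\<^sub>R \<theta>)" by (simp add: reflection_def)
  qed
  then have "?c (\<lambda>i. - s i) = ?c s"
    by (simp only: column_image_compose_linear[OF linear_reflection] parallel_coefficient_reflection[OF \<theta> convex_body_column_image[OF C]])
  then show "(\<lambda>i. - s i) \<in> {t. (\<lambda>i. y i + t i *\<^sub>R \<theta>) \<in> A}" using s unfolding sublevel_eq by simp
  fix t assume t: "t \<in> {t. (\<lambda>i. y i + t i *\<^sub>R \<theta>) \<in> A}"
  have "?c (\<lambda>i. (s i + t i) / 2) \<le> (?c s + ?c t) / 2"
    by (rule parallel_coefficient_midpoint[OF C _ \<theta>]) simp
  then show "(\<lambda>i. (s i + t i) / 2) \<in> {t. (\<lambda>i. y i + t i *\<^sub>R \<theta>) \<in> A}" using s t unfolding sublevel_eq by simp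
qed

text \<open>Shrinking the \<open>i\<close>-th vector by \<open>s\<close> is the same as shrinking
  the \<open>i\<close>-th coefficient. The result stays in \<open>C\<close> as the average of
  \<open>c\<close> and its reflection in the \<open>i\<close>-th coordinate hyperplane, with weights
  \<open>(1 + s) / 2\<close> and \<open>(1 - s) / 2\<close>. The image therefore shrinks, and
  monotonicity applies.\<close>

lemma sublevel_star_shaped:
  assumes unc: "one_unconditional C" and x: "x(i := v) \<in> A" and s: "0 \<le> s" "s \<le> 1"
  shows "x(i := s *\<^sub>R v) \<in> A"
proof -
  have "column_image (x(i := s *\<^sub>R v)) C \<subseteq> column_image (x(i := v)) C"
  proof
    fix p assume "p \<in> column_image (x(i := s *\<^sub>R v)) C"
    then obtain c where c: "c \<in> C" "p = (\<Sum>k\<in>UNIV. (c $ k) *\<^sub>R (x(i := s *\<^sub>R v)) k)" by (auto simp: column_image_def)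
    define c1 where "c1 = (\<chi> k. (if k = i then -1 else 1) * c $ k)"
    have "c1 \<in> C" using unc c(1) unfolding one_unconditional_def c1_def by (auto dest!: bspec[of _ _ c] spec[of _ "\<lambda>k. if k = i then -1 else 1"])
    then have "((1 + s) / 2) *\<^sub>R c + ((1 - s) / 2) *\<^sub>R c1 \<in> C"
      using s c(1) by (intro convexD[OF C(2)]) (auto simp: field_simps)
    moreover have "p = (\<Sum>k\<in>UNIV. ((((1 + s) / 2) *\<^sub>R c + ((1 - s) / 2) *\<^sub>R c1) $ k) *\<^sub>R (x(i := v)) k)"
      unfolding c(2)
    proof (intro sum.cong refl)
      fix k
      have "(1 + s) / 2 * a + (1 - s) / 2 * a = a" "(1 + s) / 2 * a + (1 - s) / 2 * (- 1 * a) = a * s" for a :: real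
        by (auto simp: field_simps)
      then show "(c $ k) *\<^sub>R (x(i := s *\<^sub>R v)) k = ((((1 + s) / 2) *\<^sub>R c + ((1 - s) / 2) *\<^sub>R c1) $ k) *\<^sub>R (x(i := v)) k"
        by (cases "k = i") (simp_all add: c1_def)
    qed
    ultimately show "p \<in> column_image (x(i := v)) C" unfolding column_image_def by blast
  qed
  then have "parallel_coefficient (DIM('a) - j) (column_image (x(i := s *\<^sub>R v)) C) \<le> parallel_coefficient (DIM('a) - j) (column_image (x(i := v)) C)"
    by (intro parallel_coefficient_mono[OF C] convex_body_column_image C) simp
  then show ?thesis using x unfolding sublevel_eq by simp
qed

end

text \<open>The densities are exchanged one at a time: \<open>\<psi> J\<close> carries the ball
  indicator on \<open>J\<close> and \<open>g\<close> elsewhere. Adding \<open>i\<close> to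
  \<open>J\<close> alters only the innermost integral over the \<open>i\<close>-th vector, taken
  over a star-shaped section of \<open>A\<close>.\<close>

lemma replace_radial_densities:
  fixes g :: "'m::finite \<Rightarrow> 'a::euclidean_space \<Rightarrow> ennreal" and A :: "('m \<Rightarrow> 'a) set"
  assumes A [measurable]: "A \<in> sets lborel_pow" and star: "\<And>x i v s. x(i := v) \<in> A \<Longrightarrow> 0 \<le> s \<Longrightarrow> s \<le> 1 \<Longrightarrow> x(i := s *\<^sub>R v) \<in> A"
    and g [measurable]: "\<And>i. g i \<in> borel_measurable borel" and rad: "\<And>i x y. norm x = norm y \<Longrightarrow> g i x = g i y" and le1: "\<And>i x. g i x \<le> 1"
    and int: "\<And>i. (\<integral>\<^sup>+x. g i x \<partial>lborel) = emeasure lborel (cball (0::'a) R)" and R: "R > 0"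
  shows "(\<integral>\<^sup>+x. (\<Prod>i\<in>UNIV. g i (x i)) * indicator A x \<partial>lborel_pow) \<le> (\<integral>\<^sup>+x. (\<Prod>i\<in>UNIV. indicator (cball 0 R) (x i)) * indicator A x \<partial>lborel_pow)"
proof -
  let ?b = "indicator (cball (0::'a) R) :: 'a \<Rightarrow> ennreal"
  have [measurable]: "cball (0::'a) R \<in> sets borel" by simp
  interpret P: product_sigma_finite "\<lambda>_. lborel :: 'a measure" ..
  define \<psi> where "\<psi> J i = (if i \<in> J then ?b else g i)" for J and i :: 'm
  have \<psi>m [measurable]: "\<psi> J i \<in> borel_measurable borel" for J i by (simp add: \<psi>_def)
  define \<Psi> where "\<Psi> J = (\<integral>\<^sup>+x. (\<Prod>i\<in>UNIV. \<psi> J i (x i)) * indicator A x \<partial>lborel_pow)" for J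
  have split: "\<Psi> J = (\<integral>\<^sup>+x. (\<Prod>k\<in>UNIV - {i}. \<psi> J k (x k)) * (\<integral>\<^sup>+v. \<psi> J i v * indicator {v. x(i := v) \<in> A} v \<partial>lborel) \<partial>PiM (UNIV - {i}) (\<lambda>_. lborel))"
    and secm: "x \<in> space (PiM (UNIV - {i}) (\<lambda>_. lborel :: 'a measure)) \<Longrightarrow> {v. x(i := v) \<in> A} \<in> sets borel" for J i x
  proof -
    have ins: "insert i (UNIV - {i}) = UNIV" by auto
    have secm: "{v. x(i := v) \<in> A} \<in> sets borel" if "x \<in> space (PiM (UNIV - {i}) (\<lambda>_. lborel :: 'a measure))" for x
    proof -
      have "(\<lambda>v. x(i := v)) \<in> lborel \<rightarrow>\<^sub>M lborel_pow" using measurable_component_update[OF that, of i] unfolding ins by simp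
      from measurable_sets[OF this A] show ?thesis by (simp add: vimage_def)
    qed
    then show "x \<in> space (PiM (UNIV - {i}) (\<lambda>_. lborel :: 'a measure)) \<Longrightarrow> {v. x(i := v) \<in> A} \<in> sets borel" .
    have m: "(\<lambda>x. (\<Prod>i\<in>UNIV. \<psi> J i (x i)) * indicator A x) \<in> borel_measurable (PiM (insert i (UNIV - {i})) (\<lambda>_. lborel))"
      unfolding ins by measurable
    have "\<Psi> J = (\<integral>\<^sup>+x. (\<integral>\<^sup>+v. (\<Prod>k\<in>UNIV. \<psi> J k ((x(i := v)) k)) * indicator A (x(i := v)) \<partial>lborel) \<partial>PiM (UNIV - {i}) (\<lambda>_. lborel))"
      using P.product_nn_integral_insert[OF _ _ m] unfolding \<Psi>_def ins by simp
    also have "\<dots> = (\<integral>\<^sup>+x. (\<Prod>k\<in>UNIV - {i}. \<psi> J k (x k)) * (\<integral>\<^sup>+v. \<psi> J i v * indicator {v. x(i := v) \<in> A} v \<partial>lborel) \<partial>PiM (UNIV - {i}) (\<lambda>_. lborel))"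
    proof (rule nn_integral_cong)
      fix x :: "'m \<Rightarrow> 'a" assume x: "x \<in> space (PiM (UNIV - {i}) (\<lambda>_. lborel))"
      have "(\<Prod>k\<in>UNIV. \<psi> J k ((x(i := v)) k)) * indicator A (x(i := v)) = (\<Prod>k\<in>UNIV - {i}. \<psi> J k (x k)) * (\<psi> J i v * indicator {v. x(i := v) \<in> A} v)" for v
      proof -
        have "(\<Prod>k\<in>UNIV. \<psi> J k ((x(i := v)) k)) = \<psi> J i v * (\<Prod>k\<in>UNIV - {i}. \<psi> J k ((x(i := v)) k))"
          by (simp add: prod.remove[of UNIV i])
        also have "(\<Prod>k\<in>UNIV - {i}. \<psi> J k ((x(i := v)) k)) = (\<Prod>k\<in>UNIV - {i}. \<psi> J k (x k))" by (intro prod.cong) auto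
        finally show ?thesis by (simp add: indicator_def mult_ac)
      qed
      then show "(\<integral>\<^sup>+v. (\<Prod>k\<in>UNIV. \<psi> J k ((x(i := v)) k)) * indicator A (x(i := v)) \<partial>lborel)
        = (\<Prod>k\<in>UNIV - {i}. \<psi> J k (x k)) * (\<integral>\<^sup>+v. \<psi> J i v * indicator {v. x(i := v) \<in> A} v \<partial>lborel)"
        using secm[OF x] by (simp add: nn_integral_cmult)
    qed
    finally show "\<Psi> J = (\<integral>\<^sup>+x. (\<Prod>k\<in>UNIV - {i}. \<psi> J k (x k)) * (\<integral>\<^sup>+v. \<psi> J i v * indicator {v. x(i := v) \<in> A} v \<partial>lborel) \<partial>PiM (UNIV - {i}) (\<lambda>_. lborel))" .
  qed
  have "\<Psi> {} \<le> \<Psi> J" if "finite J" for J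
    using that
  proof (induction J rule: finite_induct)
    case (insert i J)
    have "\<Psi> J \<le> \<Psi> (insert i J)"
      unfolding split[of _ i]
    proof (rule nn_integral_mono)
      fix x :: "'m \<Rightarrow> 'a" assume x: "x \<in> space (PiM (UNIV - {i}) (\<lambda>_. lborel))"
      have "(\<integral>\<^sup>+v. g i v * indicator {v. x(i := v) \<in> A} v \<partial>lborel) \<le> (\<integral>\<^sup>+v. ?b v * indicator {v. x(i := v) \<in> A} v \<partial>lborel)"
        by (rule radial_density_star_shaped[OF g rad le1 int R secm[OF x]]) (use star in auto)
      moreover have "(\<Prod>k\<in>UNIV - {i}. \<psi> J k (x k)) = (\<Prod>k\<in>UNIV - {i}. \<psi> (insert i J) k (x k))"
        by (intro prod.cong) (auto simp: \<psi>_def)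
      ultimately show "(\<Prod>k\<in>UNIV - {i}. \<psi> J k (x k)) * (\<integral>\<^sup>+v. \<psi> J i v * indicator {v. x(i := v) \<in> A} v \<partial>lborel)
        \<le> (\<Prod>k\<in>UNIV - {i}. \<psi> (insert i J) k (x k)) * (\<integral>\<^sup>+v. \<psi> (insert i J) i v * indicator {v. x(i := v) \<in> A} v \<partial>lborel)"
        using insert.hyps(2) by (simp add: \<psi>_def mult_left_mono)
    qed
    then show ?case using insert.IH by (rule order_trans[rotated])
  qed simp
  then have "\<Psi> {} \<le> \<Psi> UNIV" by simp
  then show ?thesis by (simp add: \<Psi>_def \<psi>_def)
qed

lemma unit_volume_ball_eq:
  obtains R where "R > 0" "(unit_volume_ball :: 'a::euclidean_space set) = cball 0 R" "emeasure lborel (cball (0::'a) R) = 1"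
proof -
  have cb: "emeasure lborel (cball (0::'a) r) = emeasure lborel (ball (0::'a) r)" if "r \<ge> 0" for r
    using that by (simp add: emeasure_ball emeasure_cball)
  obtain R where R: "R \<ge> 0" "emeasure lborel (ball (0::'a) R) = 1" using ball_of_measure[of 1, where 'a='a] by auto
  have R1: "emeasure lborel (cball (0::'a) R) = 1" using R cb by simp
  have "R \<noteq> 0" using R(2) by auto
  then have R0: "R > 0" using R(1) by simp
  have "(unit_volume_ball :: 'a set) = cball 0 R"
    unfolding unit_volume_ball_def
  proof (rule the_equality)
    show "\<exists>r\<ge>0. cball (0::'a) R = cball 0 r \<and> emeasure lborel (cball (0::'a) R) = 1" using R(1) R1 by blast
    fix S :: "'a set" assume "\<exists>r\<ge>0. S = cball 0 r \<and> emeasure lborel S = 1"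
    then obtain r where r: "r \<ge> 0" "S = cball 0 r" "emeasure lborel S = 1" by blast
    have "emeasure lborel (ball (0::'a) r) = emeasure lborel (ball (0::'a) R)" using cb[OF r(1)] r(2,3) R(2) by simp
    then have "r \<le> R" "R \<le> r" using ball_radius_mono[OF r(1) R(1), where 'a='a] ball_radius_mono[OF R(1) r(1), where 'a='a] by simp_all
    then show "S = cball 0 R" using r(2) by simp
  qed
  then show ?thesis using that R0 R1 by blast
qed

text \<open>The injection \<open>\<iota>\<close> selects one of the three blocks of the jointly
  independent family, so the joint law of the block is the product of its marginals; that product is
  then identified with a density with respect to \<open>lborel_pow\<close>.\<close>

lemma independent_densities:
  fixes Y :: "'m::finite \<Rightarrow> 'w \<Rightarrow> 'a::euclidean_space" and d :: "'m \<Rightarrow> 'a \<Rightarrow> ennreal"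
  assumes M: "prob_space M" and ind: "prob_space.indep_vars M (\<lambda>_. borel) U UNIV" and \<iota>: "inj \<iota>" and Y: "\<And>i. Y i = U (\<iota> i)"
    and d [measurable]: "\<And>i. d i \<in> borel_measurable borel" and dens: "\<And>i. distr M borel (Y i) = density lborel (d i)"
    and A [measurable]: "A \<in> sets lborel_pow"
  shows "(\<lambda>\<omega> i. Y i \<omega>) \<in> M \<rightarrow>\<^sub>M lborel_pow" "ennreal (measure M {\<omega> \<in> space M. (\<lambda>i. Y i \<omega>) \<in> A}) = (\<integral>\<^sup>+x. (\<Prod>i\<in>UNIV. d i (x i)) * indicator A x \<partial>lborel_pow)"
proof -
  interpret prob_space M by fact
  interpret L: product_sigma_finite "\<lambda>_. lborel :: 'a measure" ..
  have Ym [measurable]: "Y i \<in> borel_measurable M" for i using ind unfolding Y by (auto simp: indep_vars_def)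
  have "prob_space (density lborel (d i))" for i unfolding dens[symmetric] by (rule prob_space_distr) simp
  then interpret D: product_sigma_finite "\<lambda>i. density lborel (d i)"
    by (simp add: product_sigma_finite_def prob_space_imp_sigma_finite)
  show Yp [measurable]: "(\<lambda>\<omega> i. Y i \<omega>) \<in> M \<rightarrow>\<^sub>M lborel_pow" by (rule measurable_PiM_single') (auto simp: space_PiM)
  have sets_eq: "sets (PiM UNIV (\<lambda>i. density lborel (d i))) = sets lborel_pow" by (intro sets_PiM_cong) auto
  have "distr M lborel_pow (\<lambda>\<omega> i. Y i \<omega>) = PiM UNIV (\<lambda>i. density lborel (d i))"
  proof (rule D.PiM_eqI)
    fix B :: "'m \<Rightarrow> 'a set" assume "\<And>i. i \<in> UNIV \<Longrightarrow> B i \<in> sets (density lborel (d i))"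
    then have B: "\<And>i. B i \<in> sets borel" by simp
    have "emeasure (distr M lborel_pow (\<lambda>\<omega> i. Y i \<omega>)) (Pi\<^sub>E UNIV B) = emeasure M (\<Inter>k\<in>range \<iota>. U k -` B (inv \<iota> k) \<inter> space M)"
    proof -
      have "Pi\<^sub>E UNIV B \<in> sets lborel_pow" using B by (intro sets_PiM_I_finite) auto
      moreover have "(\<lambda>\<omega> i. Y i \<omega>) -` Pi\<^sub>E UNIV B \<inter> space M = (\<Inter>k\<in>range \<iota>. U k -` B (inv \<iota> k) \<inter> space M)"
        using \<iota> by (auto simp: PiE_UNIV_domain Y)
      ultimately show ?thesis using Yp by (simp add: emeasure_distr)
    qed
    also have "\<dots> = ennreal (\<Prod>k\<in>range \<iota>. prob (U k -` B (inv \<iota> k) \<inter> space M))"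
      unfolding emeasure_eq_measure by (subst indep_varsD[OF ind]) (auto simp: B)
    also have "(\<Prod>k\<in>range \<iota>. prob (U k -` B (inv \<iota> k) \<inter> space M)) = (\<Prod>i\<in>UNIV. prob (Y i -` B i \<inter> space M))"
      using \<iota> by (subst prod.reindex) (auto simp: Y)
    also have "ennreal \<dots> = (\<Prod>i\<in>UNIV. emeasure (distr M borel (Y i)) (B i))"
      using B by (simp add: prod_ennreal[symmetric] emeasure_distr emeasure_eq_measure)
    finally show "emeasure (distr M lborel_pow (\<lambda>\<omega> i. Y i \<omega>)) (Pi\<^sub>E UNIV B) = (\<Prod>i\<in>UNIV. emeasure (density lborel (d i)) (B i))"
      unfolding dens .
  qed (simp_all add: sets_eq)
  moreover have "density lborel_pow (\<lambda>x. \<Prod>i\<in>UNIV. d i (x i)) = PiM UNIV (\<lambda>i. density lborel (d i))"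
  proof (rule D.PiM_eqI)
    fix B :: "'m \<Rightarrow> 'a set" assume "\<And>i. i \<in> UNIV \<Longrightarrow> B i \<in> sets (density lborel (d i))"
    then have B [measurable]: "\<And>i. B i \<in> sets borel" by simp
    have "emeasure (density lborel_pow (\<lambda>x. \<Prod>i\<in>UNIV. d i (x i))) (Pi\<^sub>E UNIV B)
      = (\<integral>\<^sup>+x. (\<Prod>i\<in>UNIV. d i (x i)) * indicator (Pi\<^sub>E UNIV B) x \<partial>lborel_pow)"
      using B by (intro emeasure_density) (auto intro!: sets_PiM_I_finite)
    also have "\<dots> = (\<integral>\<^sup>+x. (\<Prod>i\<in>UNIV. d i (x i) * indicator (B i) (x i)) \<partial>lborel_pow)"
    proof (rule nn_integral_cong)
      fix x :: "'m \<Rightarrow> 'a"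
      have "(\<Prod>i\<in>UNIV. indicator (B i) (x i) :: ennreal) = indicator (Pi\<^sub>E UNIV B) x" by (auto simp: indicator_def prod_zero_iff PiE_UNIV_domain Pi_iff)
      then show "(\<Prod>i\<in>UNIV. d i (x i)) * indicator (Pi\<^sub>E UNIV B) x = (\<Prod>i\<in>UNIV. d i (x i) * indicator (B i) (x i))" by (simp add: prod.distrib)
    qed
    also have "\<dots> = (\<Prod>i\<in>UNIV. \<integral>\<^sup>+x. d i x * indicator (B i) x \<partial>lborel)" by (intro L.product_nn_integral_prod) auto
    also have "\<dots> = (\<Prod>i\<in>UNIV. emeasure (density lborel (d i)) (B i))" using B by (intro prod.cong refl) (subst emeasure_density, auto)
    finally show "emeasure (density lborel_pow (\<lambda>x. \<Prod>i\<in>UNIV. d i (x i))) (Pi\<^sub>E UNIV B) = (\<Prod>i\<in>UNIV. emeasure (density lborel (d i)) (B i))" .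
  qed (simp_all add: sets_eq)
  ultimately have "emeasure (distr M lborel_pow (\<lambda>\<omega> i. Y i \<omega>)) A = emeasure (density lborel_pow (\<lambda>x. \<Prod>i\<in>UNIV. d i (x i))) A" by simp
  then show "ennreal (measure M {\<omega> \<in> space M. (\<lambda>i. Y i \<omega>) \<in> A}) = (\<integral>\<^sup>+x. (\<Prod>i\<in>UNIV. d i (x i)) * indicator A x \<partial>lborel_pow)"
    by (simp add: emeasure_distr emeasure_density emeasure_eq_measure vimage_def Int_def conj_commute)
qed

theorem theorem5p1:
  fixes M :: "'w measure"
    and f :: "'m::finite \<Rightarrow> real ^ 'n::finite \<Rightarrow> real"
    and X Xs Z :: "'m \<Rightarrow> 'w \<Rightarrow> real ^ 'n"
    and C :: "(real ^ 'm) set"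
    and j :: nat
  assumes "prob_space M"
    and "\<And>i. prob_density (f i)"
    and "prob_space.indep_vars M (\<lambda>_. borel) (case_sum X (case_sum Xs Z)) (UNIV :: ('m + 'm + 'm) set)"
    and "\<And>i. distributed M lborel (X i) (\<lambda>x. ennreal (f i x))"
    and "\<And>i. distributed M lborel (Xs i) (symm_decr_rearr (f i))"
    and "\<And>i. distr M borel (Z i) = uniform_measure lborel unit_volume_ball"
    and "compact C" and "convex C"
    and "1 \<le> j" and "j \<le> CARD('n)"
  shows "(\<forall>\<alpha>\<ge>0. measure M {\<omega> \<in> space M. intrinsic_volume j (column_image (\<lambda>i. X i \<omega>) C) > \<alpha>}
                 \<ge> measure M {\<omega> \<in> space M. intrinsic_volume j (column_image (\<lambda>i. Xs i \<omega>) C) > \<alpha>})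
       \<and> (one_unconditional C \<and> (\<forall>i. esssup lborel (\<lambda>x. ereal \<bar>f i x\<bar>) \<le> 1) \<longrightarrow>
            (\<forall>\<alpha>\<ge>0. measure M {\<omega> \<in> space M. intrinsic_volume j (column_image (\<lambda>i. X i \<omega>) C) > \<alpha>}
                   \<ge> measure M {\<omega> \<in> space M. intrinsic_volume j (column_image (\<lambda>i. Z i \<omega>) C) > \<alpha>}))"
proof (cases "C = {}")
  case True
  \<comment> \<open>For empty \<open>C\<close> the image is empty whatever the vectors are, so the
    events being compared coincide.\<close>
  then have "column_image x C = {}" for x :: "'m \<Rightarrow> real ^ 'n" by (simp add: column_image_def)
  then show ?thesis by simp
next
  case False
  interpret prob_space M by fact
  note C = assms(7,8) False
  have j: "j \<le> DIM(real ^ 'n)" using assms(10) by simp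
  define A where "A \<alpha> = {x :: 'm \<Rightarrow> real ^ 'n. intrinsic_volume j (column_image x C) \<le> \<alpha>}" for \<alpha>
  have Am: "A \<alpha> \<in> sets lborel_pow" for \<alpha> unfolding A_def by (rule sublevel_sets[OF C j])
  have msA: "midconvex_symmetric_along_lines (A \<alpha>)" for \<alpha> unfolding A_def by (rule sublevel_midconvex_symmetric[OF C j])
  obtain R where R: "R > 0" "(unit_volume_ball :: (real ^ 'n) set) = cball 0 R" "emeasure lborel (cball (0 :: real ^ 'n) R) = 1"
    by (rule unit_volume_ball_eq)
  let ?g = "\<lambda>i. symm_decr_rearr (f i)" and ?b = "indicator (cball (0 :: real ^ 'n) R) :: _ \<Rightarrow> ennreal"
  have gm [measurable]: "?g i \<in> borel_measurable borel" for i using assms(5)[of i] by (simp add: distributed_def)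
  have fm [measurable]: "(\<lambda>x. ennreal (f i x)) \<in> borel_measurable borel" for i using assms(4)[of i] by (simp add: distributed_def)
  have bm [measurable]: "?b \<in> borel_measurable borel" by (intro borel_measurable_indicator) simp
  have distr_lborel: "distr M borel W = distr M lborel W" for W :: "'w \<Rightarrow> real ^ 'n" by (rule distr_cong) auto
  have dX: "distr M borel (X i) = density lborel (\<lambda>x. ennreal (f i x))" for i
    using assms(4)[of i] by (simp add: distributed_def distr_lborel)
  have dXs: "distr M borel (Xs i) = density lborel (?g i)" for i
    using assms(5)[of i] by (simp add: distributed_def distr_lborel)
  have dZ: "distr M borel (Z i) = density lborel ?b" for i
    unfolding assms(6) R(2) uniform_measure_def R(3) by (simp add: divide_ennreal_def)
  have injs: "inj (Inl :: 'm \<Rightarrow> 'm + 'm + 'm)" "inj (\<lambda>i :: 'm. Inr (Inl i) :: 'm + 'm + 'm)" "inj (\<lambda>i :: 'm. Inr (Inr i) :: 'm + 'm + 'm)"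
    by (auto simp: inj_def)
  have PX: "(\<lambda>\<omega> i. X i \<omega>) \<in> M \<rightarrow>\<^sub>M lborel_pow"
    "ennreal (prob {\<omega> \<in> space M. (\<lambda>i. X i \<omega>) \<in> A \<alpha>}) = (\<integral>\<^sup>+x. (\<Prod>i\<in>UNIV. ennreal (f i (x i))) * indicator (A \<alpha>) x \<partial>lborel_pow)" for \<alpha>
    by (rule independent_densities[OF assms(1,3) injs(1) _ fm dX Am], simp)+
  have PXs: "(\<lambda>\<omega> i. Xs i \<omega>) \<in> M \<rightarrow>\<^sub>M lborel_pow"
    "ennreal (prob {\<omega> \<in> space M. (\<lambda>i. Xs i \<omega>) \<in> A \<alpha>}) = (\<integral>\<^sup>+x. (\<Prod>i\<in>UNIV. ?g i (x i)) * indicator (A \<alpha>) x \<partial>lborel_pow)" for \<alpha>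
    by (rule independent_densities[OF assms(1,3) injs(2) _ gm dXs Am], simp)+
  have PZ: "(\<lambda>\<omega> i. Z i \<omega>) \<in> M \<rightarrow>\<^sub>M lborel_pow"
    "ennreal (prob {\<omega> \<in> space M. (\<lambda>i. Z i \<omega>) \<in> A \<alpha>}) = (\<integral>\<^sup>+x. (\<Prod>i\<in>UNIV. ?b (x i)) * indicator (A \<alpha>) x \<partial>lborel_pow)" for \<alpha>
    by (rule independent_densities[OF assms(1,3) injs(3) _ bm dZ Am], simp)+
  \<comment> \<open>The strict events are complements of the sublevel events, so upper bounds for
    \<open>A \<alpha>\<close> reverse into the lower bounds claimed.\<close>
  have compl: "prob {\<omega> \<in> space M. intrinsic_volume j (column_image (\<lambda>i. Y i \<omega>) C) > \<alpha>} = 1 - prob {\<omega> \<in> space M. (\<lambda>i. Y i \<omega>) \<in> A \<alpha>}"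
    if "(\<lambda>\<omega> i. Y i \<omega>) \<in> M \<rightarrow>\<^sub>M lborel_pow" for Y :: "'m \<Rightarrow> 'w \<Rightarrow> real ^ 'n" and \<alpha>
  proof -
    have "(\<lambda>\<omega> i. Y i \<omega>) -` A \<alpha> \<inter> space M \<in> sets M" by (rule measurable_sets[OF that Am])
    moreover have "(\<lambda>\<omega> i. Y i \<omega>) -` A \<alpha> \<inter> space M = {\<omega> \<in> space M. (\<lambda>i. Y i \<omega>) \<in> A \<alpha>}" by auto
    ultimately have "prob (space M - {\<omega> \<in> space M. (\<lambda>i. Y i \<omega>) \<in> A \<alpha>}) = 1 - prob {\<omega> \<in> space M. (\<lambda>i. Y i \<omega>) \<in> A \<alpha>}"
      by (intro prob_compl) simp
    moreover have "space M - {\<omega> \<in> space M. (\<lambda>i. Y i \<omega>) \<in> A \<alpha>} = {\<omega> \<in> space M. intrinsic_volume j (column_image (\<lambda>i. Y i \<omega>) C) > \<alpha>}"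
      by (auto simp: A_def)
    ultimately show ?thesis by simp
  qed
  have first: "prob {\<omega> \<in> space M. (\<lambda>i. X i \<omega>) \<in> A \<alpha>} \<le> prob {\<omega> \<in> space M. (\<lambda>i. Xs i \<omega>) \<in> A \<alpha>}" for \<alpha>
  proof -
    have "ennreal (prob {\<omega> \<in> space M. (\<lambda>i. X i \<omega>) \<in> A \<alpha>}) \<le> ennreal (prob {\<omega> \<in> space M. (\<lambda>i. Xs i \<omega>) \<in> A \<alpha>})"
      unfolding PX(2) PXs(2) by (rule rearrangement_densities[OF Am msA assms(2)])
    then show ?thesis by (simp add: ennreal_le_iff)
  qed
  have second: "prob {\<omega> \<in> space M. (\<lambda>i. Xs i \<omega>) \<in> A \<alpha>} \<le> prob {\<omega> \<in> space M. (\<lambda>i. Z i \<omega>) \<in> A \<alpha>}"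
    if unc: "one_unconditional C" and le1: "\<And>i. esssup lborel (\<lambda>x. ereal \<bar>f i x\<bar>) \<le> 1" for \<alpha>
  proof -
    \<comment> \<open>The total mass of the rearranged density is read off from its being the
      density of \<open>Xs i\<close>, with no recourse to equimeasurability.\<close>
    have int: "(\<integral>\<^sup>+x. ?g i x \<partial>lborel) = emeasure lborel (cball (0 :: real ^ 'n) R)" for i
    proof -
      have "Xs i \<in> borel_measurable M" using assms(5)[of i] by (simp add: distributed_def)
      then have "emeasure (distr M borel (Xs i)) UNIV = 1" by (simp add: emeasure_distr emeasure_space_1)
      then show ?thesis unfolding dXs R(3) by (simp add: emeasure_density)
    qed
    have "ennreal (prob {\<omega> \<in> space M. (\<lambda>i. Xs i \<omega>) \<in> A \<alpha>}) \<le> ennreal (prob {\<omega> \<in> space M. (\<lambda>i. Z i \<omega>) \<in> A \<alpha>})"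
      unfolding PXs(2) PZ(2)
    proof (rule replace_radial_densities[OF Am _ gm _ _ int R(1)])
      show "x(i := s *\<^sub>R v) \<in> A \<alpha>" if "x(i := v) \<in> A \<alpha>" "0 \<le> s" "s \<le> 1" for x i v s
        using sublevel_star_shaped[OF C j unc _ that(2,3)] that(1) unfolding A_def by blast
      show "?g i x = ?g i y" if "norm x = norm y" for i x y by (rule symm_decr_rearr_radial[OF assms(2) that])
      show "?g i x \<le> 1" for i x by (rule symm_decr_rearr_le_1[OF assms(2) le1])
    qed
    then show ?thesis by (simp add: ennreal_le_iff)
  qed
  show ?thesis
    unfolding compl[OF PX(1)] compl[OF PXs(1)] compl[OF PZ(1)]
    using first second by (fastforce intro: order_trans)
qed

end
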